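(* There does not exist a primitive substitutive tiling of the hyperbolic plane $\mathbb{H}^2$. That is: there is no tiling of $\mathbb{H}^2$ whose associated labelled $2$-complex can be obtained by inflation from a primitive topological substitution.
   Context: **Tilings.** Let $\mathbb{M}$ be the Euclidean plane $\mathbb{E}^2$ or the hyperbolic plane $\mathbb{H}^2$, and let $\Gamma$ be a subgroup of the isometry group $\mathrm{Isom}(\mathbb{M})$. A tile is a compact subset of $\mathbb{M}$ which is the closure of its interior; a labelled tile is a pair (tile, element of a finite set of labels). Two labelled tiles are equivalent if they have the same label and one is the image of the other under an element of $\Gamma$; an equivalence class is called a prototile. A tiling $(\mathbb{M},\Gamma,\mathcal{P},\mathsf{T})$ modelled on a finite set $\mathcal{P}$ of prototiles is a set $\mathsf{T}$ of (labelled) tiles, each belonging to an element of $\mathcal{P}$, whose union is $\mathbb{M}$ and such that distinct tiles of $\mathsf{T}$ have disjoint interiors. **Complex of a tiling.** Assume the tiles are connected. The $2$-complex associated to the tiling has as vertices the points of $\mathbb{M}$ belonging to at least three tiles; its edges are the closures of the connected components (open arcs) of $\bigcup_{T\in\mathsf{T}}\partial T$ minus the vertices; its faces are the tiles. Each face is labelled by its prototile. **Topological pre-substitutions.** A topological polygon is a $2$-dimensional CW-complex, homeomorphic to a closed disc, made of one face, $k$ edges and $k$ vertices for some $k\ge 3$, whose $1$-skeleton is the boundary circle of the disc. Let $\mathcal{T}=\{T_1,\dots,T_d\}$ be a finite set of topological polygons (called tiles). A patch modelled on $\mathcal{T}$ is a $2$-CW-complex $P$ homeomorphic to the closed disc such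 that each closed face $f$ of $P$ comes with a tile $\mathrm{type}(f)\in\mathcal{T}$ and a homeomorphism $\tau_f:f\to \mathrm{type}(f)$ respecting the cellular structure. An edge of $P$ not contained in the boundary circle of $P$ is interior; it is contained in exactly two closed faces. A topological pre-substitution $(\mathcal{T},\sigma(\mathcal{T}),\sigma)$ consists of such a set $\mathcal{T}$, a set $\sigma(\mathcal{T})=\{\sigma(T_1),\dots,\sigma(T_d)\}$ of patches modelled on $\mathcal{T}$, and a homeomorphism $\sigma:\bigsqcup_i T_i\to\bigsqcup_i\sigma(T_i)$ restricting to homeomorphisms $T_i\to\sigma(T_i)$ which send each vertex of $T_i$ to a vertex of the boundary of $\sigma(T_i)$. Thus $\sigma$ maps an edge of $T_i$ to an edge path in the boundary of $\sigma(T_i)$. **Iteration and compatibility.** A pair $(e,e')$ of edges of tiles of $\mathcal{T}$ is balanced if the edge paths $\sigma(e)$, $\sigma(e')$ have the same number of edges. An interior edge $e$ of a patch, adjacent to the faces $f,f'$, is balanced if $(\tau_f(e),\tau_{f'}(e))$ is balanced. Every pre-substitution is $1$-compatible. For $p\ge2$, $\sigma$ is $p$-compatible if it is $(p-1)$-compatible and, for every $i$, every interior edge of $\sigma^{p-1}(T_i)$ is balanced; in that case $\sigma^p(T_i)$ is the patch obtained from $\bigsqcup_{f\text{ face of }\sigma^{p-1}(T_i)}\sigma(\mathrm{type}(f))$ by gluing edge to edge, whenever $f,f'$ are adjacent along an edge $e$, the patches $\sigma(\mathrm{type}(f))$ and $\sigma(\mathrm{type}(f'))$ along $\sigma(\tau_f(e))$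 and $\sigma(\tau_{f'}(e))$. The map $\sigma$ induces homeomorphisms $\sigma^{p-1}(T_i)\to\sigma^p(T_i)$ sending vertices to vertices; by composition one gets $\sigma^p:T_i\to\sigma^p(T_i)$, and $\sigma^p$ is again a pre-substitution. $\sigma$ is compatible if it is $p$-compatible for all $p$. **Core, substitutions, inflation.** The thick boundary $\mathsf{B}(P)$ of a patch $P$ is the subcomplex consisting of the closed faces containing at least one vertex of $\partial P$; the core $\mathrm{Core}(P)$ is the closure of $P\smallsetminus \mathsf{B}(P)$. A topological substitution is a compatible pre-substitution with the core property: for some $i$ and $k$, $\mathrm{Core}(\sigma^k(T_i))\ne\emptyset$. If $T\in\mathcal{T}$ is such that the core of $\sigma(T)$ contains a face of type $T$, one identifies $T$ with such a face, hence inductively $\sigma^k(T)$ with a subcomplex of $\sigma^{k+1}(T)$, and sets $\sigma^\infty(T)=\bigcup_{k\ge0}\sigma^k(T)$, a complex homeomorphic to the plane whose faces are labelled by their types; $\sigma^\infty(T)$ is said to be obtained by inflation from $\sigma$. A tiling is substitutive if its associated labelled complex can be obtained by inflation from a topological substitution (labels of faces, i.e. prototiles, corresponding to types). **Primitivity.** A patch $P$ is separated if there is a (closed) tile $T$ of $P$ such that $P\smallsetminus T$ is not connected. A topological substitution is pure primitive if (i) for all $T\in\mathcal{T}$, the patches $\sigma(T)$ and $\sigma^2(T)$ are not separated, and (ii) for all $T,T'\in\mathcal{T}$, the core of $\sigma(T)$ contains a face of type $T'$. It is primitive if $\sigma^k$ is pure primitive for some integer $k\geq 1$. *)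

theory Defs
  imports "HOL-Analysis.Analysis" "HOL-Algebra.Bij"
begin

section \<open>The hyperbolic plane\<close>

text \<open>
  The upper half-plane model. The absolute value in the distance is irrelevant on the half-plane;
  it makes the distance nonnegative on the whole type, as the locale \<^locale>\<open>Metric_space\<close> demands.
\<close>

definition hyp_plane :: "complex set" where
  "hyp_plane = {z. Im z > 0}"

definition hyp_dist :: "complex \<Rightarrow> complex \<Rightarrow> real" where
  "hyp_dist z w = arcosh (1 + (cmod (z - w))\<^sup>2 / (2 * \<bar>Im z * Im w\<bar>))"

lemma Metric_space_hyp: "Metric_space hyp_plane hyp_dist"
proof
  fix x y :: complex
  have ge1: "1 + (cmod (x - y))\<^sup>2 / (2 * \<bar>Im x * Im y\<bar>) \<ge> 1" by simp
  show "0 \<le> hyp_dist x y"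
    unfolding hyp_dist_def using ge1 by (rule arcosh_nonneg_real)
  show "hyp_dist x y = hyp_dist y x"
    by (simp add: hyp_dist_def norm_minus_commute mult.commute)
next
  fix x y :: complex
  assume "x \<in> hyp_plane" "y \<in> hyp_plane"
  then have pos: "Im x > 0" "Im y > 0" by (auto simp: hyp_plane_def)
  have ge1: "1 + (cmod (x - y))\<^sup>2 / (2 * \<bar>Im x * Im y\<bar>) \<ge> 1" by simp
  have "hyp_dist x y = 0 \<longleftrightarrow> 1 + (cmod (x - y))\<^sup>2 / (2 * \<bar>Im x * Im y\<bar>) = 1"
    unfolding hyp_dist_def
    using ge1 by (rule arcosh_eq_0_iff_real)
  also have "\<dots> \<longleftrightarrow> x = y" using pos by auto
  finally show "hyp_dist x y = 0 \<longleftrightarrow> x = y" .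
next
  fix x y z :: complex
  assume "x \<in> hyp_plane" "y \<in> hyp_plane" "z \<in> hyp_plane"
  then have pos: "Im x > 0" "Im y > 0" "Im z > 0" by (auto simp: hyp_plane_def)
  define a where "a u = 1 / Im u" for u
  define b where "b u = Re u / Im u" for u
  define c where "c u = ((Re u)\<^sup>2 + (Im u)\<^sup>2) / Im u" for u
  define ch where "ch u v = 1 + (cmod (u - v))\<^sup>2 / (2 * \<bar>Im u * Im v\<bar>)" for u v
  have ge1: "ch u v \<ge> 1" for u v by (simp add: ch_def)
  have norm1: "a u * c u - (b u)\<^sup>2 = 1" if "Im u > 0" for u
    using that by (simp add: a_def b_def c_def field_simps power2_eq_square)
  have form: "ch u v = (a u * c v + c u * a v) / 2 - b u * b v" if "Im u > 0" "Im v > 0" for u v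
  proof -
    have "(cmod (u - v))\<^sup>2 = (Re u - Re v)\<^sup>2 + (Im u - Im v)\<^sup>2" by (simp add: cmod_power2)
    then have "ch u v = 1 + ((Re u - Re v)\<^sup>2 + (Im u - Im v)\<^sup>2) / (2 * (Im u * Im v))"
      using that by (simp add: ch_def)
    also have "\<dots> = (a u * c v + c u * a v) / 2 - b u * b v"
      using that by (simp add: a_def b_def c_def divide_simps) (simp add: algebra_simps power2_eq_square)
    finally show ?thesis .
  qed
  have gram: "1 + 2 * A * B * C - A\<^sup>2 - B\<^sup>2 - C\<^sup>2 \<ge> 0"
    if "A = (a1 * c2 + c1 * a2) / 2 - b1 * b2" "B = (a2 * c3 + c2 * a3) / 2 - b2 * b3"
      "C = (a1 * c3 + c1 * a3) / 2 - b1 * b3"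
      "a1 * c1 - b1\<^sup>2 = 1" "a2 * c2 - b2\<^sup>2 = 1" "a3 * c3 - b3\<^sup>2 = 1"
    for A B C a1 a2 a3 b1 b2 b3 c1 c2 c3 :: real
  proof -
    have "(a1*c1-b1\<^sup>2)*(a2*c2-b2\<^sup>2)*(a3*c3-b3\<^sup>2) + 2*A*B*C
        - A\<^sup>2*(a3*c3-b3\<^sup>2) - B\<^sup>2*(a1*c1-b1\<^sup>2) - C\<^sup>2*(a2*c2-b2\<^sup>2)
      = (a1*(b2*c3 - b3*c2) - b1*(a2*c3 - a3*c2) + c1*(a2*b3 - a3*b2))\<^sup>2 / 4"
      unfolding that(1-3) by (simp add: field_simps power2_eq_square)
    then have "1 + 2 * A * B * C - A\<^sup>2 - B\<^sup>2 - C\<^sup>2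
      = (a1*(b2*c3 - b3*c2) - b1*(a2*c3 - a3*c2) + c1*(a2*b3 - a3*b2))\<^sup>2 / 4"
      unfolding that(4-6) by (simp only: mult_1_right)
    then show ?thesis by (simp only: zero_le_power2 divide_nonneg_pos zero_less_numeral)
  qed
  define A B C where "A = ch x y" and "B = ch y z" and "C = ch x z"
  have ABC: "A \<ge> 1" "B \<ge> 1" "C \<ge> 1" by (simp_all add: A_def B_def C_def ge1)
  have "1 + 2 * A * B * C - A\<^sup>2 - B\<^sup>2 - C\<^sup>2 \<ge> 0"
    unfolding A_def B_def C_def
    by (rule gram[OF form form form norm1 norm1 norm1]) (use pos in auto)
  then have "(C - A * B)\<^sup>2 \<le> (A\<^sup>2 - 1) * (B\<^sup>2 - 1)"
    by (simp add: algebra_simps power2_eq_square)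
  then have "C - A * B \<le> sqrt ((A\<^sup>2 - 1) * (B\<^sup>2 - 1))"
    by (rule real_le_rsqrt)
  then have "C \<le> cosh (arcosh A + arcosh B)"
    using ABC by (simp add: cosh_add sinh_arcosh_real real_sqrt_mult)
  then have "cosh (arcosh C) \<le> cosh (arcosh A + arcosh B)"
    using ABC by simp
  then have "arcosh C \<le> arcosh A + arcosh B"
    using ABC by (subst (asm) cosh_real_nonneg_le_iff) auto
  then show "hyp_dist x z \<le> hyp_dist x y + hyp_dist y z"
    by (simp add: hyp_dist_def A_def B_def C_def ch_def)
qed


section \<open>Cell complexes of dimension two\<close>

text \<open>
  Cells of positive dimension are recorded as closed cells. In a CW-complex the open cell is
  recovered by removing the skeleton of lower dimension, so no information is lost.
\<close>

record 'a complex2 =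
  cspace :: "'a topology"
  verts :: "'a set"
  edges :: "'a set set"
  faces :: "'a set set"

definition skeleton1 :: "('a, 'z) complex2_scheme \<Rightarrow> 'a set" where
  "skeleton1 K = verts K \<union> \<Union>(edges K)"

text \<open>
  \<open>characteristic_map X S c \<phi>\<close>: \<open>\<phi>\<close> is a characteristic map, defined on the closed unit ball
  of its domain type, of the closed cell \<open>c\<close> attached to the lower skeleton \<open>S\<close>.
\<close>

definition characteristic_map ::
    "'a topology \<Rightarrow> 'a set \<Rightarrow> 'a set \<Rightarrow> ('b::euclidean_space \<Rightarrow> 'a) \<Rightarrow> bool" where
  "characteristic_map X S c \<phi> \<longleftrightarrow>
     continuous_map (top_of_set (cball 0 1)) X \<phi> \<and>
     \<phi> ` cball 0 1 = c \<and>
     \<phi> ` sphere 0 1 \<subseteq> S \<and>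
     homeomorphic_map (top_of_set (ball 0 1)) (subtopology X (c - S)) \<phi>"

definition cw2 :: "('a, 'z) complex2_scheme \<Rightarrow> bool" where
  "cw2 K \<longleftrightarrow>
     Hausdorff_space (cspace K) \<and>
     topspace (cspace K) = verts K \<union> \<Union>(edges K) \<union> \<Union>(faces K) \<and>
     (\<forall>e\<in>edges K. \<exists>\<phi> :: real \<Rightarrow> 'a. characteristic_map (cspace K) (verts K) e \<phi>) \<and>
     (\<forall>e\<in>edges K. \<forall>e'\<in>edges K. e \<noteq> e' \<longrightarrow> e \<inter> e' \<subseteq> verts K) \<and>
     (\<forall>f\<in>faces K. \<exists>\<phi> :: complex \<Rightarrow> 'a.
        characteristic_map (cspace K) (skeleton1 K) f \<phi> \<and>
        (\<exists>V E. finite V \<and> V \<subseteq> verts K \<and> finite E \<and> E \<subseteq> edges K \<and>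
               \<phi> ` sphere 0 1 \<subseteq> V \<union> \<Union>E)) \<and>
     (\<forall>f\<in>faces K. \<forall>f'\<in>faces K. f \<noteq> f' \<longrightarrow> f \<inter> f' \<subseteq> skeleton1 K) \<and>
     (\<forall>C \<subseteq> topspace (cspace K).
        (\<forall>c \<in> edges K \<union> faces K. closedin (cspace K) (C \<inter> c)) \<longrightarrow> closedin (cspace K) C)"

definition subcomplex :: "('a, 'y) complex2_scheme \<Rightarrow> ('a, 'z) complex2_scheme \<Rightarrow> bool" where
  "subcomplex K L \<longleftrightarrow>
     topspace (cspace K) \<subseteq> topspace (cspace L) \<and>
     cspace K = subtopology (cspace L) (topspace (cspace K)) \<and>
     verts K = verts L \<inter> topspace (cspace K) \<and>
     edges K = {e \<in> edges L. e \<subseteq> topspace (cspace K)} \<and>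
     faces K = {f \<in> faces L. f \<subseteq> topspace (cspace K)}"

abbreviation disc :: "complex topology" where
  "disc \<equiv> top_of_set (cball 0 1)"

text \<open>
  The boundary circle of a space homeomorphic to the closed disc; by invariance of domain
  the choice of the homeomorphism is irrelevant.
\<close>

definition boundary_circle :: "'a topology \<Rightarrow> 'a set" where
  "boundary_circle X = {x \<in> topspace X. \<exists>h. homeomorphic_map X disc h \<and> h x \<in> sphere 0 1}"

definition topological_polygon :: "('a, 'z) complex2_scheme \<Rightarrow> bool" where
  "topological_polygon K \<longleftrightarrow>
     cw2 K \<and>
     cspace K homeomorphic_space disc \<and>
     card (faces K) = 1 \<and>
     (\<exists>k\<ge>3. card (edges K) = k \<and> card (verts K) = k) \<and>
     skeleton1 K = boundary_circle (cspace K)"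


section \<open>Labelled complexes and patches\<close>

record ('a, 'l) lcomplex = "'a complex2" +
  flabel :: "'a set \<Rightarrow> 'l"

text \<open>In a patch, \<open>flabel\<close> is the type of a face (the index of a tile), \<open>chart\<close> the map \<open>\<tau>\<close>.\<close>

record 'a patch = "('a, nat) lcomplex" +
  chart :: "'a set \<Rightarrow> 'a \<Rightarrow> 'a"

definition lcomplex_iso :: "('a, 'l, 'y) lcomplex_scheme \<Rightarrow> ('b, 'm, 'z) lcomplex_scheme \<Rightarrow> bool" where
  "lcomplex_iso K L \<longleftrightarrow>
     (\<exists>h \<beta>. homeomorphic_map (cspace K) (cspace L) h \<and>
        h ` verts K = verts L \<and>
        (`) h ` edges K = edges L \<and>
        (`) h ` faces K = faces L \<and>
        inj_on \<beta> (flabel K ` faces K) \<and>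
        (\<forall>f\<in>faces K. flabel L (h ` f) = \<beta> (flabel K f)))"

text \<open>\<open>is_patch d T P\<close>: \<open>P\<close> is a patch modelled on the tiles \<open>T 0, \<dots>, T (d - 1)\<close>.\<close>

definition is_patch :: "nat \<Rightarrow> (nat \<Rightarrow> 'a complex2) \<Rightarrow> 'a patch \<Rightarrow> bool" where
  "is_patch d T P \<longleftrightarrow>
     cw2 P \<and>
     cspace P homeomorphic_space disc \<and>
     (\<forall>f\<in>faces P.
        flabel P f < d \<and>
        homeomorphic_map (subtopology (cspace P) f) (cspace (T (flabel P f))) (chart P f) \<and>
        chart P f ` (verts P \<inter> f) = verts (T (flabel P f)) \<and>
        (`) (chart P f) ` {e \<in> edges P. e \<subseteq> f} = edges (T (flabel P f)))"

definition interior_edge :: "('a, 'z) complex2_scheme \<Rightarrow> 'a set \<Rightarrow> bool" where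
  "interior_edge P e \<longleftrightarrow> e \<in> edges P \<and> \<not> e \<subseteq> boundary_circle (cspace P)"

definition adjacent_along :: "('a, 'z) complex2_scheme \<Rightarrow> 'a set \<Rightarrow> 'a set \<Rightarrow> 'a set \<Rightarrow> bool" where
  "adjacent_along P f f' e \<longleftrightarrow>
     f \<in> faces P \<and> f' \<in> faces P \<and> f \<noteq> f' \<and> e \<in> edges P \<and> e \<subseteq> f \<and> e \<subseteq> f'"

definition thick_boundary :: "('a, 'z) complex2_scheme \<Rightarrow> 'a set" where
  "thick_boundary P = \<Union>{f \<in> faces P. f \<inter> verts P \<inter> boundary_circle (cspace P) \<noteq> {}}"

definition core :: "('a, 'z) complex2_scheme \<Rightarrow> 'a set" where
  "core P = cspace P closure_of (topspace (cspace P) - thick_boundary P)"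

definition separated_patch :: "('a, 'z) complex2_scheme \<Rightarrow> bool" where
  "separated_patch P \<longleftrightarrow>
     (\<exists>f\<in>faces P. \<not> connectedin (cspace P) (topspace (cspace P) - f))"


section \<open>Topological pre-substitutions\<close>

record 'a presubst =
  ntiles :: nat
  tile :: "nat \<Rightarrow> 'a complex2"
  spatch :: "nat \<Rightarrow> 'a patch"
  smap :: "nat \<Rightarrow> 'a \<Rightarrow> 'a"

definition presubstitution :: "'a presubst \<Rightarrow> bool" where
  "presubstitution \<sigma> \<longleftrightarrow>
     (\<forall>i<ntiles \<sigma>.
        topological_polygon (tile \<sigma> i) \<and>
        is_patch (ntiles \<sigma>) (tile \<sigma>) (spatch \<sigma> i) \<and>
        homeomorphic_map (cspace (tile \<sigma> i)) (cspace (spatch \<sigma> i)) (smap \<sigma> i) \<and>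
        smap \<sigma> i ` verts (tile \<sigma> i)
          \<subseteq> verts (spatch \<sigma> i) \<inter> boundary_circle (cspace (spatch \<sigma> i)))"

text \<open>The edges of \<open>\<sigma>(T\<^sub>i)\<close> forming the edge path \<open>\<sigma>(e)\<close>, for an edge \<open>e\<close> of \<open>T\<^sub>i\<close>.\<close>

definition path_edges :: "'a presubst \<Rightarrow> nat \<Rightarrow> 'a set \<Rightarrow> 'a set set" where
  "path_edges \<sigma> i e = {e' \<in> edges (spatch \<sigma> i). e' \<subseteq> smap \<sigma> i ` e}"

definition balanced :: "'a presubst \<Rightarrow> nat \<Rightarrow> 'a set \<Rightarrow> nat \<Rightarrow> 'a set \<Rightarrow> bool" where
  "balanced \<sigma> i e j e' \<longleftrightarrow> card (path_edges \<sigma> i e) = card (path_edges \<sigma> j e')"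

definition balanced_edge :: "'a presubst \<Rightarrow> 'a patch \<Rightarrow> 'a set \<Rightarrow> bool" where
  "balanced_edge \<sigma> P e \<longleftrightarrow>
     (\<forall>f f'. adjacent_along P f f' e \<longrightarrow>
        balanced \<sigma> (flabel P f) (chart P f ` e) (flabel P f') (chart P f' ` e))"


subsection \<open>Gluing\<close>

text \<open>
  The patch \<open>\<sigma>(type f)\<close> and the edge path in its boundary that is assigned to an edge (or the
  vertex assigned to a vertex) of a face \<open>f\<close> of \<open>P\<close>.
\<close>

abbreviation fpatch :: "'a presubst \<Rightarrow> 'a patch \<Rightarrow> 'a set \<Rightarrow> 'a patch" where
  "fpatch \<sigma> P f \<equiv> spatch \<sigma> (flabel P f)"

definition fmap :: "'a presubst \<Rightarrow> 'a patch \<Rightarrow> 'a set \<Rightarrow> 'a \<Rightarrow> 'a" where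
  "fmap \<sigma> P f x = smap \<sigma> (flabel P f) (chart P f x)"

text \<open>
  \<open>\<theta> f f' e\<close> identifies the edge path of \<open>e\<close> in \<open>\<sigma>(type f)\<close> with the one in \<open>\<sigma>(type f')\<close>,
  edge to edge, with the end points matched as prescribed by the end points of \<open>e\<close>. A fixed
  formula transporting points through \<open>e\<close> by \<open>\<sigma>\<close> and the charts is not available, because it need not send vertices to
  vertices; up to isomorphism, the resulting labelled complex is the same for every choice of \<open>\<theta>\<close>.
\<close>

definition gluing_maps ::
    "'a presubst \<Rightarrow> 'a patch \<Rightarrow> ('a set \<Rightarrow> 'a set \<Rightarrow> 'a set \<Rightarrow> 'a \<Rightarrow> 'a) \<Rightarrow> bool" where
  "gluing_maps \<sigma> P \<theta> \<longleftrightarrow>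
     (\<forall>f f' e. adjacent_along P f f' e \<longrightarrow>
        homeomorphic_map
          (subtopology (cspace (fpatch \<sigma> P f)) (fmap \<sigma> P f ` e))
          (subtopology (cspace (fpatch \<sigma> P f')) (fmap \<sigma> P f' ` e)) (\<theta> f f' e) \<and>
        \<theta> f f' e ` (verts (fpatch \<sigma> P f) \<inter> fmap \<sigma> P f ` e)
          = verts (fpatch \<sigma> P f') \<inter> fmap \<sigma> P f' ` e \<and>
        (`) (\<theta> f f' e) ` path_edges \<sigma> (flabel P f) (chart P f ` e)
          = path_edges \<sigma> (flabel P f') (chart P f' ` e) \<and>
        (\<forall>v \<in> verts P \<inter> e. \<theta> f f' e (fmap \<sigma> P f v) = fmap \<sigma> P f' v) \<and>
        (\<forall>x \<in> fmap \<sigma> P f ` e. \<theta> f' f e (\<theta> f f' e x) = x))"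

definition gluing_rel ::
    "'a presubst \<Rightarrow> 'a patch \<Rightarrow> ('a set \<Rightarrow> 'a set \<Rightarrow> 'a set \<Rightarrow> 'a \<Rightarrow> 'a) \<Rightarrow> (('a set \<times> 'a) \<times> ('a set \<times> 'a)) set"
  where
  "gluing_rel \<sigma> P \<theta> =
     {((f, x), (f', \<theta> f f' e x)) | f f' e x. adjacent_along P f f' e \<and> x \<in> fmap \<sigma> P f ` e}"

text \<open>
  \<open>glued_from \<sigma> P q Q\<close>: the patch \<open>Q\<close> is the quotient of the disjoint union of the patches
  \<open>\<sigma>(type f)\<close>, \<open>f\<close> a face of \<open>P\<close>, under the gluing, and \<open>q\<close> is the quotient map. The relation
  \<open>gluing_rel\<close> is symmetric, so its reflexive transitive closure is the generated equivalence.
  Only the isomorphism type of \<open>Q\<close> is determined; since a patch has at most as many points as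
  the disc, each quotient has a representative over the same point type \<open>'a\<close>.
\<close>

definition glued_from :: "'a presubst \<Rightarrow> 'a patch \<Rightarrow> ('a set \<times> 'a \<Rightarrow> 'a) \<Rightarrow> 'a patch \<Rightarrow> bool" where
  "glued_from \<sigma> P q Q \<longleftrightarrow>
     is_patch (ntiles \<sigma>) (tile \<sigma>) Q \<and>
     (let S = sum_topology (\<lambda>f. cspace (fpatch \<sigma> P f)) (faces P) in
        \<exists>\<theta>. gluing_maps \<sigma> P \<theta> \<and>
            quotient_map S (cspace Q) q \<and>
            (\<forall>p\<in>topspace S. \<forall>p'\<in>topspace S. q p = q p' \<longleftrightarrow> (p, p') \<in> (gluing_rel \<sigma> P \<theta>)\<^sup>*)) \<and>
     verts Q = {q (f, v) | f v. f \<in> faces P \<and> v \<in> verts (fpatch \<sigma> P f)} \<and>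
     edges Q = {q ` ({f} \<times> e) | f e. f \<in> faces P \<and> e \<in> edges (fpatch \<sigma> P f)} \<and>
     faces Q = {q ` ({f} \<times> g) | f g. f \<in> faces P \<and> g \<in> faces (fpatch \<sigma> P f)} \<and>
     (\<forall>f\<in>faces P. \<forall>g\<in>faces (fpatch \<sigma> P f).
        flabel Q (q ` ({f} \<times> g)) = flabel (fpatch \<sigma> P f) g \<and>
        (\<forall>x\<in>g. chart Q (q ` ({f} \<times> g)) (q (f, x)) = chart (fpatch \<sigma> P f) g x))"

text \<open>
  The homeomorphism \<open>P \<rightarrow> Q\<close> induced by \<open>\<sigma>\<close>. It is determined by \<open>\<sigma>\<close> on the cells of \<open>P\<close>
  (and pointwise on vertices), that is, up to an isotopy preserving all cells of \<open>P\<close>.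
\<close>

definition induced_map ::
    "'a presubst \<Rightarrow> 'a patch \<Rightarrow> ('a set \<times> 'a \<Rightarrow> 'a) \<Rightarrow> 'a patch \<Rightarrow> ('a \<Rightarrow> 'a) \<Rightarrow> bool" where
  "induced_map \<sigma> P q Q h \<longleftrightarrow>
     homeomorphic_map (cspace P) (cspace Q) h \<and>
     (\<forall>f\<in>faces P.
        h ` f = q ` ({f} \<times> topspace (cspace (fpatch \<sigma> P f))) \<and>
        (\<forall>e\<in>edges P. e \<subseteq> f \<longrightarrow> h ` e = q ` ({f} \<times> fmap \<sigma> P f ` e)) \<and>
        (\<forall>v\<in>verts P \<inter> f. h v = q (f, fmap \<sigma> P f v)))"


subsection \<open>Iteration and compatibility\<close>

definition tile_copy :: "'a presubst \<Rightarrow> nat \<Rightarrow> 'a patch \<Rightarrow> bool" where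
  "tile_copy \<sigma> i P \<longleftrightarrow>
     is_patch (ntiles \<sigma>) (tile \<sigma>) P \<and> (\<exists>f. faces P = {f} \<and> flabel P f = i)"

text \<open>
  \<open>iterate \<sigma> i p Q h\<close>: \<open>Q\<close> is (a representative of) \<open>\<sigma>\<^sup>p(T\<^sub>i)\<close> and \<open>h\<close> is the map \<open>\<sigma>\<^sup>p\<close> from \<open>T\<^sub>i\<close> to \<open>Q\<close>.
\<close>

inductive iterate :: "'a presubst \<Rightarrow> nat \<Rightarrow> nat \<Rightarrow> 'a patch \<Rightarrow> ('a \<Rightarrow> 'a) \<Rightarrow> bool"
  for \<sigma> :: "'a presubst" and i :: nat where
  iterate_0: "\<lbrakk>tile_copy \<sigma> i P; \<forall>f\<in>faces P. \<forall>x\<in>topspace (cspace (tile \<sigma> i)). h x \<in> f \<and> chart P f (h x) = x\<rbrakk>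
    \<Longrightarrow> iterate \<sigma> i 0 P h"
| iterate_Suc: "\<lbrakk>iterate \<sigma> i p P h; glued_from \<sigma> P q Q; induced_map \<sigma> P q Q g\<rbrakk>
    \<Longrightarrow> iterate \<sigma> i (Suc p) Q (g \<circ> h)"

text \<open>
  When \<open>\<sigma>\<close> is \<open>p\<close>-compatible, the patches \<open>\<sigma>\<^sup>p(T\<^sub>i)\<close> exist and are unique up to isomorphism, so it
  does not matter that all representatives are considered. The case \<open>p = 0\<close> is a convention.
\<close>

fun p_compatible :: "'a presubst \<Rightarrow> nat \<Rightarrow> bool" where
  "p_compatible \<sigma> 0 \<longleftrightarrow> True"
| "p_compatible \<sigma> (Suc 0) \<longleftrightarrow> True"
| "p_compatible \<sigma> (Suc (Suc p)) \<longleftrightarrow>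
     p_compatible \<sigma> (Suc p) \<and>
     (\<forall>i<ntiles \<sigma>. \<forall>Q h. iterate \<sigma> i (Suc p) Q h \<longrightarrow>
        (\<forall>e. interior_edge Q e \<longrightarrow> balanced_edge \<sigma> Q e))"

definition compatible :: "'a presubst \<Rightarrow> bool" where
  "compatible \<sigma> \<longleftrightarrow> (\<forall>p. p_compatible \<sigma> p)"

definition is_power :: "'a presubst \<Rightarrow> nat \<Rightarrow> 'a presubst \<Rightarrow> bool" where
  "is_power \<sigma> k \<sigma>' \<longleftrightarrow>
     presubstitution \<sigma>' \<and>
     ntiles \<sigma>' = ntiles \<sigma> \<and>
     (\<forall>i<ntiles \<sigma>. tile \<sigma>' i = tile \<sigma> i \<and> iterate \<sigma> i k (spatch \<sigma>' i) (smap \<sigma>' i))"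


section \<open>Topological substitutions, primitivity, inflation\<close>

definition core_property :: "'a presubst \<Rightarrow> bool" where
  "core_property \<sigma> \<longleftrightarrow>
     (\<exists>i<ntiles \<sigma>. \<exists>k Q h. iterate \<sigma> i k Q h \<and> core Q \<noteq> {})"

definition topological_substitution :: "'a presubst \<Rightarrow> bool" where
  "topological_substitution \<sigma> \<longleftrightarrow> presubstitution \<sigma> \<and> compatible \<sigma> \<and> core_property \<sigma>"

definition core_contains_type :: "'a patch \<Rightarrow> nat \<Rightarrow> bool" where
  "core_contains_type P j \<longleftrightarrow> (\<exists>f\<in>faces P. f \<subseteq> core P \<and> flabel P f = j)"

definition pure_primitive :: "'a presubst \<Rightarrow> bool" where
  "pure_primitive \<sigma> \<longleftrightarrow>
     topological_substitution \<sigma> \<and>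
     (\<forall>i<ntiles \<sigma>. \<not> separated_patch (spatch \<sigma> i) \<and>
        (\<forall>Q h. iterate \<sigma> i 2 Q h \<longrightarrow> \<not> separated_patch Q)) \<and>
     (\<forall>i<ntiles \<sigma>. \<forall>j<ntiles \<sigma>. core_contains_type (spatch \<sigma> i) j)"

definition primitive :: "'a presubst \<Rightarrow> bool" where
  "primitive \<sigma> \<longleftrightarrow>
     topological_substitution \<sigma> \<and> (\<exists>k\<ge>1. \<exists>\<sigma>'. is_power \<sigma> k \<sigma>' \<and> pure_primitive \<sigma>')"

text \<open>The union of an increasing sequence of subcomplexes, with the weak topology.\<close>

definition union_topology :: "(nat \<Rightarrow> 'a topology) \<Rightarrow> 'a topology" where
  "union_topology X =
     topology (\<lambda>U. U \<subseteq> (\<Union>k. topspace (X k)) \<and> (\<forall>k. openin (X k) (U \<inter> topspace (X k))))"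

lemma openin_union_topology:
  "openin (union_topology X) U \<longleftrightarrow>
     U \<subseteq> (\<Union>k. topspace (X k)) \<and> (\<forall>k. openin (X k) (U \<inter> topspace (X k)))"
proof -
  have "istopology (\<lambda>U. U \<subseteq> (\<Union>k. topspace (X k)) \<and> (\<forall>k. openin (X k) (U \<inter> topspace (X k))))"
    unfolding istopology_def
  proof (intro conjI allI impI)
    fix S T k
    assume "S \<subseteq> (\<Union>k. topspace (X k)) \<and> (\<forall>k. openin (X k) (S \<inter> topspace (X k)))"
      and "T \<subseteq> (\<Union>k. topspace (X k)) \<and> (\<forall>k. openin (X k) (T \<inter> topspace (X k)))"
    then have "openin (X k) ((S \<inter> topspace (X k)) \<inter> (T \<inter> topspace (X k)))" by blast
    then show "openin (X k) (S \<inter> T \<inter> topspace (X k))"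
      by (simp add: Int_assoc Int_left_commute)
  next
    fix \<K> k
    assume "\<forall>K\<in>\<K>. K \<subseteq> (\<Union>k. topspace (X k)) \<and> (\<forall>k. openin (X k) (K \<inter> topspace (X k)))"
    then have "openin (X k) (\<Union>((\<lambda>K. K \<inter> topspace (X k)) ` \<K>))" by blast
    then show "openin (X k) (\<Union>\<K> \<inter> topspace (X k))" by (simp add: Int_commute Int_Union)
  qed blast+
  then show ?thesis by (simp add: union_topology_def)
qed

text \<open>
  \<open>inflation \<sigma> i L\<close>: \<open>L\<close> is \<open>\<sigma>\<^sup>\<infinity>(T\<^sub>i)\<close>. The patches \<open>P k\<close> represent \<open>\<sigma>\<^sup>k(T\<^sub>i)\<close> and \<open>q k\<close> is the quotient
  map onto \<open>P (Suc k)\<close>. The identification of \<open>\<sigma>\<^sup>k(T\<^sub>i)\<close> with a subcomplex of \<open>\<sigma>\<^sup>k\<^sup>+\<^sup>1(T\<^sub>i)\<close> is realised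
  as an inclusion: \<open>P 0\<close> is a face in the core of \<open>P 1\<close>, and the later inclusions are
  those induced by \<open>\<sigma>\<close> from the previous ones, i.e. \<open>q (Suc k)\<close> extends \<open>q k\<close>.
\<close>

definition inflation :: "'a presubst \<Rightarrow> nat \<Rightarrow> ('a, nat) lcomplex \<Rightarrow> bool" where
  "inflation \<sigma> i L \<longleftrightarrow>
     (\<exists>(P :: nat \<Rightarrow> 'a patch) q.
        tile_copy \<sigma> i (P 0) \<and>
        (\<forall>k. glued_from \<sigma> (P k) (q k) (P (Suc k))) \<and>
        (\<forall>f\<in>faces (P 0). f \<subseteq> core (P 1)) \<and>
        (\<forall>k. subcomplex (P k) (P (Suc k)) \<and>
             (\<forall>f\<in>faces (P k).
                flabel (P (Suc k)) f = flabel (P k) f \<and>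
                (\<forall>x\<in>f. chart (P (Suc k)) f x = chart (P k) f x) \<and>
                (\<forall>x\<in>topspace (cspace (fpatch \<sigma> (P k) f)). q (Suc k) (f, x) = q k (f, x)))) \<and>
        cspace L = union_topology (\<lambda>k. cspace (P k)) \<and>
        verts L = (\<Union>k. verts (P k)) \<and>
        edges L = (\<Union>k. edges (P k)) \<and>
        faces L = (\<Union>k. faces (P k)) \<and>
        (\<forall>k. \<forall>f\<in>faces (P k). flabel L f = flabel (P k) f))"

definition obtained_by_inflation :: "('x, 'm, 'z) lcomplex_scheme \<Rightarrow> 'a presubst \<Rightarrow> bool" where
  "obtained_by_inflation K \<sigma> \<longleftrightarrow>
     (\<exists>i<ntiles \<sigma>. core_contains_type (spatch \<sigma> i) i \<and> (\<exists>L. inflation \<sigma> i L \<and> lcomplex_iso K L))"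


section \<open>Tilings\<close>

definition isometry_group :: "'x set \<Rightarrow> ('x \<Rightarrow> 'x \<Rightarrow> real) \<Rightarrow> ('x \<Rightarrow> 'x) monoid" where
  "isometry_group M d =
     (BijGroup M)\<lparr>carrier := {g \<in> Bij M. \<forall>x\<in>M. \<forall>y\<in>M. d (g x) (g y) = d x y}\<rparr>"

definition is_tile :: "'x topology \<Rightarrow> 'x set \<Rightarrow> bool" where
  "is_tile X t \<longleftrightarrow> compactin X t \<and> t = X closure_of (X interior_of t)"

definition labelled_tiles :: "'x topology \<Rightarrow> 'l set \<Rightarrow> ('x set \<times> 'l) set" where
  "labelled_tiles X \<Lambda> = {t. is_tile X t} \<times> \<Lambda>"

definition tile_equiv ::
    "'x topology \<Rightarrow> ('x \<Rightarrow> 'x) set \<Rightarrow> 'l set \<Rightarrow> (('x set \<times> 'l) \<times> ('x set \<times> 'l)) set" where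
  "tile_equiv X \<Gamma> \<Lambda> =
     {((s, l), (t, m)). (s, l) \<in> labelled_tiles X \<Lambda> \<and> (t, m) \<in> labelled_tiles X \<Lambda> \<and>
        l = m \<and> (\<exists>g\<in>\<Gamma>. t = g ` s)}"

definition prototiles :: "'x topology \<Rightarrow> ('x \<Rightarrow> 'x) set \<Rightarrow> 'l set \<Rightarrow> ('x set \<times> 'l) set set" where
  "prototiles X \<Gamma> \<Lambda> = labelled_tiles X \<Lambda> // tile_equiv X \<Gamma> \<Lambda>"

definition tiling ::
    "'x set \<Rightarrow> ('x \<Rightarrow> 'x \<Rightarrow> real) \<Rightarrow> ('x \<Rightarrow> 'x) set \<Rightarrow> 'l set
      \<Rightarrow> ('x set \<times> 'l) set set \<Rightarrow> ('x set \<times> 'l) set \<Rightarrow> bool" where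
  "tiling M d \<Gamma> \<Lambda> \<P> \<T> \<longleftrightarrow>
     (let X = Metric_space.mtopology M d in
        subgroup \<Gamma> (isometry_group M d) \<and>
        finite \<Lambda> \<and>
        finite \<P> \<and> \<P> \<subseteq> prototiles X \<Gamma> \<Lambda> \<and>
        (\<forall>t\<in>\<T>. \<exists>p\<in>\<P>. t \<in> p) \<and>
        (\<Union>t\<in>\<T>. fst t) = M \<and>
        (\<forall>t\<in>\<T>. \<forall>t'\<in>\<T>. t \<noteq> t' \<longrightarrow> X interior_of fst t \<inter> X interior_of fst t' = {}))"

definition tiling_verts :: "('x set \<times> 'l) set \<Rightarrow> 'x set" where
  "tiling_verts \<T> =
     {x. \<exists>t1\<in>\<T>. \<exists>t2\<in>\<T>. \<exists>t3\<in>\<T>. t1 \<noteq> t2 \<and> t1 \<noteq> t3 \<and> t2 \<noteq> t3 \<and>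
           x \<in> fst t1 \<and> x \<in> fst t2 \<and> x \<in> fst t3}"

definition tiling_edges :: "'x topology \<Rightarrow> ('x set \<times> 'l) set \<Rightarrow> 'x set set" where
  "tiling_edges X \<T> =
     (\<lambda>C. X closure_of C) `
       connected_components_of
         (subtopology X ((\<Union>t\<in>\<T>. X frontier_of fst t) - tiling_verts \<T>))"

text \<open>The label of a face is its prototile, which is unique as prototiles are equivalence classes.\<close>

definition tiling_complex ::
    "'x topology \<Rightarrow> ('x set \<times> 'l) set set \<Rightarrow> ('x set \<times> 'l) set \<Rightarrow> ('x, ('x set \<times> 'l) set) lcomplex" where
  "tiling_complex X \<P> \<T> =
     \<lparr>cspace = X,
      verts = tiling_verts \<T>,
      edges = tiling_edges X \<T>,
      faces = fst ` \<T>,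
      flabel = (\<lambda>s. THE p. p \<in> \<P> \<and> (\<exists>l. (s, l) \<in> \<T> \<and> (s, l) \<in> p))\<rparr>"

text \<open>
  The type argument is the type of points of the topological polygons and patches; it occurs
  only in the existential quantifier over substitutions.
\<close>

definition primitive_substitutive_tiling ::
    "'a itself \<Rightarrow> 'x set \<Rightarrow> ('x \<Rightarrow> 'x \<Rightarrow> real) \<Rightarrow> ('x \<Rightarrow> 'x) set \<Rightarrow> 'l set
      \<Rightarrow> ('x set \<times> 'l) set set \<Rightarrow> ('x set \<times> 'l) set \<Rightarrow> bool" where
  "primitive_substitutive_tiling _ M d \<Gamma> \<Lambda> \<P> \<T> \<longleftrightarrow>
     tiling M d \<Gamma> \<Lambda> \<P> \<T> \<and>
     (\<forall>t\<in>\<T>. connectedin (Metric_space.mtopology M d) (fst t)) \<and>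
     (\<exists>\<sigma> :: 'a presubst. topological_substitution \<sigma> \<and> primitive \<sigma> \<and>
        obtained_by_inflation (tiling_complex (Metric_space.mtopology M d) \<P> \<T>) \<sigma>)"

end

theory Submission
  imports Defs
begin

text \<open>
  The hyperbolic plane is not amenable, whereas inflation by a primitive substitution produces
  regions whose boundary is negligible. These two facts contradict each other.

  \<^emph>\<open>Hyperbolic side.\<close> The upper half-plane is cut into dyadic boxes, squares of side \<open>2\<^sup>k\<close> standing
  at height \<open>2\<^sup>k\<close>, all of bounded hyperbolic size. Below each box hang exactly two smaller ones, so a finite
  set of \<open>N\<close> boxes has at least \<open>N\<close> children outside the set. As the tiles of a tiling with
  finitely many prototiles are uniformly comparable to hyperbolic balls, the same holds for
  tiles: the size of a finite family of tiles is at most a constant multiple of the number of its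
  members that touch a tile outside the family
  (\<open>hyperbolic_isoperimetric_inequality\<close>). A finite set of points, such as the vertices of the
  family, may be disregarded when deciding whether tiles touch.

  \<^emph>\<open>Substitution side.\<close> Let \<open>P\<^sub>n = \<sigma>\<^sup>n(T)\<close> be the patches of an inflation. An edge of a patch is
  called free if it lies in one face only, and the rim of a patch consists of the faces that
  contain a vertex of a free edge. A face of \<open>P\<^sub>n\<^sub>+\<^sub>1\<close> in the rim descends from a face in the rim of
  \<open>P\<^sub>n\<close>, and it does not come from the core of the substituted tile (\<open>rim_subface\<close>). Hence in
  passing from \<open>P\<^sub>n\<close> to \<open>P\<^sub>n\<^sub>+\<^sub>1\<close> the vector of types of all faces is multiplied by the matrix \<open>M\<close> of
  \<open>\<sigma>\<close>, while the one of the rim is bounded by the product with \<open>M - C\<close>, where \<open>C\<close> counts the core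
  faces. Some power of \<open>M\<close> is positive and \<open>C \<noteq> 0\<close>, because the core of \<open>\<sigma>(T)\<close> contains a
  face of type \<open>T\<close>; so the rim grows at a strictly smaller exponential rate
  (\<open>thin_boundary\<close>, \<open>inflated_patches_have_thin_rim\<close>).

  \<^emph>\<open>Matching the two.\<close> Let a tile \<open>t\<close> of the family of \<open>P\<^sub>n\<close> share a point that is not a vertex with a
  tile outside the family. By the definition of vertices no third tile contains this point, and by invariance
  of domain it lies on an edge of the face \<open>t\<close>. That edge is free, so \<open>t\<close> is in the rim. Therefore
  the number of faces of \<open>P\<^sub>n\<close> is bounded by a multiple of the size of its rim
  (\<open>rim_isoperimetric_inequality\<close>), against the previous paragraph.
\<close>

section \<open>Hyperbolic distance in coordinates\<close>

interpretation hyp: Metric_space hyp_plane hyp_dist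
  by (rule Metric_space_hyp)

lemma cosh_hyp_dist:
  "cosh (hyp_dist z w) = 1 + (cmod (z - w))\<^sup>2 / (2 * \<bar>Im z * Im w\<bar>)"
  unfolding hyp_dist_def by (rule cosh_arcosh_real) simp

lemma hyp_dist_le_iff:
  assumes "Im z > 0" "Im w > 0" "0 \<le> \<rho>"
  shows "hyp_dist z w \<le> \<rho> \<longleftrightarrow> (cmod (z - w))\<^sup>2 \<le> 2 * (cosh \<rho> - 1) * (Im z * Im w)"
proof -
  have pos: "Im z * Im w > 0" using assms by simp
  have "hyp_dist z w \<le> \<rho> \<longleftrightarrow> cosh (hyp_dist z w) \<le> cosh \<rho>"
    using assms by (simp add: cosh_real_nonneg_le_iff)
  also have "\<dots> \<longleftrightarrow> (cmod (z - w))\<^sup>2 \<le> 2 * (cosh \<rho> - 1) * (Im z * Im w)"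
    unfolding cosh_hyp_dist abs_of_pos[OF pos] using assms by (simp add: divide_simps) (auto simp: algebra_simps)
  finally show ?thesis .
qed

lemma hyp_dist_less_iff:
  assumes "Im z > 0" "Im w > 0" "0 \<le> \<rho>"
  shows "hyp_dist z w < \<rho> \<longleftrightarrow> (cmod (z - w))\<^sup>2 < 2 * (cosh \<rho> - 1) * (Im z * Im w)"
proof -
  have pos: "Im z * Im w > 0" using assms by simp
  have "hyp_dist z w < \<rho> \<longleftrightarrow> cosh (hyp_dist z w) < cosh \<rho>"
    using assms by (simp add: cosh_real_nonneg_less_iff)
  also have "\<dots> \<longleftrightarrow> (cmod (z - w))\<^sup>2 < 2 * (cosh \<rho> - 1) * (Im z * Im w)"
    unfolding cosh_hyp_dist abs_of_pos[OF pos] using assms by (simp add: divide_simps) (auto simp: algebra_simps)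
  finally show ?thesis .
qed

text \<open>
  A hyperbolic ball has Euclidean size comparable to the height of its centre. The bound on the
  height comes from dropping the real parts, which leaves a quadratic inequality for \<open>Im w\<close>.
\<close>
lemma hyp_dist_le_imp_coordinates:
  assumes "Im z > 0" "Im w > 0" and le: "hyp_dist z w \<le> \<rho>"
  shows "Im w \<le> 2 * cosh \<rho> * Im z" "\<bar>Re z - Re w\<bar> \<le> 2 * cosh \<rho> * Im z"
proof -
  have "0 \<le> \<rho>" using hyp.nonneg[of z w] le by linarith
  then have "(cmod (z - w))\<^sup>2 \<le> 2 * (cosh \<rho> - 1) * (Im z * Im w)"
    using assms hyp_dist_le_iff by blast
  then have *: "(Re z - Re w)\<^sup>2 + (Im z - Im w)\<^sup>2 \<le> 2 * (cosh \<rho> - 1) * (Im z * Im w)"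
    by (simp add: cmod_power2)
  show Im: "Im w \<le> 2 * cosh \<rho> * Im z"
  proof -
    have "(Im z - Im w)\<^sup>2 \<le> 2 * (cosh \<rho> - 1) * (Im z * Im w)"
      using * by (smt (verit) zero_le_power2)
    then have "Im w * Im w + Im z * Im z \<le> (2 * cosh \<rho> * Im z) * Im w"
      by (simp add: power2_eq_square algebra_simps)
    then have "Im w * Im w \<le> (2 * cosh \<rho> * Im z) * Im w"
      by (smt (verit) assms(1) mult_pos_pos)
    then show ?thesis using assms(2) by simp
  qed
  have "(Re z - Re w)\<^sup>2 \<le> 2 * (cosh \<rho> - 1) * (Im z * Im w)"
    using * by (smt (verit) zero_le_power2)
  also have "\<dots> \<le> 2 * cosh \<rho> * (Im z * (2 * cosh \<rho> * Im z))"
    using Im assms cosh_real_ge_1[of \<rho>] by (intro mult_mono) auto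
  also have "\<dots> = (2 * cosh \<rho> * Im z)\<^sup>2" by (simp add: power2_eq_square)
  finally show "\<bar>Re z - Re w\<bar> \<le> 2 * cosh \<rho> * Im z"
    using assms by (intro power2_le_imp_le[of "\<bar>_\<bar>"]) auto
qed

lemma open_hyp_plane: "open hyp_plane"
  unfolding hyp_plane_def by (simp add: open_halfspace_Im_gt)
text \<open>
  At a fixed point of the half-plane the squared Euclidean distance is \<open>2 (cosh \<rho> - 1)\<close> times the
  product of the heights, so balls of each metric contain balls of the other. This makes
  Euclidean connectedness and invariance of domain applicable to tiles.
\<close>
lemma mtopology_hyp: "hyp.mtopology = top_of_set hyp_plane"
proof -
  have key1: "\<exists>r>0. \<forall>w\<in>hyp_plane. hyp_dist x w < r \<longrightarrow> dist x w < e"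
    if "x \<in> hyp_plane" "e > 0" for x e
  proof -
    have x: "Im x > 0" using that by (simp add: hyp_plane_def)
    have "((\<lambda>\<rho>. 2 * (cosh \<rho> - 1) * (2 * cosh \<rho> * (Im x)\<^sup>2)) \<longlongrightarrow>
             2 * (cosh 0 - 1) * (2 * cosh 0 * (Im x)\<^sup>2)) (at_right (0::real))"
      by (intro tendsto_intros)
    then have "\<forall>\<^sub>F \<rho> in at_right (0::real). 2 * (cosh \<rho> - 1) * (2 * cosh \<rho> * (Im x)\<^sup>2) < e\<^sup>2"
      using that by (auto elim!: order_tendstoD(2))
    then obtain b where b: "b > 0" "\<And>\<rho>. 0 < \<rho> \<Longrightarrow> \<rho> < b \<Longrightarrow> 2 * (cosh \<rho> - 1) * (2 * cosh \<rho> * (Im x)\<^sup>2) < e\<^sup>2"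
      unfolding eventually_at_right_field by auto
    define \<rho> where "\<rho> = b / 2"
    have \<rho>: "\<rho> > 0" "2 * (cosh \<rho> - 1) * (2 * cosh \<rho> * (Im x)\<^sup>2) < e\<^sup>2"
      using b by (auto simp: \<rho>_def)
    have "dist x w < e" if w: "w \<in> hyp_plane" "hyp_dist x w < \<rho>" for w
    proof -
      have w0: "Im w > 0" using w by (simp add: hyp_plane_def)
      have "(cmod (x - w))\<^sup>2 \<le> 2 * (cosh \<rho> - 1) * (Im x * Im w)"
        using hyp_dist_le_iff[OF x w0, of \<rho>] w \<rho> by auto
      also have "\<dots> \<le> 2 * (cosh \<rho> - 1) * (Im x * (2 * cosh \<rho> * Im x))"
        using hyp_dist_le_imp_coordinates(1)[OF x w0, of \<rho>] w x cosh_real_ge_1[of \<rho>]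
        by (intro mult_left_mono) auto
      also have "\<dots> < e\<^sup>2" using \<rho>(2) by (simp add: power2_eq_square algebra_simps)
      finally show ?thesis using \<open>e > 0\<close> by (simp add: dist_norm power2_less_imp_less)
    qed
    then show ?thesis using \<rho> by blast
  qed
  have key2: "\<exists>\<delta>>0. \<forall>w. dist x w < \<delta> \<longrightarrow> w \<in> hyp_plane \<and> hyp_dist x w < r"
    if "x \<in> hyp_plane" "r > 0" for x r
  proof -
    have x: "Im x > 0" using that by (simp add: hyp_plane_def)
    have c: "cosh r > 1" using that cosh_real_nonneg_less_iff[of 0 r] by simp
    define \<delta> where "\<delta> = min (Im x / 2) (Im x * sqrt (cosh r - 1))"
    have "w \<in> hyp_plane \<and> hyp_dist x w < r" if w: "dist x w < \<delta>" for w
    proof -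
      have "\<bar>Im x - Im w\<bar> \<le> dist x w" using abs_Im_le_cmod[of "x - w"] by (simp add: dist_norm)
      then have Iw: "Im w > Im x / 2" using w unfolding \<delta>_def by linarith
      have "(cmod (x - w))\<^sup>2 < \<delta>\<^sup>2" using w by (intro power_strict_mono) (auto simp: dist_norm)
      also have "\<dots> \<le> (Im x * sqrt (cosh r - 1))\<^sup>2"
        using x c by (intro power_mono) (auto simp: \<delta>_def)
      also have "\<dots> = 2 * (cosh r - 1) * (Im x * (Im x / 2))"
        using c by (simp add: power_mult_distrib) (simp add: power2_eq_square)
      also have "\<dots> \<le> 2 * (cosh r - 1) * (Im x * Im w)"
        using Iw x c by (intro mult_left_mono) auto
      finally show ?thesis
        using hyp_dist_less_iff[OF x, of w r] Iw x \<open>r > 0\<close> by (auto simp: hyp_plane_def)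
    qed
    moreover have "\<delta> > 0" using x c by (simp add: \<delta>_def)
    ultimately show ?thesis by blast
  qed
  have "openin hyp.mtopology U \<longleftrightarrow> openin (top_of_set hyp_plane) U" for U
  proof
    assume U: "openin hyp.mtopology U"
    then have sub: "U \<subseteq> hyp_plane" by (simp add: hyp.openin_mtopology)
    have "\<exists>e>0. \<forall>w. dist w x < e \<longrightarrow> w \<in> U" if "x \<in> U" for x
    proof -
      obtain r where r: "r > 0" "hyp.mball x r \<subseteq> U" using U \<open>x \<in> U\<close> by (auto simp: hyp.openin_mtopology)
      obtain \<delta> where "\<delta> > 0" "\<forall>w. dist x w < \<delta> \<longrightarrow> w \<in> hyp_plane \<and> hyp_dist x w < r"
        using key2[of x r] r sub \<open>x \<in> U\<close> by blast
      then show ?thesis using r sub \<open>x \<in> U\<close>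
        by (metis dist_commute hyp.in_mball subset_eq)
    qed
    then have "open U" by (simp add: open_dist)
    then show "openin (top_of_set hyp_plane) U" using sub open_hyp_plane by (simp add: openin_open_eq)
  next
    assume "openin (top_of_set hyp_plane) U"
    then have U: "open U" "U \<subseteq> hyp_plane" using open_hyp_plane by (auto simp: openin_open_eq)
    have "\<exists>r>0. hyp.mball x r \<subseteq> U" if "x \<in> U" for x
    proof -
      obtain e where e: "e > 0" "\<forall>w. dist w x < e \<longrightarrow> w \<in> U" using U \<open>x \<in> U\<close> by (auto simp: open_dist)
      obtain r where "r > 0" "\<forall>w\<in>hyp_plane. hyp_dist x w < r \<longrightarrow> dist x w < e"
        using key1[of x e] e U \<open>x \<in> U\<close> by blast
      then show ?thesis using e
        by (metis dist_commute hyp.in_mball subset_eq)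
    qed
    then show "openin hyp.mtopology U" using U by (simp add: hyp.openin_mtopology)
  qed
  then show ?thesis by (simp add: topology_eq)
qed

section \<open>Dyadic boxes and the isoperimetric inequality\<close>

definition dyadic_level :: "complex \<Rightarrow> int" where
  "dyadic_level z = \<lfloor>log 2 (Im z)\<rfloor>"

text \<open>
  The pair \<open>(m, k)\<close> stands for the square with lower left corner \<open>2\<^sup>k m + 2\<^sup>k \<i>\<close> and side \<open>2\<^sup>k\<close>. The
  maps \<open>z \<mapsto> a z + b\<close> are hyperbolic isometries, so all these squares are congruent.
\<close>
definition dyadic_box :: "complex \<Rightarrow> int \<times> int" where
  "dyadic_box z = (\<lfloor>Re z / 2 powr dyadic_level z\<rfloor>, dyadic_level z)"

lemma dyadic_box_eq_iff:
  assumes "Im z > 0"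
  shows "dyadic_box z = (m, k) \<longleftrightarrow>
    2 powr k \<le> Im z \<and> Im z < 2 * 2 powr k \<and> 2 powr k * m \<le> Re z \<and> Re z < 2 powr k * (m + 1)"
proof -
  have "dyadic_level z = k \<longleftrightarrow> real_of_int k \<le> log 2 (Im z) \<and> log 2 (Im z) < k + 1"
    by (auto simp: dyadic_level_def floor_eq_iff)
  also have "\<dots> \<longleftrightarrow> 2 powr k \<le> Im z \<and> Im z < 2 * 2 powr k"
    using assms by (simp add: le_log_iff log_less_iff powr_add mult.commute)
  finally have 1: "dyadic_level z = k \<longleftrightarrow> 2 powr k \<le> Im z \<and> Im z < 2 * 2 powr k" .
  have 2: "\<lfloor>Re z / 2 powr k\<rfloor> = m \<longleftrightarrow> 2 powr k * m \<le> Re z \<and> Re z < 2 powr k * (m + 1)"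
    by (simp add: floor_eq_iff field_simps)
  have "dyadic_box z = (m, k) \<longleftrightarrow> dyadic_level z = k \<and> \<lfloor>Re z / 2 powr k\<rfloor> = m"
    by (auto simp: dyadic_box_def)
  then show ?thesis using 1 2 by simp
qed

text \<open>
  The bound is uniform in \<open>z\<close> because all quantities scale with the height of \<open>z\<close>: only boundedly
  many levels occur, and on each of them the possible real parts fill an interval whose length is
  a bounded multiple of the side of a box.
\<close>
lemma dyadic_boxes_near_point:
  "\<exists>K. \<forall>z\<in>hyp_plane. finite (dyadic_box ` {w \<in> hyp_plane. hyp_dist z w \<le> \<rho>}) \<and>
          card (dyadic_box ` {w \<in> hyp_plane. hyp_dist z w \<le> \<rho>}) \<le> K"
proof -
  define E e where "E = 2 * cosh \<rho>" and "e = log 2 E"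
  have E: "E \<ge> 2" using cosh_real_ge_1[of \<rho>] by (simp add: E_def)
  have e: "e \<ge> 0" using E by (simp add: e_def)
  define K where "K = nat \<lceil>2 * e + 2\<rceil> * nat \<lceil>4 * E\<^sup>2 + 2\<rceil>"
  have "finite (dyadic_box ` {w \<in> hyp_plane. hyp_dist z w \<le> \<rho>}) \<and>
        card (dyadic_box ` {w \<in> hyp_plane. hyp_dist z w \<le> \<rho>}) \<le> K" if "z \<in> hyp_plane" for z
  proof -
    define y where "y = Im z"
    have y: "y > 0" using that by (simp add: y_def hyp_plane_def)
    define A where "A = {\<lfloor>log 2 y - e\<rfloor>..\<lfloor>log 2 y + e\<rfloor>}"
    define B where "B k = {\<lfloor>(Re z - E * y) / 2 powr real_of_int k\<rfloor>..\<lfloor>(Re z + E * y) / 2 powr real_of_int k\<rfloor>}" for k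
    have sub: "dyadic_box ` {w \<in> hyp_plane. hyp_dist z w \<le> \<rho>} \<subseteq> (\<Union>k\<in>A. (\<lambda>m. (m, k)) ` B k)"
    proof
      fix b assume "b \<in> dyadic_box ` {w \<in> hyp_plane. hyp_dist z w \<le> \<rho>}"
      then obtain w where w: "Im w > 0" "hyp_dist z w \<le> \<rho>" and b: "b = dyadic_box w"
        by (auto simp: hyp_plane_def)
      have 1: "Im w \<le> E * y" "\<bar>Re z - Re w\<bar> \<le> E * y"
        using hyp_dist_le_imp_coordinates[of z w \<rho>] w y by (auto simp: E_def y_def)
      have 2: "y \<le> E * Im w"
        using hyp_dist_le_imp_coordinates(1)[of w z \<rho>] w y hyp.commute[of z w] by (auto simp: E_def y_def)
      have "log 2 (Im w) \<le> log 2 (E * y)" using 1 w y E by (subst log_le_cancel_iff) auto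
      also have "\<dots> = log 2 y + e" using y E by (simp add: log_mult e_def)
      finally have 3: "log 2 (Im w) \<le> log 2 y + e" .
      have "log 2 y \<le> log 2 (E * Im w)" using 2 w y E by (subst log_le_cancel_iff) auto
      also have "\<dots> = log 2 (Im w) + e" using w E by (simp add: log_mult e_def)
      finally have 4: "log 2 y - e \<le> log 2 (Im w)" by simp
      have k: "dyadic_level w \<in> A" using 3 4 by (auto simp: A_def dyadic_level_def intro!: floor_mono)
      have "(Re z - E * y) / 2 powr dyadic_level w \<le> Re w / 2 powr dyadic_level w"
           "Re w / 2 powr dyadic_level w \<le> (Re z + E * y) / 2 powr dyadic_level w"
        using 1 by (auto intro!: divide_right_mono)
      then have "\<lfloor>Re w / 2 powr dyadic_level w\<rfloor> \<in> B (dyadic_level w)"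
        by (auto simp: B_def intro!: floor_mono)
      then show "b \<in> (\<Union>k\<in>A. (\<lambda>m. (m, k)) ` B k)" using k b by (auto simp: dyadic_box_def)
    qed
    have cardA: "card A \<le> nat \<lceil>2 * e + 2\<rceil>"
    proof -
      have "real_of_int (\<lfloor>log 2 y + e\<rfloor> - \<lfloor>log 2 y - e\<rfloor> + 1) \<le> 2 * e + 2" by linarith
      then have "\<lfloor>log 2 y + e\<rfloor> - \<lfloor>log 2 y - e\<rfloor> + 1 \<le> \<lceil>2 * e + 2\<rceil>" by linarith
      then show ?thesis by (simp add: A_def nat_mono)
    qed
    have cardB: "card ((\<lambda>m. (m, k)) ` B k) \<le> nat \<lceil>4 * E\<^sup>2 + 2\<rceil>" if "k \<in> A" for k
    proof -
      have "log 2 y - e - 1 \<le> k" using that by (simp add: A_def) linarith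
      then have "2 powr (log 2 y - e - 1) \<le> 2 powr k" by simp
      moreover have "2 powr (log 2 y - e - 1) = y / (2 * E)"
        using y E by (simp add: powr_diff e_def)
      ultimately have "y / (2 * E) \<le> 2 powr k" by simp
      then have "y \<le> 2 * E * 2 powr k" using E by (simp add: field_simps)
      then have "E * y \<le> E * (2 * E * 2 powr k)" using E by (intro mult_left_mono) auto
      then have "E * y / 2 powr k \<le> 2 * E\<^sup>2"
        by (simp add: field_simps power2_eq_square)
      then have "(Re z + E * y) / 2 powr k - (Re z - E * y) / 2 powr k \<le> 4 * E\<^sup>2"
        by (simp add: add_divide_distrib diff_divide_distrib)
      then have "real_of_int (\<lfloor>(Re z + E * y) / 2 powr k\<rfloor> - \<lfloor>(Re z - E * y) / 2 powr k\<rfloor> + 1) \<le> 4 * E\<^sup>2 + 2"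
        by linarith
      then have "\<lfloor>(Re z + E * y) / 2 powr k\<rfloor> - \<lfloor>(Re z - E * y) / 2 powr k\<rfloor> + 1 \<le> \<lceil>4 * E\<^sup>2 + 2\<rceil>"
        by linarith
      then have "card (B k) \<le> nat \<lceil>4 * E\<^sup>2 + 2\<rceil>" by (simp add: B_def nat_mono)
      then show ?thesis using card_image_le[of "B k" "\<lambda>m. (m, k)"] by (simp add: B_def)
    qed
    have finU: "finite (\<Union>k\<in>A. (\<lambda>m. (m, k)) ` B k)" by (simp add: A_def B_def)
    have "card (\<Union>k\<in>A. (\<lambda>m. (m, k)) ` B k) \<le> (\<Sum>k\<in>A. card ((\<lambda>m. (m, k)) ` B k))"
      by (rule card_UN_le) (simp add: A_def)
    also have "\<dots> \<le> card A * nat \<lceil>4 * E\<^sup>2 + 2\<rceil>"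
      using sum_bounded_above[of A "\<lambda>k. card ((\<lambda>m. (m, k)) ` B k)"] cardB by simp
    also have "\<dots> \<le> K" using cardA by (simp add: K_def)
    finally show ?thesis using sub finU by (meson card_mono finite_subset order_trans)
  qed
  then show ?thesis by blast
qed

text \<open>
  A packing bound: a box is divided into \<open>n\<^sup>2\<close> equal squares, where \<open>n\<close> is so large that
  each has hyperbolic diameter less than \<open>r\<close> and therefore holds at most one of the points.
\<close>
lemma separated_points_in_dyadic_box:
  assumes "0 < r"
  shows "\<exists>N. \<forall>C b. C \<subseteq> hyp_plane \<and> dyadic_box ` C \<subseteq> {b} \<and>
           (\<forall>c\<in>C. \<forall>c'\<in>C. c \<noteq> c' \<longrightarrow> r \<le> hyp_dist c c') \<longrightarrow> finite C \<and> card C \<le> N"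
proof -
  have "cosh r > 1" using assms cosh_real_nonneg_less_iff[of 0 r] by simp
  then obtain n0 where n0: "inverse (real (Suc n0)) < cosh r - 1"
    using reals_Archimedean[of "cosh r - 1"] by auto
  define n where "n = Suc n0"
  have n: "n \<ge> 1" "1 / real n < cosh r - 1" using n0 by (auto simp: n_def inverse_eq_divide)
  have "finite C \<and> card C \<le> n * n"
    if C: "C \<subseteq> hyp_plane" "dyadic_box ` C \<subseteq> {b}" and sep: "\<forall>c\<in>C. \<forall>c'\<in>C. c \<noteq> c' \<longrightarrow> r \<le> hyp_dist c c'"
    for C b
  proof -
    obtain m k where b: "b = (m, k)" by (cases b)
    define s where "s = 2 powr real_of_int k"
    have s: "s > 0" by (simp add: s_def)
    have pos: "Im c > 0" if "c \<in> C" for c using C that by (auto simp: hyp_plane_def)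
    have box: "s \<le> Im c \<and> Im c < 2 * s \<and> s * m \<le> Re c \<and> Re c < s * (m + 1)" if "c \<in> C" for c
      using dyadic_box_eq_iff[OF pos[OF that], of m k] C that b by (auto simp: s_def)
    define g where "g c = (\<lfloor>n * (Re c / s)\<rfloor>, \<lfloor>n * (Im c / s)\<rfloor>)" for c
    have img: "g ` C \<subseteq> {n * m..<n * (m + 1)} \<times> {int n..<2 * n}"
    proof (intro image_subsetI)
      fix c assume "c \<in> C"
      then have "m \<le> Re c / s" "Re c / s < m + 1" "1 \<le> Im c / s" "Im c / s < 2"
        using box[of c] s by (auto simp: field_simps)
      then have "n * real_of_int m \<le> n * (Re c / s)" "n * (Re c / s) < n * (m + 1)"
          "real n * 1 \<le> n * (Im c / s)" "n * (Im c / s) < n * 2"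
        using n by (auto simp del: times_divide_eq_right)
      then show "g c \<in> {n * m..<n * (m + 1)} \<times> {int n..<2 * n}"
        by (auto simp: g_def le_floor_iff floor_less_iff algebra_simps)
    qed
    have inj: "inj_on g C"
    proof (rule inj_onI, rule ccontr)
      fix c c' assume cc: "c \<in> C" "c' \<in> C" "g c = g c'" "c \<noteq> c'"
      have "\<bar>n * (Re c / s) - n * (Re c' / s)\<bar> \<le> 1" "\<bar>n * (Im c / s) - n * (Im c' / s)\<bar> \<le> 1"
        using cc(3) by (simp_all add: g_def) linarith+
      then have "\<bar>n * (Re c - Re c') / s\<bar> \<le> 1" "\<bar>n * (Im c - Im c') / s\<bar> \<le> 1"
        by (simp_all add: algebra_simps diff_divide_distrib)
      then have "n * \<bar>Re c - Re c'\<bar> \<le> s" "n * \<bar>Im c - Im c'\<bar> \<le> s"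
        using s by (simp_all add: abs_mult pos_divide_le_eq)
      then have "\<bar>Re c - Re c'\<bar> \<le> s / n" "\<bar>Im c - Im c'\<bar> \<le> s / n"
        using n by (simp_all add: field_simps)
      then have "(Re c - Re c')\<^sup>2 \<le> (s / n)\<^sup>2" "(Im c - Im c')\<^sup>2 \<le> (s / n)\<^sup>2"
        using s n by (auto intro!: abs_le_square_iff[THEN iffD1])
      then have "(cmod (c - c'))\<^sup>2 \<le> 2 * (s / n)\<^sup>2"
        unfolding cmod_power2 minus_complex.sel by linarith
      also have "\<dots> = 2 * (1 / n)\<^sup>2 * (s * s)"
        by (simp add: power_divide power2_eq_square)
      also have "\<dots> \<le> 2 * (1 / n) * (s * s)"
        using n s by (intro mult_right_mono mult_left_mono) (auto simp: power2_eq_square field_simps)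
      also have "\<dots> < 2 * (cosh r - 1) * (s * s)"
        using n s by (intro mult_strict_right_mono) auto
      also have "\<dots> \<le> 2 * (cosh r - 1) * (Im c * Im c')"
        using box[OF cc(1)] box[OF cc(2)] s \<open>cosh r > 1\<close> by (intro mult_left_mono mult_mono) auto
      finally have "hyp_dist c c' < r"
        using hyp_dist_less_iff[OF pos[OF cc(1)] pos[OF cc(2)], of r] assms by simp
      then show False using sep cc by force
    qed
    have "finite C" using img inj by (meson finite_SigmaI finite_atLeastLessThan_int finite_imageD finite_subset)
    moreover have "card C \<le> card ({n * m..<n * (m + 1)} \<times> {int n..<2 * n})"
      using card_inj_on_le[OF inj img] by simp
    ultimately show ?thesis by (simp add: card_cartesian_product algebra_simps)
  qed
  then show ?thesis by blast
qed

lemma open_minus_finite_nonempty: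
  fixes U :: "complex set"
  assumes "open U" "U \<noteq> {}" "finite V"
  shows "\<exists>x. x \<in> U - V"
proof (rule ccontr)
  assume "\<not> ?thesis"
  then have "finite U" using \<open>finite V\<close> by (meson DiffI finite_subset subsetI)
  then show False using assms finite_imp_not_open by blast
qed

lemma dyadic_box_nonempty:
  "\<exists>z. Im z > 0 \<and> dyadic_box z = (m, k)"
proof -
  have "dyadic_box (Complex (2 powr k * m) (2 powr k)) = (m, k)"
    by (subst dyadic_box_eq_iff) (auto simp: algebra_simps)
  moreover have "Im (Complex (2 powr k * m) (2 powr k)) > 0" by simp
  ultimately show ?thesis by blast
qed

text \<open>
  The parent of a box is the box of twice the side on which it hangs. Every box has two children;
  this branching is the source of the isoperimetric inequality.
\<close>
definition dyadic_parent :: "int \<times> int \<Rightarrow> int \<times> int" where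
  "dyadic_parent b = (fst b div 2, snd b + 1)"

lemma card_dyadic_children:
  assumes "finite F"
  shows "finite {b. dyadic_parent b \<in> F}" "card {b. dyadic_parent b \<in> F} = 2 * card F"
proof -
  define l r where "l b = (2 * fst b, snd b - 1)" and "r b = (2 * fst b + 1, snd b - 1)" for b :: "int \<times> int"
  have eq: "{b. dyadic_parent b \<in> F} = l ` F \<union> r ` F"
  proof (rule subset_antisym; rule subsetI)
    fix b :: "int \<times> int" assume "b \<in> {b. dyadic_parent b \<in> F}"
    then have F: "dyadic_parent b \<in> F" by simp
    have "b = l (dyadic_parent b) \<or> b = r (dyadic_parent b)"
      by (cases b) (simp add: l_def r_def dyadic_parent_def, presburger)
    then show "b \<in> l ` F \<union> r ` F" using F by blast
  qed (auto simp: l_def r_def dyadic_parent_def)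
  have inj: "inj_on l F" "inj_on r F"
    by (auto simp: inj_on_def l_def r_def prod_eq_iff)
  have disj: "l ` F \<inter> r ` F = {}"
    by (auto simp: l_def r_def) presburger
  show "finite {b. dyadic_parent b \<in> F}" using eq assms by simp
  show "card {b. dyadic_parent b \<in> F} = 2 * card F"
    using eq disj inj assms by (simp add: card_Un_disjoint card_image)
qed

text \<open>
  The rectangle \<open>U\<close> is an open convex neighbourhood of a box and its two children. It serves to
  pass from a point of the box to a point of a child without meeting a given finite set.
\<close>
lemma dyadic_window:
  fixes m k :: int
  defines "U \<equiv> {z. 2 powr k * (m - 1) < Re z \<and> Re z < 2 powr k * (m + 2) \<and>
                   2 powr k / 4 < Im z \<and> Im z < 4 * 2 powr k}"
  shows "open U" "convex U" "U \<subseteq> hyp_plane"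
    and "\<And>z w. z \<in> U \<Longrightarrow> w \<in> U \<Longrightarrow> hyp_dist z w \<le> 2 * arcosh 41"
    and "\<And>z. Im z > 0 \<Longrightarrow> dyadic_box z = (m, k) \<Longrightarrow> z \<in> U"
    and "\<And>z. Im z > 0 \<Longrightarrow> dyadic_parent (dyadic_box z) = (m, k) \<Longrightarrow> z \<in> U"
proof -
  have U: "U = {z. Re z > 2 powr k * (m - 1)} \<inter> {z. Re z < 2 powr k * (m + 2)} \<inter>
               {z. Im z > 2 powr k / 4} \<inter> {z. Im z < 4 * 2 powr k}"
    by (auto simp: U_def)
  show "open U" unfolding U
    by (intro open_Int open_halfspace_Re_gt open_halfspace_Re_lt open_halfspace_Im_gt open_halfspace_Im_lt)
  show "convex U" unfolding U
    by (intro convex_Int convex_halfspace_Re_gt convex_halfspace_Re_lt convex_halfspace_Im_gt convex_halfspace_Im_lt)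
  show sub: "U \<subseteq> hyp_plane"
  proof
    fix z assume "z \<in> U"
    then have "2 powr k / 4 < Im z" by (simp add: U_def)
    moreover have "(0::real) < 2 powr k" by simp
    ultimately have "Im z > 0" by linarith
    then show "z \<in> hyp_plane" by (simp add: hyp_plane_def)
  qed
  define s where "s = 2 powr real_of_int k"
  have s: "s > 0" by (simp add: s_def)
  define p where "p = Complex (s * m) s"
  have p: "p \<in> hyp_plane" using s by (simp add: p_def hyp_plane_def)
  have near: "hyp_dist p z \<le> arcosh 41" if "z \<in> U" for z
  proof -
    have z: "s * (m - 1) < Re z" "Re z < s * (m + 2)" "s / 4 < Im z" "Im z < 4 * s"
      using that by (auto simp: U_def s_def)
    \<comment> \<open>The squared Euclidean distance is at most \<open>20 s\<^sup>2\<close> and the product of the heights at least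
      \<open>s\<^sup>2 / 4\<close>; the constant 41 is the solution of \<open>2 (c - 1) / 4 = 20\<close>.\<close>
    have "\<bar>Re p - Re z\<bar> \<le> 2 * s" "\<bar>Im p - Im z\<bar> \<le> 4 * s"
      using z s by (simp_all add: p_def algebra_simps)
    then have "(Re p - Re z)\<^sup>2 \<le> (2 * s)\<^sup>2" "(Im p - Im z)\<^sup>2 \<le> (4 * s)\<^sup>2"
      using power_mono[OF _ abs_ge_zero, of "Re p - Re z" "2 * s" 2]
        power_mono[OF _ abs_ge_zero, of "Im p - Im z" "4 * s" 2] by auto
    then have "(cmod (p - z))\<^sup>2 \<le> 20 * s * s"
      unfolding cmod_power2 minus_complex.sel by (simp add: power2_eq_square)
    also have "\<dots> = 2 * (cosh (arcosh 41) - 1) * (s * (s / 4))" by simp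
    also have "\<dots> \<le> 2 * (cosh (arcosh 41) - 1) * (Im p * Im z)"
      using z s by (intro mult_left_mono mult_mono) (auto simp: p_def)
    finally show ?thesis using z s by (subst hyp_dist_le_iff) (auto simp: p_def)
  qed
  show "hyp_dist z w \<le> 2 * arcosh 41" if "z \<in> U" "w \<in> U" for z w
    using near[OF that(1)] near[OF that(2)] hyp.triangle[of z p w] hyp.commute[of z p] sub p that by force
  show "z \<in> U" if "Im z > 0" "dyadic_box z = (m, k)" for z
  proof -
    have "s \<le> Im z \<and> Im z < 2 * s \<and> s * m \<le> Re z \<and> Re z < s * (m + 1)"
      using that by (simp add: dyadic_box_eq_iff s_def)
    then show ?thesis using s unfolding U_def s_def[symmetric] by (auto simp: algebra_simps)
  qed
  show "z \<in> U" if z: "Im z > 0" "dyadic_parent (dyadic_box z) = (m, k)" for z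
  proof -
    define m' where "m' = fst (dyadic_box z)"
    have "dyadic_box z = (m', k - 1)" "m = m' div 2"
      using z by (auto simp: dyadic_parent_def m'_def prod_eq_iff)
    then have "2 powr (k - 1) \<le> Im z" "Im z < 2 * 2 powr (k - 1)"
        "2 powr (k - 1) * m' \<le> Re z" "Re z < 2 powr (k - 1) * (m' + 1)"
      using z(1) dyadic_box_eq_iff[of z m' "k - 1"] by auto
    moreover have "2 powr (real_of_int k - 1) = s / 2" by (simp add: s_def powr_diff)
    ultimately have *: "s / 2 \<le> Im z" "Im z < s" "s / 2 * m' \<le> Re z" "Re z < s / 2 * (m' + 1)"
      by auto
    have m: "2 * m \<le> m'" "m' + 1 \<le> 2 * m + 2" using \<open>m = m' div 2\<close> by presburger+
    have "s / 2 * (2 * real_of_int m) \<le> s / 2 * m'" using m(1) s by (intro mult_left_mono) linarith+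
    moreover have "s / 2 * (m' + 1) \<le> s / 2 * (2 * m + 2)" using m(2) s by (intro mult_left_mono) linarith+
    ultimately have "s / 2 * (2 * real_of_int m) \<le> Re z" "Re z < s / 2 * (2 * m + 2)" using * by linarith+
    then have "s * m \<le> Re z" "Re z < s * (m + 1)" by (simp_all add: algebra_simps)
    then show ?thesis using * s unfolding U_def s_def[symmetric] by (auto simp: algebra_simps)
  qed
qed

text \<open>
  Let \<open>F\<close> be the set of boxes met by the tiles of \<open>S\<close>. A box contains boundedly many centres \<open>c t\<close>,
  so \<open>F\<close> is not much smaller than \<open>S\<close>. At least \<open>card F\<close> children of boxes of \<open>F\<close> are not in \<open>F\<close>.
  The window around such a child and its parent stays connected when \<open>V\<close> is removed, and it meets
  tiles of \<open>S\<close> as well as tiles not in \<open>S\<close>; both kinds form relatively closed subsets covering it, hence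
  they have a common point. This produces a tile of \<open>S\<close> in contact with the outside near the
  given child, and each tile is near boundedly many boxes only.
\<close>
lemma hyperbolic_isoperimetric_inequality:
  fixes \<T> :: "complex set set" and c :: "complex set \<Rightarrow> complex"
  assumes r: "0 < r"
    and cover: "\<Union>\<T> = hyp_plane"
    and closed: "\<And>t. t \<in> \<T> \<Longrightarrow> closedin (top_of_set hyp_plane) t"
    and regular: "\<And>t. t \<in> \<T> \<Longrightarrow> t \<subseteq> closure (interior t)"
    and disj: "\<And>t t'. t \<in> \<T> \<Longrightarrow> t' \<in> \<T> \<Longrightarrow> t \<noteq> t' \<Longrightarrow> interior t \<inter> interior t' = {}"
    and centre: "\<And>t. t \<in> \<T> \<Longrightarrow> c t \<in> hyp_plane"
    and inball: "\<And>t w. t \<in> \<T> \<Longrightarrow> w \<in> hyp_plane \<Longrightarrow> hyp_dist (c t) w < r \<Longrightarrow> w \<in> interior t"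
    and diam: "\<And>t w. t \<in> \<T> \<Longrightarrow> w \<in> t \<Longrightarrow> hyp_dist (c t) w \<le> D"
  shows "\<exists>\<kappa>. \<forall>S V. S \<subseteq> \<T> \<and> finite S \<and> finite V \<longrightarrow>
           card S \<le> \<kappa> * card {t \<in> S. \<exists>x\<in>t - V. \<exists>t'\<in>\<T> - S. x \<in> t'}"
proof -
  have cin: "c t \<in> interior t" if "t \<in> \<T>" for t
    using inball[OF that centre[OF that]] centre[OF that] r by simp
  have sep: "r \<le> hyp_dist (c t) (c t')" if "t \<in> \<T>" "t' \<in> \<T>" "t \<noteq> t'" for t t'
    using inball[of t "c t'"] cin disj[OF that] centre that by force
  have injc: "inj_on c \<T>"
  proof (rule inj_onI, rule ccontr)
    fix t t' assume *: "t \<in> \<T>" "t' \<in> \<T>" "c t = c t'" "t \<noteq> t'"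
    then show False using cin[OF *(1)] cin[OF *(2)] disj[OF *(1,2,4)] by auto
  qed
  have tsub: "t \<subseteq> hyp_plane" if "t \<in> \<T>" for t using cover that by blast
  obtain N where N: "\<And>C b. C \<subseteq> hyp_plane \<Longrightarrow> dyadic_box ` C \<subseteq> {b} \<Longrightarrow>
           (\<forall>c\<in>C. \<forall>c'\<in>C. c \<noteq> c' \<longrightarrow> r \<le> hyp_dist c c') \<Longrightarrow> finite C \<and> card C \<le> N"
    using separated_points_in_dyadic_box[OF r] by meson
  have fibre: "finite {t \<in> \<T>. dyadic_box (c t) = b} \<and> card {t \<in> \<T>. dyadic_box (c t) = b} \<le> N" for b
  proof -
    let ?A = "{t \<in> \<T>. dyadic_box (c t) = b}"
    have 1: "finite (c ` ?A) \<and> card (c ` ?A) \<le> N"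
    proof (rule N[of _ b])
      show "c ` ?A \<subseteq> hyp_plane" using centre by blast
      show "dyadic_box ` c ` ?A \<subseteq> {b}" by blast
      show "\<forall>x\<in>c ` ?A. \<forall>y\<in>c ` ?A. x \<noteq> y \<longrightarrow> r \<le> hyp_dist x y" using sep by blast
    qed
    have 2: "inj_on c ?A" by (rule inj_on_subset[OF injc]) blast
    show ?thesis using 1 finite_imageD[OF conjunct1[OF 1] 2] card_image[OF 2] by simp
  qed
  have locfin: "finite {t \<in> \<T>. hyp_dist z (c t) \<le> \<rho>}" if "z \<in> hyp_plane" for z \<rho>
  proof -
    let ?W = "{w \<in> hyp_plane. hyp_dist z w \<le> \<rho>}"
    have "finite (dyadic_box ` ?W)"
      by (rule exE[OF dyadic_boxes_near_point[of \<rho>]]) (drule bspec[OF _ that], erule conjunct1)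
    then have fin: "finite (\<Union>b\<in>dyadic_box ` ?W. {t \<in> \<T>. dyadic_box (c t) = b})"
      using conjunct1[OF fibre] by (rule finite_UN_I)
    show ?thesis
    proof (rule finite_subset[OF subsetI fin])
      fix t assume "t \<in> {t \<in> \<T>. hyp_dist z (c t) \<le> \<rho>}"
      then have t: "t \<in> \<T>" "hyp_dist z (c t) \<le> \<rho>" by simp_all
      then have "dyadic_box (c t) \<in> dyadic_box ` ?W" using centre[OF t(1)] by (intro imageI) simp
      then show "t \<in> (\<Union>b\<in>dyadic_box ` ?W. {t \<in> \<T>. dyadic_box (c t) = b})"
        by (rule UN_I) (simp add: t)
    qed
  qed
  define C where "C = 2 * arcosh (41::real)"
  obtain K where K: "\<And>z. z \<in> hyp_plane \<Longrightarrow>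
      finite (dyadic_box ` {w \<in> hyp_plane. hyp_dist z w \<le> D + C}) \<and>
      card (dyadic_box ` {w \<in> hyp_plane. hyp_dist z w \<le> D + C}) \<le> K"
    using dyadic_boxes_near_point[of "D + C"] by meson
  define W where "W t = dyadic_box ` {w \<in> hyp_plane. hyp_dist (c t) w \<le> D + C}" for t
  have Wfin: "finite (W t)" and Wcard: "card (W t) \<le> K" if "t \<in> \<T>" for t
    unfolding W_def using K[OF centre[OF that]] by simp_all
  have "card S \<le> N * K * card {t \<in> S. \<exists>x\<in>t - V. \<exists>t'\<in>\<T> - S. x \<in> t'}"
    if S: "S \<subseteq> \<T>" "finite S" and V: "finite V" for S V
  proof -
    define Bd where "Bd = {t \<in> S. \<exists>x\<in>t - V. \<exists>t'\<in>\<T> - S. x \<in> t'}"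
    define F where "F = dyadic_box ` \<Union>S"
    have finF: "finite F"
    proof -
      have "F \<subseteq> (\<Union>t\<in>S. W t)"
      proof -
        have "C \<ge> 0" by (simp add: C_def)
        then have "hyp_dist (c t) w \<le> D + C \<and> w \<in> hyp_plane" if "t \<in> S" "w \<in> t" for t w
          using diam[of t w] tsub[of t] that S by force
        then show ?thesis unfolding F_def W_def by blast
      qed
      moreover have "finite \<dots>" using S Wfin by (intro finite_UN_I) auto
      ultimately show ?thesis by (rule finite_subset)
    qed
    have SF: "card S \<le> N * card F"
    proof -
      have "S \<subseteq> (\<Union>b\<in>F. {t \<in> \<T>. dyadic_box (c t) = b})"
      proof
        fix t assume t: "t \<in> S"
        then have "c t \<in> \<Union>S" using subsetD[OF interior_subset cin[of t]] S by blast
        then have "dyadic_box (c t) \<in> F" unfolding F_def by (rule imageI)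
        then show "t \<in> (\<Union>b\<in>F. {t \<in> \<T>. dyadic_box (c t) = b})"
          using t S(1) by blast
      qed
      then have "card S \<le> card (\<Union>b\<in>F. {t \<in> \<T>. dyadic_box (c t) = b})"
        using finF conjunct1[OF fibre] by (intro card_mono finite_UN_I)
      also have "\<dots> \<le> (\<Sum>b\<in>F. card {t \<in> \<T>. dyadic_box (c t) = b})"
        by (rule card_UN_le[OF finF])
      also have "\<dots> \<le> card F * N" using sum_bounded_above[where A = F and K = N, OF conjunct2[OF fibre]] by simp
      finally show ?thesis by (simp add: mult.commute)
    qed
    define G where "G = {b. dyadic_parent b \<in> F} - F"
    have "card F \<le> card G"
      using card_dyadic_children[OF finF] diff_card_le_card_Diff[OF finF, of "{b. dyadic_parent b \<in> F}"]
      by (simp add: G_def)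
    also have "card G \<le> card (\<Union>t\<in>Bd. W t)"
    proof (rule card_mono)
      show "finite (\<Union>t\<in>Bd. W t)"
        using S Wfin by (intro finite_UN_I) (auto simp: Bd_def)
      show "G \<subseteq> (\<Union>t\<in>Bd. W t)"
      proof
        fix b' assume b': "b' \<in> G"
        obtain m k where par: "dyadic_parent b' = (m, k)" by (cases "dyadic_parent b'")
        define U where "U = {z. 2 powr k * (m - 1) < Re z \<and> Re z < 2 powr k * (m + 2) \<and>
                   2 powr k / 4 < Im z \<and> Im z < 4 * 2 powr k}"
        note window = dyadic_window[where k = k and m = m, folded U_def]
        have "(m, k) \<in> F" using b' par by (simp add: G_def)
        then obtain z t where z: "z \<in> t" "t \<in> S" "dyadic_box z = (m, k)" by (auto simp: F_def)
        have "z \<in> hyp_plane" using tsub z S(1) by blast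
        then have zU: "z \<in> U" using window(5)[OF _ z(3)] by (simp add: hyp_plane_def)
        obtain w where w: "Im w > 0" "dyadic_box w = b'"
          using dyadic_box_nonempty[of "fst b'" "snd b'"] by auto
        have wU: "w \<in> U" using window(6) w par by auto
        have "w \<notin> \<Union>S" using w b' by (auto simp: G_def F_def)
        moreover have "w \<in> \<Union>\<T>" using cover w(1) by (simp add: hyp_plane_def)
        ultimately obtain t' where t': "t' \<in> \<T> - S" "w \<in> t'" by blast
        have meet: "\<exists>x. x \<in> (U - V) \<inter> t" if t: "t \<in> \<T>" and y: "y \<in> t" "y \<in> U" for t y
        proof -
          have "y \<in> closure (interior t)" using regular t y by blast
          then have "U \<inter> interior t \<noteq> {}"
            using y window(1) open_Int_closure_eq_empty by blast
          then obtain x where "x \<in> U \<inter> interior t - V"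
            using open_minus_finite_nonempty[of "U \<inter> interior t" V] window(1) V by blast
          then show ?thesis using interior_subset[of t] by blast
        qed
        define A where "A = {t \<in> \<T> - S. t \<inter> U \<noteq> {}}"
        have finA: "finite A"
        proof -
          have "A \<subseteq> {t \<in> \<T>. hyp_dist z (c t) \<le> C + D}"
          proof
            fix t assume t: "t \<in> A"
            then obtain y where y: "y \<in> t" "y \<in> U" "t \<in> \<T>" by (auto simp: A_def)
            have "hyp_dist z (c t) \<le> hyp_dist z y + hyp_dist y (c t)"
              using y zU window(3) centre by (intro hyp.triangle) auto
            also have "\<dots> \<le> C + D"
              using window(4)[OF zU y(2)] diam[OF y(3,1)] hyp.commute[of y] by (simp add: C_def)
            finally show "t \<in> {t \<in> \<T>. hyp_dist z (c t) \<le> C + D}" using y by simp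
          qed
          moreover have "finite {t \<in> \<T>. hyp_dist z (c t) \<le> C + D}"
            using window(3) zU by (intro locfin) blast
          ultimately show ?thesis by (rule finite_subset)
        qed
        have clos: "closedin (top_of_set (U - V)) ((U - V) \<inter> \<Union>X)" if "X \<subseteq> \<T>" "finite X" for X
        proof -
          have "closedin (top_of_set hyp_plane) (\<Union>X)"
            using that closed by (intro closedin_Union) auto
          then obtain Z where "closed Z" "\<Union>X = hyp_plane \<inter> Z" by (auto simp: closedin_closed)
          then have "(U - V) \<inter> \<Union>X = (U - V) \<inter> Z" using window(3) by blast
          then show ?thesis using \<open>closed Z\<close> by (auto simp: closedin_closed)
        qed
        have conn: "connected (U - V)"
          using window(1) convex_connected[OF window(2)] V by (intro connected_open_diff_countable) (auto simp: countable_finite)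
        have "(U - V) \<inter> \<Union>S \<inter> ((U - V) \<inter> \<Union>A) \<noteq> {}"
        proof
          assume emp: "(U - V) \<inter> \<Union>S \<inter> ((U - V) \<inter> \<Union>A) = {}"
          have un: "U - V \<subseteq> (U - V) \<inter> \<Union>S \<union> (U - V) \<inter> \<Union>A"
          proof
            fix x assume x: "x \<in> U - V"
            then have "x \<in> \<Union>\<T>" using window(3) cover by blast
            then show "x \<in> (U - V) \<inter> \<Union>S \<union> (U - V) \<inter> \<Union>A" using x by (auto simp: A_def)
          qed
          have ne: "(U - V) \<inter> \<Union>S \<noteq> {}" "(U - V) \<inter> \<Union>A \<noteq> {}"
          proof -
            have "t \<in> \<T>" "t' \<in> \<T>" "t' \<in> A" using z(2) t' wU S(1) by (auto simp: A_def)
            then show "(U - V) \<inter> \<Union>S \<noteq> {}" "(U - V) \<inter> \<Union>A \<noteq> {}"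
              using meet[of t z] meet[of t' w] z(1,2) zU t'(2) wU by blast+
          qed
          have "closedin (top_of_set (U - V)) ((U - V) \<inter> \<Union>S)" "closedin (top_of_set (U - V)) ((U - V) \<inter> \<Union>A)"
            using clos S finA by (auto simp: A_def)
          then show False using conn un ne emp unfolding connected_closedin by blast
        qed
        then obtain x t1 t2 where x: "x \<in> U" "x \<notin> V" "t1 \<in> S" "x \<in> t1" "t2 \<in> \<T> - S" "x \<in> t2"
          by (auto simp: A_def)
        then have Bd: "t1 \<in> Bd" by (auto simp: Bd_def)
        have "hyp_dist (c t1) w \<le> hyp_dist (c t1) x + hyp_dist x w"
          using x S centre window(3) wU by (intro hyp.triangle) auto
        also have "\<dots> \<le> D + C" using diam[of t1 x] x S window(4)[OF x(1) wU] by (auto simp: C_def intro!: add_mono)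
        finally show "b' \<in> (\<Union>t\<in>Bd. W t)"
          using Bd w by (auto simp: hyp_plane_def W_def)
      qed
    qed
    also have "\<dots> \<le> (\<Sum>t\<in>Bd. card (W t))"
      by (rule card_UN_le) (use S in \<open>auto simp: Bd_def\<close>)
    also have "\<dots> \<le> card Bd * K"
      using sum_bounded_above[of Bd "\<lambda>t. card (W t)" K] Wcard S by (simp add: Bd_def subset_iff)
    finally have "card F \<le> card Bd * K" .
    then have "card S \<le> N * (card Bd * K)" using SF mult_le_mono2 order_trans by blast
    then have "card S \<le> N * K * card Bd" by (simp only: mult_ac)
    then show ?thesis by (simp only: Bd_def)
  qed
  then show ?thesis by blast
qed

section \<open>Growth of a substitution and of its boundary part\<close>

text \<open>
  The transpose of the matrix of a substitution, acting on weights \<open>\<psi>\<close> of types: a tile of type \<open>j\<close> has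
  children indexed by \<open>G j\<close>, and the child \<open>g\<close> has type \<open>ty j g\<close>.
\<close>
definition children_sum :: "('t \<Rightarrow> 'g set) \<Rightarrow> ('t \<Rightarrow> 'g \<Rightarrow> 't) \<Rightarrow> ('t \<Rightarrow> nat) \<Rightarrow> 't \<Rightarrow> nat" where
  "children_sum G ty \<psi> j = (\<Sum>g\<in>G j. \<psi> (ty j g))"

inductive occurs_after :: "('t \<Rightarrow> 'g set) \<Rightarrow> ('t \<Rightarrow> 'g \<Rightarrow> 't) \<Rightarrow> nat \<Rightarrow> 't \<Rightarrow> 't \<Rightarrow> bool"
  for G ty where
  "occurs_after G ty 0 j j"
| "g \<in> G j \<Longrightarrow> occurs_after G ty k (ty j g) l \<Longrightarrow> occurs_after G ty (Suc k) j l"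

lemma occurs_after_append:
  assumes "occurs_after G ty k j l" "g \<in> G l"
  shows "occurs_after G ty (Suc k) j (ty l g)"
  using assms by (induction rule: occurs_after.induct) (auto intro: occurs_after.intros)

text \<open>
  Two substitutions on the same types are compared: \<open>G\<close> lists all children, \<open>H\<close> only those that can
  remain at the boundary.
\<close>
locale type_substitution =
  fixes d :: nat and G H :: "nat \<Rightarrow> 'g set" and ty :: "nat \<Rightarrow> 'g \<Rightarrow> nat"
  assumes fin: "\<And>j. j < d \<Longrightarrow> finite (G j)"
    and ty: "\<And>j g. j < d \<Longrightarrow> g \<in> G j \<Longrightarrow> ty j g < d"
    and sub: "\<And>j. j < d \<Longrightarrow> H j \<subseteq> G j"
begin

abbreviation A where "A \<equiv> children_sum G ty"
abbreviation B where "B \<equiv> children_sum H ty"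

lemma tyH: "j < d \<Longrightarrow> g \<in> H j \<Longrightarrow> ty j g < d"
  using ty sub by blast

lemma A_mono: "(\<And>l. l < d \<Longrightarrow> \<psi> l \<le> \<phi> l) \<Longrightarrow> j < d \<Longrightarrow> A \<psi> j \<le> A \<phi> j"
  unfolding children_sum_def using ty by (intro sum_mono) auto

lemma B_mono: "(\<And>l. l < d \<Longrightarrow> \<psi> l \<le> \<phi> l) \<Longrightarrow> j < d \<Longrightarrow> B \<psi> j \<le> B \<phi> j"
  unfolding children_sum_def using tyH by (intro sum_mono) auto

lemma A_pow_mono: "(\<And>l. l < d \<Longrightarrow> \<psi> l \<le> \<phi> l) \<Longrightarrow> j < d \<Longrightarrow> (A ^^ n) \<psi> j \<le> (A ^^ n) \<phi> j"
  by (induction n arbitrary: j) (auto intro!: A_mono)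

lemma B_pow_mono: "(\<And>l. l < d \<Longrightarrow> \<psi> l \<le> \<phi> l) \<Longrightarrow> j < d \<Longrightarrow> (B ^^ n) \<psi> j \<le> (B ^^ n) \<phi> j"
  by (induction n arbitrary: j) (auto intro!: B_mono)

lemma B_le_A: "j < d \<Longrightarrow> B \<psi> j \<le> A \<psi> j"
  unfolding children_sum_def using fin sub by (intro sum_mono2) auto

lemma B_pow_le_A_pow: "j < d \<Longrightarrow> (B ^^ n) \<psi> j \<le> (A ^^ n) \<psi> j"
proof (induction n arbitrary: j)
  case (Suc n)
  have "(B ^^ Suc n) \<psi> j \<le> B ((A ^^ n) \<psi>) j" using B_mono[OF Suc.IH Suc.prems] by simp
  also have "\<dots> \<le> (A ^^ Suc n) \<psi> j" using B_le_A[OF Suc.prems] by simp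
  finally show ?case .
qed simp

lemma A_add: "A (\<lambda>l. \<psi> l + \<phi> l) = (\<lambda>j. A \<psi> j + A \<phi> j)"
  by (simp add: children_sum_def sum.distrib fun_eq_iff)

lemma A_pow_add: "(A ^^ n) (\<lambda>l. \<psi> l + \<phi> l) = (\<lambda>j. (A ^^ n) \<psi> j + (A ^^ n) \<phi> j)"
  by (induction n) (simp_all add: A_add)

lemma A_pow_const: "(A ^^ n) (\<lambda>l. c * \<psi> l) = (\<lambda>j. c * (A ^^ n) \<psi> j)"
  by (induction n) (auto simp: children_sum_def sum_distrib_left fun_eq_iff)

lemma occurs_imp_le:
  assumes "occurs_after G ty k j l" "j < d"
  shows "\<psi> l \<le> (A ^^ k) \<psi> j"
  using assms
proof (induction rule: occurs_after.induct)
  case (2 g j k l)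
  have "\<psi> l \<le> (A ^^ k) \<psi> (ty j g)" using 2 ty by auto
  also have "\<dots> \<le> A ((A ^^ k) \<psi>) j" unfolding children_sum_def
    using fin 2 by (intro member_le_sum) auto
  finally show ?case by simp
qed simp

text \<open>
  Some child \<open>g\<close> of \<open>i\<close>, again of type \<open>i\<close>, is missing from \<open>H\<close>. By the positivity of the \<open>k\<close>-th power,
  every type \<open>l\<close> is reached from every type \<open>j\<close> in \<open>2 k + 1\<close> steps through this missing child. So the
  \<open>(2 k + 1)\<close>-th powers of the two operators differ by at least the largest weight, which is a fixed
  fraction of the value of the larger one.
\<close>
lemma thin_boundary:
  assumes prim: "\<And>j l. j < d \<Longrightarrow> l < d \<Longrightarrow> occurs_after G ty k j l"
    and i: "i < d" "g \<in> G i - H i" "ty i g = i"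
  shows "\<exists>s\<ge>1. \<exists>C\<ge>1. \<forall>n. C ^ n * (B ^^ (n * s)) (\<lambda>_. 1) i \<le> (C - 1) ^ n * (A ^^ (n * s)) (\<lambda>_. 1) i"
proof -
  define s where "s = k + Suc k"
  define C where "C = Max ((A ^^ s) (\<lambda>_. 1) ` {..<d}) + 1"
  have drop: "(B ^^ s) \<psi> j + \<psi> l \<le> (A ^^ s) \<psi> j" if jl: "j < d" "l < d" for \<psi> j l
  proof -
    define \<phi> where "\<phi> = (A ^^ k) \<psi>"
    \<comment> \<open>The weight \<open>\<psi> l\<close> lost through the missing child, placed at the type \<open>i\<close> after \<open>k\<close> steps.\<close>
    define \<delta> where "\<delta> m = (if m = i then \<psi> l else 0)" for m
    have one: "B \<phi> m + \<delta> m \<le> A \<phi> m" if m: "m < d" for m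
    proof (cases "m = i")
      case True
      have "\<psi> l \<le> \<phi> i" unfolding \<phi>_def using occurs_imp_le prim i jl by blast
      then have "B \<phi> i + \<psi> l \<le> (\<Sum>h\<in>H i. \<phi> (ty i h)) + (\<Sum>h\<in>{g}. \<phi> (ty i h))"
        using i by (simp add: children_sum_def)
      also have "\<dots> = (\<Sum>h\<in>H i \<union> {g}. \<phi> (ty i h))"
        using fin[OF i(1)] sub[OF i(1)] i by (subst sum.union_disjoint) (auto intro: finite_subset)
      also have "\<dots> \<le> A \<phi> i" unfolding children_sum_def
        using fin[OF i(1)] sub[OF i(1)] i by (intro sum_mono2) auto
      finally show ?thesis using True by (simp add: \<delta>_def)
    next
      case False
      then show ?thesis using B_le_A[OF m] by (simp add: \<delta>_def)
    qed
    have "(B ^^ s) \<psi> j + \<psi> l = (B ^^ k) (B ((B ^^ k) \<psi>)) j + \<delta> i"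
      by (simp add: s_def funpow_add \<delta>_def funpow_swap1)
    also have "\<dots> \<le> (A ^^ k) (B \<phi>) j + (A ^^ k) \<delta> j"
    proof (rule add_mono)
      have "(B ^^ k) (B ((B ^^ k) \<psi>)) j \<le> (B ^^ k) (B \<phi>) j"
        using jl unfolding \<phi>_def by (intro B_pow_mono B_mono B_pow_le_A_pow)
      also have "\<dots> \<le> (A ^^ k) (B \<phi>) j" using jl by (rule_tac B_pow_le_A_pow)
      finally show "(B ^^ k) (B ((B ^^ k) \<psi>)) j \<le> (A ^^ k) (B \<phi>) j" .
      show "\<delta> i \<le> (A ^^ k) \<delta> j" using occurs_imp_le prim i jl by blast
    qed
    also have "\<dots> = (A ^^ k) (\<lambda>m. B \<phi> m + \<delta> m) j" by (simp add: A_pow_add)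
    also have "\<dots> \<le> (A ^^ k) (A \<phi>) j" using jl one by (intro A_pow_mono)
    also have "\<dots> = (A ^^ s) \<psi> j" by (simp add: s_def funpow_add \<phi>_def funpow_swap1)
    finally show ?thesis .
  qed
  have step: "C * (B ^^ s) \<psi> j \<le> (C - 1) * (A ^^ s) \<psi> j" if j: "j < d" for \<psi> j
  proof -
    define M where "M = Max (\<psi> ` {..<d})"
    have ne: "\<psi> ` {..<d} \<noteq> {}" using i by auto
    then have "M \<in> \<psi> ` {..<d}" unfolding M_def by (intro Max_in) auto
    then obtain l where l: "l < d" "M = \<psi> l" by auto
    have "(A ^^ s) \<psi> j \<le> (A ^^ s) (\<lambda>l. M * 1) j"
      using j by (intro A_pow_mono) (auto simp: M_def)
    also have "\<dots> = M * (A ^^ s) (\<lambda>_. 1) j" using A_pow_const[of s M "\<lambda>_. 1"] by simp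
    also have "\<dots> \<le> M * C"
    proof (rule mult_left_mono)
      have "(A ^^ s) (\<lambda>_. 1) j \<le> Max ((A ^^ s) (\<lambda>_. 1) ` {..<d})" using j by (intro Max_ge) auto
      then show "(A ^^ s) (\<lambda>_. 1) j \<le> C" by (simp add: C_def)
    qed simp
    finally have 1: "(A ^^ s) \<psi> j \<le> C * M" by (simp add: mult.commute)
    have "C * (B ^^ s) \<psi> j + (A ^^ s) \<psi> j \<le> C * ((B ^^ s) \<psi> j + M)" using 1 by (simp add: distrib_left)
    also have "\<dots> \<le> C * (A ^^ s) \<psi> j" using drop[OF j l(1), of \<psi>] l by simp
    finally show ?thesis by (simp add: diff_mult_distrib)
  qed
  have "C ^ n * (B ^^ (n * s)) \<psi> j \<le> (C - 1) ^ n * (A ^^ (n * s)) \<psi> j" if "j < d" for n \<psi> j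
    using that
  proof (induction n arbitrary: j)
    case (Suc n)
    have cB: "c * (B ^^ m) \<psi> j = (B ^^ m) (\<lambda>l. c * \<psi> l) j" for c m \<psi> j
      by (induction m arbitrary: j) (auto simp: children_sum_def sum_distrib_left)
    have "C ^ Suc n * (B ^^ (Suc n * s)) \<psi> j = C * (B ^^ s) (\<lambda>l. C ^ n * (B ^^ (n * s)) \<psi> l) j"
      by (simp add: funpow_add cB[symmetric])
    also have "\<dots> \<le> C * (B ^^ s) (\<lambda>l. (C - 1) ^ n * (A ^^ (n * s)) \<psi> l) j"
      using Suc by (intro mult_left_mono B_pow_mono) auto
    also have "\<dots> \<le> (C - 1) * (A ^^ s) (\<lambda>l. (C - 1) ^ n * (A ^^ (n * s)) \<psi> l) j"
      by (rule step[OF Suc.prems])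
    also have "\<dots> = (C - 1) ^ Suc n * (A ^^ (Suc n * s)) \<psi> j"
      by (simp add: funpow_add A_pow_const)
    finally show ?case .
  qed simp
  moreover have "s \<ge> 1" "C \<ge> 1" by (simp_all add: s_def C_def)
  ultimately show ?thesis using i by blast
qed

end

lemma geometric_gap:
  fixes C \<kappa> :: nat
  assumes "C \<ge> 1"
  shows "\<exists>n. \<kappa> * (C - 1) ^ n < C ^ n"
proof -
  have c: "real C > 0" using assms by simp
  have "(real (C - 1) / real C) < 1" using assms by (simp add: of_nat_diff)
  then obtain n where n: "(real (C - 1) / real C) ^ n < 1 / (real \<kappa> + 1)"
    using real_arch_pow_inv[of "1 / (real \<kappa> + 1)" "real (C - 1) / real C"] by auto
  then have "(real \<kappa> + 1) * real (C - 1) ^ n < real C ^ n"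
    using c by (simp add: power_divide field_simps)
  then have "real (\<kappa> * (C - 1) ^ n) < real (C ^ n)"
    by (simp add: algebra_simps) (smt (verit) of_nat_0_le_iff zero_le_power)
  then show ?thesis using of_nat_less_iff by blast
qed

section \<open>Cells of a patch of polygons\<close>

lemma homeomorphic_map_inverse:
  assumes "homeomorphic_map X Y h"
  obtains h' where "continuous_map Y X h'" "\<And>x. x \<in> topspace X \<Longrightarrow> h' (h x) = x"
    "\<And>y. y \<in> topspace Y \<Longrightarrow> h (h' y) = y" "\<And>y. y \<in> topspace Y \<Longrightarrow> h' y \<in> topspace X"
proof -
  obtain h' where "homeomorphic_maps X Y h h'" using assms homeomorphic_map_maps by blast
  then have "continuous_map Y X h'" "\<And>x. x \<in> topspace X \<Longrightarrow> h' (h x) = x"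
    "\<And>y. y \<in> topspace Y \<Longrightarrow> h (h' y) = y"
    by (auto simp: homeomorphic_maps_def)
  moreover then have "\<And>y. y \<in> topspace Y \<Longrightarrow> h' y \<in> topspace X"
    by (meson continuous_map_image_subset_topspace image_subset_iff)
  ultimately show ?thesis using that by blast
qed

text \<open>
  Every homeomorphism of \<open>X\<close> onto the disc sends the image of \<open>\<psi>\<close> to an open subset of the plane, by
  invariance of domain. Such a subset of the closed disc lies in the open disc, so no
  homeomorphism can exhibit a point of the image as a boundary point.
\<close>
lemma disc_open_image:
  fixes \<psi> :: "complex \<Rightarrow> 'a"
  assumes d: "homeomorphic_map X disc d" and W: "open W"
    and \<psi>: "continuous_map (top_of_set W) X \<psi>" "inj_on \<psi> W"
  shows "openin X (\<psi> ` W)" "\<psi> ` W \<inter> boundary_circle X = {}"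
proof -
  have sub: "\<psi> ` W \<subseteq> topspace X"
    using continuous_map_image_subset_topspace[OF \<psi>(1)] by simp
  have key: "open (h ` \<psi> ` W) \<and> h ` \<psi> ` W \<subseteq> ball 0 1" if h: "homeomorphic_map X disc h" for h
  proof -
    have c: "continuous_map (top_of_set W) disc (h \<circ> \<psi>)"
      using continuous_map_compose[OF \<psi>(1) homeomorphic_imp_continuous_map[OF h]] .
    then have "continuous_on W (h \<circ> \<psi>)" "(h \<circ> \<psi>) ` W \<subseteq> cball 0 1"
      by (auto simp: continuous_map_in_subtopology)
    moreover have "inj_on (h \<circ> \<psi>) W"
      using \<psi>(2) inj_on_subset[OF homeomorphic_imp_injective_map[OF h] sub] by (rule comp_inj_on)
    ultimately have "open ((h \<circ> \<psi>) ` W)" "(h \<circ> \<psi>) ` W \<subseteq> cball 0 1"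
      using invariance_of_domain W by blast+
    then show ?thesis using interior_maximal[of "(h \<circ> \<psi>) ` W" "cball 0 1"]
      by (simp add: image_comp)
  qed
  have "openin disc (d ` \<psi> ` W)"
    using key[OF d] ball_subset_cball by (intro open_subset) blast+
  then show "openin X (\<psi> ` W)"
    using homeomorphic_map_openness[OF d sub] by simp
  show "\<psi> ` W \<inter> boundary_circle X = {}"
  proof (rule ccontr)
    assume "\<psi> ` W \<inter> boundary_circle X \<noteq> {}"
    then obtain x h where "x \<in> \<psi> ` W" "homeomorphic_map X disc h" "h x \<in> sphere 0 1"
      by (auto simp: boundary_circle_def)
    then show False using key[of h] by force
  qed
qed

lemma disc_open_subset:
  assumes d: "homeomorphic_map X disc d" and U: "openin X U"
  obtains V where "open V" "d ` U = cball 0 1 \<inter> V" "U \<noteq> {} \<Longrightarrow> ball 0 1 \<inter> V \<noteq> {}"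
proof -
  have "openin disc (d ` U)"
    using homeomorphic_map_openness[OF d openin_subset[OF U]] U by simp
  then obtain V where V: "open V" "d ` U = cball 0 1 \<inter> V" by (auto simp: openin_open)
  moreover have "ball 0 1 \<inter> V \<noteq> {}" if "U \<noteq> {}"
  proof -
    have "cball 0 1 \<inter> V \<noteq> {}" using V that by (metis image_is_empty)
    then show ?thesis
      using open_Int_closure_eq_empty[OF V(1), of "ball 0 1"] by (simp add: Int_commute)
  qed
  ultimately show ?thesis using that by blast
qed

lemma boundary_circle_eq:
  assumes d: "homeomorphic_map X disc d"
  shows "boundary_circle X = {x \<in> topspace X. d x \<in> sphere 0 1}"
proof
  show "{x \<in> topspace X. d x \<in> sphere 0 1} \<subseteq> boundary_circle X"
    using d by (auto simp: boundary_circle_def)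
  obtain d' where d': "continuous_map disc X d'" "\<And>x. x \<in> topspace X \<Longrightarrow> d' (d x) = x"
    "\<And>y. y \<in> topspace disc \<Longrightarrow> d (d' y) = y"
    using homeomorphic_map_inverse[OF d] by metis
  have "continuous_map (top_of_set (ball 0 1)) X d'"
    by (rule continuous_map_from_subtopology_mono[OF d'(1)]) auto
  moreover have "inj_on d' (ball 0 1)"
    by (rule inj_on_inverseI[of _ d]) (use d'(3) in auto)
  ultimately have "d' ` ball 0 1 \<inter> boundary_circle X = {}"
    using disc_open_image[OF d] by blast
  moreover have "d x \<in> cball 0 1" if "x \<in> topspace X" for x
    using homeomorphic_imp_surjective_map[OF d] that by auto
  ultimately show "boundary_circle X \<subseteq> {x \<in> topspace X. d x \<in> sphere 0 1}"
  proof (intro subsetI CollectI conjI)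
    fix x assume x: "x \<in> boundary_circle X"
    then show X: "x \<in> topspace X" by (auto simp: boundary_circle_def)
    have "d x \<notin> ball 0 1"
    proof
      assume "d x \<in> ball 0 1"
      then have "d' (d x) \<in> d' ` ball 0 1" by (rule imageI)
      then show False using \<open>d' ` ball 0 1 \<inter> boundary_circle X = {}\<close> x d'(2)[OF X] by auto
    qed
    moreover have "d x \<in> cball 0 1" using homeomorphic_imp_surjective_map[OF d] X by auto
    ultimately show "d x \<in> sphere 0 1" by auto
  qed
qed

lemma closedin_boundary_circle:
  assumes d: "homeomorphic_map X disc d"
  shows "closedin X (boundary_circle X)"
proof -
  have "closedin disc (sphere 0 1)" by (rule closed_subset) auto
  then show ?thesis unfolding boundary_circle_eq[OF d]
    using closedin_continuous_map_preimage[OF homeomorphic_imp_continuous_map[OF d]] by blast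
qed

lemma boundary_circle_homeomorphic_image:
  assumes h: "homeomorphic_map X Y h"
  shows "boundary_circle Y = h ` boundary_circle X"
proof
  show "boundary_circle Y \<subseteq> h ` boundary_circle X"
  proof
    fix y assume "y \<in> boundary_circle Y"
    then obtain d where d: "y \<in> topspace Y" "homeomorphic_map Y disc d" "d y \<in> sphere 0 1"
      by (auto simp: boundary_circle_def)
    then obtain x where x: "x \<in> topspace X" "y = h x"
      using homeomorphic_imp_surjective_map[OF h] by blast
    have "homeomorphic_map X disc (d \<circ> h)" using homeomorphic_map_compose[OF h d(2)] .
    then have "x \<in> boundary_circle X" using x d by (auto simp: boundary_circle_def)
    then show "y \<in> h ` boundary_circle X" using x by blast
  qed
  obtain h' where h': "homeomorphic_maps X Y h h'" using h homeomorphic_map_maps by blast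
  show "h ` boundary_circle X \<subseteq> boundary_circle Y"
  proof
    fix y assume "y \<in> h ` boundary_circle X"
    then obtain x d where d: "y = h x" "x \<in> topspace X" "homeomorphic_map X disc d" "d x \<in> sphere 0 1"
      by (auto simp: boundary_circle_def)
    have hm: "homeomorphic_map Y X h'" using h' homeomorphic_maps_sym homeomorphic_maps_map by blast
    have "homeomorphic_map Y disc (d \<circ> h')" using homeomorphic_map_compose[OF hm d(3)] .
    moreover have "h' y = x" "y \<in> topspace Y"
      using h' d homeomorphic_imp_surjective_map[OF h] by (auto simp: homeomorphic_maps_def)
    ultimately show "y \<in> boundary_circle Y" using d by (auto simp: boundary_circle_def)
  qed
qed

lemma characteristic_map_open_cell:
  fixes \<phi> :: "'b::euclidean_space \<Rightarrow> 'a"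
  assumes ch: "characteristic_map X S c \<phi>" and S: "c \<subseteq> topspace X"
  shows "\<phi> ` ball 0 1 = c - S" "c \<inter> S = \<phi> ` sphere 0 1" "inj_on \<phi> (ball 0 1)" "c - S \<noteq> {}"
    "continuous_map (top_of_set (ball 0 1)) X \<phi>" "connectedin X (c - S)"
proof -
  have hm: "homeomorphic_map (top_of_set (ball 0 1)) (subtopology X (c - S)) \<phi>"
    using ch by (simp add: characteristic_map_def)
  show 1: "\<phi> ` ball 0 1 = c - S"
    using homeomorphic_imp_surjective_map[OF hm] S by auto
  have "\<phi> ` cball 0 1 = c" "\<phi> ` sphere 0 1 \<subseteq> S" using ch by (auto simp: characteristic_map_def)
  moreover have "cball (0::'b) 1 = ball 0 1 \<union> sphere 0 1" by auto
  ultimately show "c \<inter> S = \<phi> ` sphere 0 1" using 1 by (auto simp: image_Un)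
  show "inj_on \<phi> (ball 0 1)" using homeomorphic_imp_injective_map[OF hm] by simp
  show "c - S \<noteq> {}" using 1 by (metis ball_eq_empty image_is_empty not_one_le_zero)
  show 2: "continuous_map (top_of_set (ball 0 1)) X \<phi>"
    using homeomorphic_imp_continuous_map[OF hm] continuous_map_in_subtopology by blast
  have "connectedin (top_of_set (ball 0 1)) (ball (0::'b) 1)"
    by (simp add: connectedin_subtopology)
  then show "connectedin X (c - S)" using connectedin_continuous_map_image[OF 2] 1 by metis
qed

lemma characteristic_map_closed:
  fixes \<phi> :: "'b::euclidean_space \<Rightarrow> 'a"
  assumes ch: "characteristic_map X S c \<phi>" and H: "Hausdorff_space X"
  shows "closedin X c" "closedin X (\<phi> ` sphere 0 1)"
proof -
  have c: "continuous_map (top_of_set (cball 0 1)) X \<phi>" and im: "\<phi> ` cball 0 1 = c"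
    using ch by (auto simp: characteristic_map_def)
  have cp: "compactin (top_of_set (cball 0 1)) (cball (0::'b) 1)" "compactin (top_of_set (cball 0 1)) (sphere (0::'b) 1)"
    by (auto simp: compactin_subtopology)
  show "closedin X c" using image_compactin[OF cp(1) c] im compactin_imp_closedin[OF H] by simp
  show "closedin X (\<phi> ` sphere 0 1)" using image_compactin[OF cp(2) c] compactin_imp_closedin[OF H] by simp
qed

lemma characteristic_map_subset_closed:
  fixes \<phi> :: "'b::euclidean_space \<Rightarrow> 'a"
  assumes ch: "characteristic_map X S c \<phi>" and S: "c \<subseteq> topspace X" and C: "closedin X C" "c - S \<subseteq> C"
  shows "c \<subseteq> C"
proof -
  have c: "continuous_map (top_of_set (cball 0 1)) X \<phi>" and im: "\<phi> ` cball 0 1 = c"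
    using ch by (auto simp: characteristic_map_def)
  have "closedin (top_of_set (cball 0 1)) {x \<in> topspace (top_of_set (cball 0 1)). \<phi> x \<in> C}"
    using closedin_continuous_map_preimage[OF c C(1)] .
  then have "closed {x \<in> cball 0 1. \<phi> x \<in> C}"
    using closedin_closed_trans closed_cball by fastforce
  moreover have "ball 0 1 \<subseteq> {x \<in> cball 0 1. \<phi> x \<in> C}"
    using characteristic_map_open_cell(1)[OF ch S] C by auto
  ultimately have "closure (ball 0 1) \<subseteq> {x \<in> cball 0 1. \<phi> x \<in> C}" by (rule closure_minimal[rotated])
  then show ?thesis using im by auto
qed

lemma cw2D:
  assumes "cw2 (K :: ('a, 'z) complex2_scheme)"
  shows "Hausdorff_space (cspace K)"
    "topspace (cspace K) = verts K \<union> \<Union>(edges K) \<union> \<Union>(faces K)"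
    "\<forall>e\<in>edges K. \<exists>\<phi> :: real \<Rightarrow> 'a. characteristic_map (cspace K) (verts K) e \<phi>"
    "\<forall>e\<in>edges K. \<forall>e'\<in>edges K. e \<noteq> e' \<longrightarrow> e \<inter> e' \<subseteq> verts K"
    "\<forall>f\<in>faces K. \<exists>\<phi> :: complex \<Rightarrow> 'a. characteristic_map (cspace K) (skeleton1 K) f \<phi>"
    "\<forall>f\<in>faces K. \<forall>f'\<in>faces K. f \<noteq> f' \<longrightarrow> f \<inter> f' \<subseteq> skeleton1 K"
    "\<forall>C \<subseteq> topspace (cspace K).
        (\<forall>c \<in> edges K \<union> faces K. closedin (cspace K) (C \<inter> c)) \<longrightarrow> closedin (cspace K) C"
proof -
  note K = assms[unfolded cw2_def]
  show "Hausdorff_space (cspace K)" using K by (elim conjE)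
  show "topspace (cspace K) = verts K \<union> \<Union>(edges K) \<union> \<Union>(faces K)" using K by (elim conjE)
  show "\<forall>e\<in>edges K. \<exists>\<phi> :: real \<Rightarrow> 'a. characteristic_map (cspace K) (verts K) e \<phi>" using K by (elim conjE)
  show "\<forall>e\<in>edges K. \<forall>e'\<in>edges K. e \<noteq> e' \<longrightarrow> e \<inter> e' \<subseteq> verts K" using K by (elim conjE)
  show "\<forall>f\<in>faces K. \<forall>f'\<in>faces K. f \<noteq> f' \<longrightarrow> f \<inter> f' \<subseteq> skeleton1 K" using K by (elim conjE)
  show "\<forall>C \<subseteq> topspace (cspace K).
        (\<forall>c \<in> edges K \<union> faces K. closedin (cspace K) (C \<inter> c)) \<longrightarrow> closedin (cspace K) C"
    using K by (elim conjE)
  have "\<forall>f\<in>faces K. \<exists>\<phi> :: complex \<Rightarrow> 'a.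
        characteristic_map (cspace K) (skeleton1 K) f \<phi> \<and>
        (\<exists>V E. finite V \<and> V \<subseteq> verts K \<and> finite E \<and> E \<subseteq> edges K \<and>
               \<phi> ` sphere 0 1 \<subseteq> V \<union> \<Union>E)" using K by (elim conjE)
  then show "\<forall>f\<in>faces K. \<exists>\<phi> :: complex \<Rightarrow> 'a. characteristic_map (cspace K) (skeleton1 K) f \<phi>"
    by (intro ballI) (drule (1) bspec, elim exE conjE, rule exI)
qed

text \<open>
  A patch carries charts that identify each face, together with the vertices and edges contained in it,
  with a polygon. The lemmas of this locale derive from this and from the disc topology the facts on
  planar complexes that the counting of faces needs.
\<close>
locale polygon_patch =
  fixes d :: nat and T :: "nat \<Rightarrow> 'a complex2" and P :: "'a patch"
  assumes patch: "is_patch d T P"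
    and polygon: "\<And>i. i < d \<Longrightarrow> topological_polygon (T i)"
begin

abbreviation X where "X \<equiv> cspace P"
abbreviation open_edge where "open_edge e \<equiv> e - verts P"
abbreviation face_tile where "face_tile f \<equiv> T (flabel P f)"

lemma cw: "cw2 P" using patch by (simp add: is_patch_def)

lemma Hausdorff: "Hausdorff_space X" using cw2D(1)[OF cw] .

lemma topspace_eq: "topspace X = verts P \<union> \<Union>(edges P) \<union> \<Union>(faces P)" using cw2D(2)[OF cw] .

lemma cells_subset:
  "e \<in> edges P \<Longrightarrow> e \<subseteq> topspace X" "f \<in> faces P \<Longrightarrow> f \<subseteq> topspace X"
  using topspace_eq by auto

lemma weak_topology:
  assumes "C \<subseteq> topspace X" "\<And>e. e \<in> edges P \<Longrightarrow> closedin X (C \<inter> e)" "\<And>f. f \<in> faces P \<Longrightarrow> closedin X (C \<inter> f)"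
  shows "closedin X C"
  using cw2D(7)[OF cw] assms by blast

lemma edge_characteristic_map:
  assumes "e \<in> edges P"
  obtains \<phi> :: "real \<Rightarrow> 'a" where "characteristic_map X (verts P) e \<phi>"
  using cw2D(3)[OF cw] assms by blast

lemma face_characteristic_map:
  assumes "f \<in> faces P"
  obtains \<phi> :: "complex \<Rightarrow> 'a" where "characteristic_map X (skeleton1 P) f \<phi>"
  using cw2D(5)[OF cw] assms by blast

lemma edges_Int: "e \<in> edges P \<Longrightarrow> e' \<in> edges P \<Longrightarrow> e \<noteq> e' \<Longrightarrow> e \<inter> e' \<subseteq> verts P"
  using cw2D(4)[OF cw] by blast

lemma faces_Int: "f \<in> faces P \<Longrightarrow> f' \<in> faces P \<Longrightarrow> f \<noteq> f' \<Longrightarrow> f \<inter> f' \<subseteq> skeleton1 P"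
  using cw2D(6)[OF cw] by blast

lemma closedin_edge: "e \<in> edges P \<Longrightarrow> closedin X e"
  using edge_characteristic_map characteristic_map_closed(1)[OF _ Hausdorff] by blast

lemma closedin_face: "f \<in> faces P \<Longrightarrow> closedin X f"
  using face_characteristic_map characteristic_map_closed(1)[OF _ Hausdorff] by blast

lemma edge_open_cell:
  assumes "e \<in> edges P"
  shows "open_edge e \<noteq> {}" "connectedin X (open_edge e)" "e \<inter> verts P \<noteq> {}" "closedin X (e \<inter> verts P)"
    "\<And>C. closedin X C \<Longrightarrow> open_edge e \<subseteq> C \<Longrightarrow> e \<subseteq> C"
proof -
  obtain \<phi> :: "real \<Rightarrow> 'a" where \<phi>: "characteristic_map X (verts P) e \<phi>"
    using edge_characteristic_map assms by blast
  note * = characteristic_map_open_cell[OF \<phi> cells_subset(1)[OF assms]]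
  show "open_edge e \<noteq> {}" "connectedin X (open_edge e)" using * by blast+
  have "(1::real) \<in> sphere 0 1" by simp
  then show "e \<inter> verts P \<noteq> {}" using *(2) by blast
  show "closedin X (e \<inter> verts P)" using *(2) characteristic_map_closed(2)[OF \<phi> Hausdorff] by simp
  show "\<And>C. closedin X C \<Longrightarrow> open_edge e \<subseteq> C \<Longrightarrow> e \<subseteq> C"
    using characteristic_map_subset_closed[OF \<phi> cells_subset(1)[OF assms]] by blast
qed

lemma disc_homeomorphism: obtains h where "homeomorphic_map X disc h"
  using patch by (auto simp: is_patch_def homeomorphic_space)

lemma compact: "compact_space X"
proof -
  have "compact_space disc" by (simp add: compact_space_subtopology)
  then show ?thesis using patch homeomorphic_compact_space by (auto simp: is_patch_def)
qed

lemma open_face: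
  assumes f: "f \<in> faces P"
  shows "openin X (f - skeleton1 P)" "(f - skeleton1 P) \<inter> boundary_circle X = {}" "f - skeleton1 P \<noteq> {}"
proof -
  obtain \<phi> :: "complex \<Rightarrow> 'a" where \<phi>: "characteristic_map X (skeleton1 P) f \<phi>"
    using face_characteristic_map f by blast
  note * = characteristic_map_open_cell[OF \<phi> cells_subset(2)[OF f]]
  obtain h where h: "homeomorphic_map X disc h" using disc_homeomorphism .
  show "openin X (f - skeleton1 P)" "(f - skeleton1 P) \<inter> boundary_circle X = {}"
    using disc_open_image[OF h open_ball *(5,3)] *(1) by simp_all
  show "f - skeleton1 P \<noteq> {}" using *(4) .
qed

text \<open>
  One point chosen in each open face gives a set all of whose subsets are closed in the weak topology;
  in a compact space such a set is finite.
\<close>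
lemma finite_faces: "finite (faces P)"
proof -
  have "\<forall>f\<in>faces P. \<exists>x. x \<in> f - skeleton1 P" using open_face by blast
  then obtain p where p: "\<And>f. f \<in> faces P \<Longrightarrow> p f \<in> f - skeleton1 P" by metis
  have inj: "inj_on p (faces P)"
  proof (rule inj_onI, rule ccontr)
    fix f g assume "f \<in> faces P" "g \<in> faces P" "p f = p g" "f \<noteq> g"
    then show False using p[of f] p[of g] faces_Int[of f g] by auto
  qed
  have clos: "closedin X C" if C: "C \<subseteq> p ` faces P" for C
  proof (rule weak_topology)
    show "C \<subseteq> topspace X" using C p cells_subset by blast
    show "closedin X (C \<inter> e)" if "e \<in> edges P" for e
    proof -
      have "C \<inter> e = {}" using C p that by (fastforce simp: skeleton1_def)
      then show ?thesis by simp
    qed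
    show "closedin X (C \<inter> f)" if f: "f \<in> faces P" for f
    proof -
      have "C \<inter> f \<subseteq> {p f}"
      proof
        fix x assume x: "x \<in> C \<inter> f"
        then obtain g where g: "g \<in> faces P" "x = p g" using C by blast
        then have "g = f" using p[of g] x faces_Int[OF g(1) f] by blast
        then show "x \<in> {p f}" using g by simp
      qed
      moreover have "p f \<in> topspace X" using p[OF f] cells_subset(2)[OF f] by blast
      ultimately show ?thesis
        using closedin_Hausdorff_sing_eq[OF Hausdorff] by (metis closedin_empty subset_singletonD)
    qed
  qed
  have "finite (p ` faces P)"
  proof (rule ccontr)
    assume inf: "infinite (p ` faces P)"
    have "p ` faces P \<subseteq> topspace X" using p cells_subset by blast
    then obtain x where x: "x \<in> X derived_set_of (p ` faces P)"
      using compactin_imp_Bolzano_Weierstrass[of X "topspace X" "p ` faces P"] compact inf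
      by (auto simp: compact_space_def)
    define C where "C = p ` faces P - {x}"
    have "openin X (topspace X - C)" using clos[of C] by (auto simp: C_def)
    moreover have "x \<in> topspace X - C" using x by (auto simp: C_def in_derived_set_of)
    ultimately have "\<exists>y. y \<noteq> x \<and> y \<in> p ` faces P \<and> y \<in> topspace X - C"
      using x unfolding in_derived_set_of by blast
    then show False by (auto simp: C_def)
  qed
  then show ?thesis using inj finite_imageD by blast
qed

lemma chart_homeomorphism:
  assumes "f \<in> faces P"
  shows "homeomorphic_map (subtopology X f) (cspace (face_tile f)) (chart P f)"
    "chart P f ` f = topspace (cspace (face_tile f))" "inj_on (chart P f) f"
    "flabel P f < d"
proof -
  show 1: "homeomorphic_map (subtopology X f) (cspace (face_tile f)) (chart P f)"
    and "flabel P f < d"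
    using patch assms by (auto simp: is_patch_def)
  have "topspace (subtopology X f) = f" using cells_subset(2)[OF assms] by auto
  then show "chart P f ` f = topspace (cspace (face_tile f))" "inj_on (chart P f) f"
    using homeomorphic_imp_surjective_map[OF 1] homeomorphic_imp_injective_map[OF 1] by auto
qed

lemma chart_cells:
  assumes "f \<in> faces P"
  shows "chart P f ` (verts P \<inter> f) = verts (face_tile f)"
    "(`) (chart P f) ` {e \<in> edges P. e \<subseteq> f} = edges (face_tile f)"
  using patch assms by (auto simp: is_patch_def)

lemma finite_face_verts: "f \<in> faces P \<Longrightarrow> finite (verts P \<inter> f)"
proof -
  assume f: "f \<in> faces P"
  have "card (verts (face_tile f)) \<ge> 3"
    using polygon[OF chart_homeomorphism(4)[OF f]] by (auto simp: topological_polygon_def)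
  then have "finite (verts (face_tile f))" using card.infinite by fastforce
  moreover have "inj_on (chart P f) (verts P \<inter> f)"
    by (rule inj_on_subset[OF chart_homeomorphism(3)[OF f]]) blast
  ultimately show ?thesis using chart_cells(1)[OF f] finite_imageD by metis
qed

lemma face_skeleton:
  assumes f: "f \<in> faces P" and x: "x \<in> f" "chart P f x \<in> skeleton1 (face_tile f)"
  shows "x \<in> verts P \<or> (\<exists>e\<in>edges P. e \<subseteq> f \<and> x \<in> e)"
proof (cases "chart P f x \<in> verts (face_tile f)")
  case True
  then obtain v where "v \<in> verts P \<inter> f" "chart P f x = chart P f v" using chart_cells(1)[OF f] by blast
  then show ?thesis using inj_onD[OF chart_homeomorphism(3)[OF f]] x by blast
next
  case False
  then obtain a where "a \<in> edges (face_tile f)" "chart P f x \<in> a" using x by (auto simp: skeleton1_def)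
  then have "a \<in> (`) (chart P f) ` {e \<in> edges P. e \<subseteq> f}" using chart_cells(2)[OF f] by simp
  then obtain e where e: "e \<in> edges P" "e \<subseteq> f" "a = chart P f ` e" by auto
  then obtain y where y: "y \<in> e" "chart P f x = chart P f y" using \<open>chart P f x \<in> a\<close> by auto
  then have "x = y" using inj_onD[OF chart_homeomorphism(3)[OF f] y(2) x(1)] e(2) by auto
  then show ?thesis using e y by auto
qed

text \<open>
  The inverse of the face chart on the open polygon. The characteristic map of the face would not serve
  here: the points outside its image are only known to lie in the skeleton of the patch, not on
  an edge contained in the face.
\<close>
lemma face_parametrization:
  assumes f: "f \<in> faces P"
  obtains \<psi> :: "complex \<Rightarrow> 'a"
    where "continuous_map (top_of_set (ball 0 1)) X \<psi>" "inj_on \<psi> (ball 0 1)" "\<psi> ` ball 0 1 \<subseteq> f"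
      "\<And>x. x \<in> f \<Longrightarrow> x \<notin> \<psi> ` ball 0 1 \<Longrightarrow> chart P f x \<in> skeleton1 (face_tile f)"
proof -
  let ?K = "face_tile f"
  have poly: "topological_polygon ?K" using polygon chart_homeomorphism(4)[OF f] by blast
  then obtain t where t: "homeomorphic_map (cspace ?K) disc t"
    by (auto simp: topological_polygon_def homeomorphic_space)
  define D where "D = t \<circ> chart P f"
  have D: "homeomorphic_map (subtopology X f) disc D"
    unfolding D_def using homeomorphic_map_compose[OF chart_homeomorphism(1)[OF f] t] .
  have top: "topspace (subtopology X f) = f" using cells_subset(2)[OF f] by auto
  obtain D' where D': "continuous_map disc (subtopology X f) D'" "\<And>x. x \<in> f \<Longrightarrow> D' (D x) = x"
    "\<And>y. y \<in> cball 0 1 \<Longrightarrow> D (D' y) = y" "\<And>y. y \<in> cball 0 1 \<Longrightarrow> D' y \<in> f"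
    using homeomorphic_map_inverse[OF D] unfolding top by (metis topspace_euclidean_subtopology)
  show ?thesis
  proof
    have "continuous_map disc X D'" using D'(1) by (simp add: continuous_map_in_subtopology)
    then show "continuous_map (top_of_set (ball 0 1)) X D'"
      by (rule continuous_map_from_subtopology_mono) auto
    show "inj_on D' (ball 0 1)" by (rule inj_on_inverseI[of _ D]) (use D'(3) in auto)
    show "D' ` ball 0 1 \<subseteq> f" using D'(4) by auto
    show "chart P f x \<in> skeleton1 ?K" if x: "x \<in> f" "x \<notin> D' ` ball 0 1" for x
    proof -
      have "D x \<in> cball 0 1" using homeomorphic_imp_surjective_map[OF D] x top by auto
      moreover have "D x \<notin> ball 0 1" using x D'(2) by force
      ultimately have "t (chart P f x) \<in> sphere 0 1" by (auto simp: D_def)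
      moreover have "chart P f x \<in> topspace (cspace ?K)" using chart_homeomorphism(2)[OF f] x by blast
      ultimately have "chart P f x \<in> boundary_circle (cspace ?K)" using t by (auto simp: boundary_circle_def)
      then show ?thesis using poly by (simp add: topological_polygon_def)
    qed
  qed
qed

text \<open>
  If the open edge leaves the interior of the face, it does so through an edge of the face, and
  distinct open edges are disjoint. Otherwise its part in the face is relatively open and closed.
\<close>
lemma edge_meets_face:
  assumes e: "e \<in> edges P" and f: "f \<in> faces P" and z: "z \<in> open_edge e" "z \<in> f"
  shows "e \<subseteq> f"
proof -
  obtain \<psi> :: "complex \<Rightarrow> 'a" where \<psi>: "continuous_map (top_of_set (ball 0 1)) X \<psi>" "inj_on \<psi> (ball 0 1)" "\<psi> ` ball 0 1 \<subseteq> f"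
      "\<And>x. x \<in> f \<Longrightarrow> x \<notin> \<psi> ` ball 0 1 \<Longrightarrow> chart P f x \<in> skeleton1 (face_tile f)"
    using face_parametrization[OF f] by blast
  define G where "G = \<psi> ` ball 0 1"
  obtain h where h: "homeomorphic_map X disc h" using disc_homeomorphism .
  have G: "openin X G" unfolding G_def using disc_open_image(1)[OF h open_ball \<psi>(1,2)] .
  show ?thesis
  proof (cases "\<exists>x. x \<in> open_edge e \<inter> f - G")
    case True
    then obtain x where x: "x \<in> open_edge e" "x \<in> f" "x \<notin> G" by blast
    then obtain e' where "e' \<in> edges P" "e' \<subseteq> f" "x \<in> e'"
      using face_skeleton[OF f x(2)] \<psi>(4) by (auto simp: G_def)
    then show ?thesis using edges_Int[OF e, of e'] x by blast
  next
    case False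
    have "open_edge e \<subseteq> f"
    proof (rule ccontr)
      assume not: "\<not> open_edge e \<subseteq> f"
      have "openin X (topspace X - f)" using closedin_face[OF f] by blast
      moreover have "open_edge e \<subseteq> G \<union> (topspace X - f)"
        using False cells_subset(1)[OF e] by blast
      moreover have "G \<inter> (topspace X - f) \<inter> open_edge e = {}" using \<psi>(3) by (auto simp: G_def)
      moreover have "G \<inter> open_edge e \<noteq> {}" using z False by blast
      moreover have "(topspace X - f) \<inter> open_edge e \<noteq> {}" using not cells_subset(1)[OF e] by blast
      ultimately show False using edge_open_cell(2)[OF e] G connectedinD by metis
    qed
    then show ?thesis using edge_open_cell(5)[OF e closedin_face[OF f]] by blast
  qed
qed

text \<open>
  An open edge disjoint from all faces would be open in the disc, that is, a one-dimensional open
  subset of the plane.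
\<close>
lemma edge_in_some_face:
  assumes e: "e \<in> edges P"
  shows "\<exists>f\<in>faces P. e \<subseteq> f"
proof (rule ccontr)
  assume no: "\<not> ?thesis"
  then have disj: "open_edge e \<inter> f = {}" if "f \<in> faces P" for f
    using edge_meets_face[OF e that] that by blast
  obtain \<phi> :: "real \<Rightarrow> 'a" where \<phi>: "characteristic_map X (verts P) e \<phi>"
    using edge_characteristic_map e by blast
  note cell = characteristic_map_open_cell[OF \<phi> cells_subset(1)[OF e]]
  have "closedin X (topspace X - open_edge e)"
  proof (rule weak_topology)
    show "closedin X ((topspace X - open_edge e) \<inter> e')" if e': "e' \<in> edges P" for e'
    proof (cases "e' = e")
      case True
      then have "(topspace X - open_edge e) \<inter> e' = e \<inter> verts P" using cells_subset(1)[OF e] by blast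
      then show ?thesis using edge_open_cell(4)[OF e] by simp
    next
      case False
      then have "(topspace X - open_edge e) \<inter> e' = e'" using cells_subset(1)[OF e'] edges_Int[OF e e'] by blast
      then show ?thesis using closedin_edge[OF e'] by simp
    qed
    show "closedin X ((topspace X - open_edge e) \<inter> f)" if f: "f \<in> faces P" for f
    proof -
      have "(topspace X - open_edge e) \<inter> f = f" using disj[OF f] cells_subset(2)[OF f] by blast
      then show ?thesis using closedin_face[OF f] by simp
    qed
  qed blast
  then have op: "openin X (open_edge e)"
    using cells_subset(1)[OF e] by (simp add: openin_closedin_eq) blast
  obtain h where h: "homeomorphic_map X disc h" using disc_homeomorphism .
  obtain V where V: "open V" "h ` open_edge e = cball 0 1 \<inter> V" "ball 0 1 \<inter> V \<noteq> {}"
    using disc_open_subset[OF h op] edge_open_cell(1)[OF e] by metis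
  define W where "W = ball 0 1 \<inter> V"
  have W: "open W" "W \<noteq> {}" "W \<subseteq> h ` open_edge e" "W \<subseteq> cball 0 1" using V by (auto simp: W_def)
  obtain h' where h': "continuous_map disc X h'" "\<And>x. x \<in> topspace X \<Longrightarrow> h' (h x) = x"
    "\<And>y. y \<in> topspace disc \<Longrightarrow> h (h' y) = y"
    using homeomorphic_map_inverse[OF h] by metis
  have hm: "homeomorphic_map (top_of_set (ball 0 1)) (subtopology X (open_edge e)) \<phi>"
    using \<phi> by (simp add: characteristic_map_def)
  have tope: "topspace (subtopology X (open_edge e)) = open_edge e" using cells_subset(1)[OF e] by auto
  obtain p where p: "continuous_map (subtopology X (open_edge e)) (top_of_set (ball 0 1)) p"
    "\<And>y. y \<in> open_edge e \<Longrightarrow> \<phi> (p y) = y"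
    using homeomorphic_map_inverse[OF hm] unfolding tope by metis
  have im: "h' w \<in> open_edge e" if "w \<in> W" for w
  proof -
    obtain y where y: "y \<in> open_edge e" "w = h y" using W(3) \<open>w \<in> W\<close> by blast
    then have "h' w = y" using h'(2)[of y] cells_subset(1)[OF e] by blast
    then show ?thesis using y(1) by simp
  qed
  have "continuous_map (top_of_set W) (subtopology X (open_edge e)) h'"
    using continuous_map_from_subtopology_mono[OF h'(1) W(4)] im by (auto simp: continuous_map_in_subtopology)
  then have "continuous_map (top_of_set W) (top_of_set (ball 0 1)) (p \<circ> h')"
    using p(1) by (rule continuous_map_compose)
  then have "continuous_on W (p \<circ> h')" by (simp add: continuous_map_in_subtopology)
  moreover have "inj_on (p \<circ> h') W"
  proof (rule inj_on_inverseI[of _ "h \<circ> \<phi>"])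
    fix w assume w: "w \<in> W"
    then show "(h \<circ> \<phi>) ((p \<circ> h') w) = w" using p(2)[OF im[OF w]] h'(3)[of w] W(4) by auto
  qed
  ultimately have "DIM(complex) \<le> DIM(real)"
    using invariance_of_dimension W(1,2) by blast
  then show False by simp
qed

text \<open>A vertex in no face would be an isolated point of the disc.\<close>
lemma topspace_eq_Union_faces: "topspace X = \<Union>(faces P)"
proof (rule ccontr)
  assume "topspace X \<noteq> \<Union>(faces P)"
  then obtain x where x: "x \<in> topspace X" "x \<notin> \<Union>(faces P)" using cells_subset(2) by blast
  then have xe: "x \<notin> \<Union>(edges P)" using edge_in_some_face by blast
  have "closedin X (topspace X - {x})"
  proof (rule weak_topology)
    show "closedin X ((topspace X - {x}) \<inter> e)" if "e \<in> edges P" for e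
    proof -
      have "(topspace X - {x}) \<inter> e = e" using that xe cells_subset(1) by blast
      then show ?thesis using closedin_edge that by simp
    qed
    show "closedin X ((topspace X - {x}) \<inter> f)" if "f \<in> faces P" for f
    proof -
      have "(topspace X - {x}) \<inter> f = f" using that x cells_subset(2) by blast
      then show ?thesis using closedin_face that by simp
    qed
  qed blast
  then have op: "openin X {x}" using x by (simp add: openin_closedin_eq)
  obtain h where h: "homeomorphic_map X disc h" using disc_homeomorphism .
  obtain V where V: "open V" "h ` {x} = cball 0 1 \<inter> V" "ball 0 1 \<inter> V \<noteq> {}"
    using disc_open_subset[OF h op] by (metis insert_not_empty)
  have "ball 0 1 \<inter> V \<subseteq> cball 0 1 \<inter> V" by auto
  then have "ball 0 1 \<inter> V \<subseteq> {h x}" using V(2) by simp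
  then have "finite (ball 0 1 \<inter> V)" by (rule finite_subset) simp
  moreover have "open (ball 0 1 \<inter> V)" using V(1) by blast
  ultimately show False using finite_imp_not_open V(3) by blast
qed

text \<open>
  Near a point of such an open edge the patch coincides with the face. If the point were interior to the
  disc, the chart of the face would embed a plane neighbourhood of it into the polygon, and the point
  could not be sent to the boundary of the polygon, where the edges are.
\<close>
lemma free_edge_in_boundary:
  assumes e: "e \<in> edges P" and f: "f \<in> faces P" "e \<subseteq> f"
    and free: "\<And>f'. f' \<in> faces P \<Longrightarrow> e \<subseteq> f' \<Longrightarrow> f' = f"
  shows "e \<subseteq> boundary_circle X"
proof -
  obtain h where h: "homeomorphic_map X disc h" using disc_homeomorphism .
  obtain h' where h': "continuous_map disc X h'" "\<And>x. x \<in> topspace X \<Longrightarrow> h' (h x) = x"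
    "\<And>y. y \<in> topspace disc \<Longrightarrow> h (h' y) = y"
    using homeomorphic_map_inverse[OF h] by metis
  have "open_edge e \<subseteq> boundary_circle X"
  proof (rule subsetI, rule ccontr)
    fix z assume z: "z \<in> open_edge e" "z \<notin> boundary_circle X"
    have zX: "z \<in> topspace X" using z cells_subset(1)[OF e] by blast
    define U where "U = topspace X - \<Union>(faces P - {f})"
    have "closedin X (\<Union>(faces P - {f}))"
      using finite_faces closedin_face by (intro closedin_Union) auto
    then have U: "openin X U" unfolding U_def by blast
    have "z \<notin> f'" if "f' \<in> faces P - {f}" for f'
      using edge_meets_face[OF e _ z(1), of f'] free that by blast
    then have zU: "z \<in> U" using zX by (auto simp: U_def)
    have Uf: "U \<subseteq> f" using topspace_eq_Union_faces by (auto simp: U_def)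
    obtain V where V: "open V" "h ` U = cball 0 1 \<inter> V"
      using disc_open_subset[OF h U] by metis
    define W where "W = ball 0 1 \<inter> V"
    have "h z \<in> cball 0 1" using homeomorphic_imp_surjective_map[OF h] zX by auto
    moreover have "h z \<notin> sphere 0 1" using z(2) zX boundary_circle_eq[OF h] by blast
    moreover have "h z \<in> V" using V(2) zU by blast
    ultimately have zW: "h z \<in> W" by (auto simp: W_def)
    have W: "open W" "W \<subseteq> cball 0 1" "W \<subseteq> h ` U" using V by (auto simp: W_def)
    have im: "h' w \<in> f" if "w \<in> W" for w
    proof -
      obtain y where y: "y \<in> U" "w = h y" using W(3) \<open>w \<in> W\<close> by blast
      then have "h' w = y" using h'(2)[of y] openin_subset[OF U] by blast
      then show ?thesis using y(1) Uf by blast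
    qed
    have "continuous_map (top_of_set W) (subtopology X f) h'"
      using continuous_map_from_subtopology_mono[OF h'(1) W(2)] im by (auto simp: continuous_map_in_subtopology)
    then have c: "continuous_map (top_of_set W) (cspace (face_tile f)) (chart P f \<circ> h')"
      using homeomorphic_imp_continuous_map[OF chart_homeomorphism(1)[OF f(1)]] by (rule continuous_map_compose)
    have "inj_on h' W" by (rule inj_on_inverseI[of _ h]) (use h'(3) W(2) in auto)
    then have i: "inj_on (chart P f \<circ> h') W"
      by (rule comp_inj_on) (rule inj_on_subset[OF chart_homeomorphism(3)[OF f(1)]], use im in auto)
    have poly: "topological_polygon (face_tile f)" using polygon chart_homeomorphism(4)[OF f(1)] by blast
    then obtain t where t: "homeomorphic_map (cspace (face_tile f)) disc t"
      by (auto simp: topological_polygon_def homeomorphic_space)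
    have "(chart P f \<circ> h') (h z) \<notin> boundary_circle (cspace (face_tile f))"
      using disc_open_image(2)[OF t W(1) c i] zW by blast
    then have "chart P f z \<notin> skeleton1 (face_tile f)"
      using poly h'(2)[OF zX] by (simp add: topological_polygon_def)
    moreover have "chart P f ` e \<in> edges (face_tile f)" using chart_cells(2)[OF f(1)] e f(2) by blast
    ultimately show False using z(1) by (auto simp: skeleton1_def)
  qed
  then show ?thesis using edge_open_cell(5)[OF e closedin_boundary_circle[OF h]] by blast
qed

text \<open>
  A face with a boundary vertex belongs to the thick boundary. Its open cell is an open set in the
  thick boundary, so it is disjoint from the core.
\<close>
lemma core_face_avoids_boundary:
  assumes g: "g \<in> faces P" "g \<subseteq> core P" and v: "v \<in> g" "v \<in> verts P"
  shows "v \<notin> boundary_circle X"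
proof
  assume "v \<in> boundary_circle X"
  then have "g \<subseteq> thick_boundary P" using g v by (auto simp: thick_boundary_def)
  then have "(g - skeleton1 P) \<inter> (topspace X - thick_boundary P) = {}" by blast
  then have "(g - skeleton1 P) \<inter> core P = {}"
    unfolding core_def using openin_Int_closure_of_eq_empty[OF open_face(1)[OF g(1)]] by blast
  then show False using open_face(3)[OF g(1)] g(2) by blast
qed

text \<open>
  The boundary circle consists of the images of the vertices and edges of the tile. The images of the
  edges are closed and meet in vertices of the patch only. The open edge is connected and contains no
  vertex, so it lies in one of them.
\<close>
lemma boundary_edge_in_tile_edge:
  fixes K :: "'a complex2"
  assumes K: "topological_polygon K" and h: "homeomorphic_map (cspace K) X h"
    and vs: "h ` verts K \<subseteq> verts P"
    and e: "e \<in> edges P" "e \<subseteq> boundary_circle X"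
  shows "\<exists>a\<in>edges K. e \<subseteq> h ` a"
proof -
  have cwK: "cw2 K" using K unfolding topological_polygon_def by blast
  note HK = cw2D(1)[OF cwK] and top = cw2D(2)[OF cwK] and chK = cw2D(3)[OF cwK] and IntK = cw2D(4)[OF cwK]
  have clos: "closedin X (h ` a)" if a: "a \<in> edges K" for a
  proof -
    obtain \<phi> :: "real \<Rightarrow> 'a" where "characteristic_map (cspace K) (verts K) a \<phi>"
      using chK a by blast
    then have "closedin (cspace K) a" using characteristic_map_closed(1) HK by blast
    then show ?thesis using homeomorphic_map_closedness_eq[OF h] by blast
  qed
  have inj: "inj_on h (topspace (cspace K))" using homeomorphic_imp_injective_map[OF h] .
  have Int: "h ` a \<inter> h ` a' \<subseteq> verts P" if "a \<in> edges K" "a' \<in> edges K" "a \<noteq> a'" for a a'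
  proof -
    have "a \<inter> a' \<subseteq> verts K" using IntK that by blast
    moreover have "h ` a \<inter> h ` a' = h ` (a \<inter> a')"
      by (rule inj_on_image_Int[OF inj, symmetric]) (use top that in auto)
    ultimately show ?thesis using vs by blast
  qed
  have "card (edges K) \<ge> 3" using K by (auto simp: topological_polygon_def)
  then have fin: "finite (edges K)" using card.infinite by fastforce
  have "boundary_circle X = h ` skeleton1 K"
    using boundary_circle_homeomorphic_image[OF h] K unfolding topological_polygon_def by metis
  then have bd: "boundary_circle X = h ` verts K \<union> (\<Union>a\<in>edges K. h ` a)"
    by (simp add: skeleton1_def image_Un image_Union)
  have cover: "open_edge e \<subseteq> (\<Union>a\<in>edges K. h ` a)"
  proof
    fix x assume x: "x \<in> open_edge e"
    then have "x \<in> boundary_circle X" "x \<notin> h ` verts K" using e(2) vs by blast+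
    then show "x \<in> (\<Union>a\<in>edges K. h ` a)" unfolding bd by blast
  qed
  obtain z where z: "z \<in> open_edge e" using edge_open_cell(1)[OF e(1)] by blast
  then obtain a where a: "a \<in> edges K" "z \<in> h ` a" using cover by blast
  define C where "C = (\<Union>a'\<in>edges K - {a}. h ` a')"
  have C: "closedin X C" unfolding C_def using fin clos by (intro closedin_Union) auto
  have disj: "h ` a \<inter> C \<inter> open_edge e = {}"
  proof (rule equals0I)
    fix x assume x: "x \<in> h ` a \<inter> C \<inter> open_edge e"
    then obtain a' where "a' \<in> edges K" "a' \<noteq> a" "x \<in> h ` a'" by (auto simp: C_def)
    then have "x \<in> verts P" using Int[OF a(1), of a'] x by blast
    then show False using x by blast
  qed
  have "open_edge e \<subseteq> h ` a"
  proof (rule ccontr)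
    assume not: "\<not> open_edge e \<subseteq> h ` a"
    have "openin X (topspace X - C)" "openin X (topspace X - h ` a)" using C clos[OF a(1)] by blast+
    moreover have "open_edge e \<subseteq> (topspace X - C) \<union> (topspace X - h ` a)"
      using disj cells_subset(1)[OF e(1)] by blast
    moreover have "(topspace X - C) \<inter> (topspace X - h ` a) \<inter> open_edge e = {}"
      using cover by (auto simp: C_def)
    moreover have "(topspace X - C) \<inter> open_edge e \<noteq> {}" using z a disj cells_subset(1)[OF e(1)] by blast
    moreover have "(topspace X - h ` a) \<inter> open_edge e \<noteq> {}" using not cells_subset(1)[OF e(1)] by blast
    ultimately show False using edge_open_cell(2)[OF e(1)] connectedinD by metis
  qed
  then show ?thesis using edge_open_cell(5)[OF e(1) clos[OF a(1)]] a(1) by blast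
qed

end

section \<open>Free edges and the rim under gluing\<close>

definition free_edge :: "('a, 'z) complex2_scheme \<Rightarrow> 'a set \<Rightarrow> bool" where
  "free_edge P e \<longleftrightarrow> e \<in> edges P \<and> (\<exists>!f. f \<in> faces P \<and> e \<subseteq> f)"

text \<open>
  Faces that touch a free edge in a single vertex are included, since their images under the
  substitution touch free edges as well.
\<close>
definition rim_faces :: "('a, 'z) complex2_scheme \<Rightarrow> 'a set set" where
  "rim_faces P = {f \<in> faces P. \<exists>e v. free_edge P e \<and> v \<in> e \<and> v \<in> verts P \<and> v \<in> f}"

lemma free_edge_unique:
  assumes "free_edge P e" "f \<in> faces P" "e \<subseteq> f" "f' \<in> faces P" "e \<subseteq> f'"
  shows "f = f'"
  using assms unfolding free_edge_def by blast

lemma presubstitutionD: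
  assumes "presubstitution \<sigma>" "j < ntiles \<sigma>"
  shows "topological_polygon (tile \<sigma> j)" "is_patch (ntiles \<sigma>) (tile \<sigma>) (spatch \<sigma> j)"
    "homeomorphic_map (cspace (tile \<sigma> j)) (cspace (spatch \<sigma> j)) (smap \<sigma> j)"
    "smap \<sigma> j ` verts (tile \<sigma> j) \<subseteq> verts (spatch \<sigma> j)"
proof -
  note * = assms(1)[unfolded presubstitution_def, rule_format, OF assms(2)]
  show "topological_polygon (tile \<sigma> j)" using * by (elim conjE)
  show "is_patch (ntiles \<sigma>) (tile \<sigma>) (spatch \<sigma> j)" using * by (elim conjE)
  show "homeomorphic_map (cspace (tile \<sigma> j)) (cspace (spatch \<sigma> j)) (smap \<sigma> j)" using * by (elim conjE)
  show "smap \<sigma> j ` verts (tile \<sigma> j) \<subseteq> verts (spatch \<sigma> j)"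
    using * by (elim conjE) (erule subset_trans, rule Int_lower1)
qed

lemma polygon_patch_presubstitution:
  assumes "presubstitution \<sigma>" "is_patch (ntiles \<sigma>) (tile \<sigma>) P"
  shows "polygon_patch (ntiles \<sigma>) (tile \<sigma>) P"
  by unfold_locales (rule assms(2), rule presubstitutionD(1)[OF assms(1)])

text \<open>
  The patch \<open>Q\<close> is obtained from \<open>P\<close> by replacing every face by its substituted patch, with gluing
  maps \<open>\<theta>\<close>; two points of the disjoint union are identified by \<open>q\<close> if a chain of gluings joins them.
\<close>
locale gluing =
  fixes \<sigma> :: "'a presubst" and P :: "'a patch" and \<theta> :: "'a set \<Rightarrow> 'a set \<Rightarrow> 'a set \<Rightarrow> 'a \<Rightarrow> 'a"
    and q :: "'a set \<times> 'a \<Rightarrow> 'a" and Q :: "'a patch"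
  assumes pre: "presubstitution \<sigma>"
    and patchP: "is_patch (ntiles \<sigma>) (tile \<sigma>) P"
    and glued: "glued_from \<sigma> P q Q"
    and maps: "gluing_maps \<sigma> P \<theta>"
    and rel: "\<And>f x f' x'. f \<in> faces P \<Longrightarrow> f' \<in> faces P \<Longrightarrow>
        x \<in> topspace (cspace (fpatch \<sigma> P f)) \<Longrightarrow> x' \<in> topspace (cspace (fpatch \<sigma> P f')) \<Longrightarrow>
        q (f, x) = q (f', x') \<longleftrightarrow> ((f, x), (f', x')) \<in> (gluing_rel \<sigma> P \<theta>)\<^sup>*"
begin

lemma patchQ: "is_patch (ntiles \<sigma>) (tile \<sigma>) Q"
  using glued unfolding glued_from_def by (elim conjE)

sublocale P: polygon_patch "ntiles \<sigma>" "tile \<sigma>" P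
  by (rule polygon_patch_presubstitution[OF pre patchP])

sublocale Q: polygon_patch "ntiles \<sigma>" "tile \<sigma>" Q
  by (rule polygon_patch_presubstitution[OF pre patchQ])

abbreviation F where "F f \<equiv> fpatch \<sigma> P f"
abbreviation subface where "subface f g \<equiv> q ` ({f} \<times> g)"

lemma polygon_patch_F:
  assumes "f \<in> faces P" shows "polygon_patch (ntiles \<sigma>) (tile \<sigma>) (F f)"
  by (rule polygon_patch_presubstitution[OF pre presubstitutionD(2)[OF pre P.chart_homeomorphism(4)[OF assms]]])

lemma facesQ: "faces Q = {subface f g | f g. f \<in> faces P \<and> g \<in> faces (F f)}"
  using glued unfolding glued_from_def by (elim conjE)

lemma subface_in: "f \<in> faces P \<Longrightarrow> g \<in> faces (F f) \<Longrightarrow> subface f g \<in> faces Q"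
  unfolding facesQ by (rule CollectI, intro exI conjI, rule refl)

lemma labelQ:
  assumes "f \<in> faces P" "g \<in> faces (F f)"
  shows "flabel Q (subface f g) = flabel (F f) g"
    "\<And>x. x \<in> g \<Longrightarrow> chart Q (subface f g) (q (f, x)) = chart (F f) g x"
proof -
  have "\<forall>f\<in>faces P. \<forall>g\<in>faces (F f).
        flabel Q (subface f g) = flabel (F f) g \<and>
        (\<forall>x\<in>g. chart Q (subface f g) (q (f, x)) = chart (F f) g x)"
    using glued unfolding glued_from_def by (elim conjE)
  then have *: "flabel Q (subface f g) = flabel (F f) g \<and>
        (\<forall>x\<in>g. chart Q (subface f g) (q (f, x)) = chart (F f) g x)"
    using assms by (elim ballE) auto
  show "flabel Q (subface f g) = flabel (F f) g" using * by (rule conjunct1)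
  show "\<And>x. x \<in> g \<Longrightarrow> chart Q (subface f g) (q (f, x)) = chart (F f) g x"
    using conjunct2[OF *] by (rule bspec)
qed

text \<open>All gluings take place along boundary circles.\<close>
lemma fmap_image_edge:
  assumes f: "f \<in> faces P" and e: "e \<in> edges P" "e \<subseteq> f"
  shows "fmap \<sigma> P f ` e \<subseteq> boundary_circle (cspace (F f))"
proof -
  define j where "j = flabel P f"
  have j: "j < ntiles \<sigma>" unfolding j_def by (rule P.chart_homeomorphism(4)[OF f])
  have poly: "topological_polygon (tile \<sigma> j)" by (rule presubstitutionD(1)[OF pre j])
  have "chart P f ` e \<in> (`) (chart P f) ` {e \<in> edges P. e \<subseteq> f}" using e by (intro imageI) simp
  then have "chart P f ` e \<in> edges (tile \<sigma> j)" unfolding j_def P.chart_cells(2)[OF f] .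
  then have "chart P f ` e \<subseteq> skeleton1 (tile \<sigma> j)" unfolding skeleton1_def by (intro le_supI2 Union_upper)
  also have "\<dots> = boundary_circle (cspace (tile \<sigma> j))"
    using poly unfolding topological_polygon_def by (elim conjE)
  finally have "smap \<sigma> j ` chart P f ` e \<subseteq> smap \<sigma> j ` boundary_circle (cspace (tile \<sigma> j))" by (rule image_mono)
  also have "\<dots> = boundary_circle (cspace (spatch \<sigma> j))"
    by (rule boundary_circle_homeomorphic_image[OF presubstitutionD(3)[OF pre j], symmetric])
  finally show ?thesis by (simp add: fmap_def j_def image_image)
qed

lemma inj_fmap:
  assumes f: "f \<in> faces P" shows "inj_on (fmap \<sigma> P f) f"
proof -
  have "inj_on (smap \<sigma> (flabel P f)) (chart P f ` f)"
    unfolding P.chart_homeomorphism(2)[OF f]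
    by (rule homeomorphic_imp_injective_map[OF presubstitutionD(3)[OF pre P.chart_homeomorphism(4)[OF f]]])
  then have "inj_on (smap \<sigma> (flabel P f) \<circ> chart P f) f"
    by (rule comp_inj_on[OF P.chart_homeomorphism(3)[OF f]])
  moreover have "smap \<sigma> (flabel P f) \<circ> chart P f = fmap \<sigma> P f" by (rule ext) (simp add: fmap_def)
  ultimately show ?thesis by simp
qed

lemma in_fmap_image:
  assumes "f \<in> faces P" "e \<subseteq> f" "x \<in> f" "fmap \<sigma> P f x \<in> fmap \<sigma> P f ` e"
  shows "x \<in> e"
  using inj_on_image_mem_iff[OF inj_fmap[OF assms(1)] assms(3,2)] assms(4) by simp

lemma gluing_relE:
  assumes "((f, x), p) \<in> gluing_rel \<sigma> P \<theta>"
  obtains f' e where "adjacent_along P f f' e" "x \<in> fmap \<sigma> P f ` e" "p = (f', \<theta> f f' e x)"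
  using assms unfolding gluing_rel_def by auto

lemma chain_from_interior:
  assumes x: "x \<notin> boundary_circle (cspace (F f))" and p: "((f, x), p) \<in> (gluing_rel \<sigma> P \<theta>)\<^sup>*"
  shows "p = (f, x)"
  using p
proof (cases rule: converse_rtranclE)
  case (step y)
  then obtain f' e where "adjacent_along P f f' e" "x \<in> fmap \<sigma> P f ` e" by (elim gluing_relE)
  then show ?thesis using fmap_image_edge[of f e] x unfolding adjacent_along_def by blast
qed simp

text \<open>
  At a vertex of \<open>P\<close> the gluing maps agree with \<open>\<sigma>\<close>, so a chain starting at its image only visits the images
  of this same vertex, in faces that contain it.
\<close>
lemma chain_from_vertex:
  assumes f: "f \<in> faces P" and z: "z \<in> verts P" "z \<in> f"
    and p: "((f, fmap \<sigma> P f z), p) \<in> (gluing_rel \<sigma> P \<theta>)\<^sup>*"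
  shows "z \<in> fst p \<and> fst p \<in> faces P \<and> snd p = fmap \<sigma> P (fst p) z"
  using p
proof (induction rule: rtrancl_induct)
  case base
  then show ?case using f z by simp
next
  case (step p p')
  obtain f1 x1 where p: "p = (f1, x1)" by (cases p)
  have 1: "z \<in> f1" "f1 \<in> faces P" "x1 = fmap \<sigma> P f1 z" using step.IH p by simp_all
  obtain f2 e where e: "adjacent_along P f1 f2 e" "x1 \<in> fmap \<sigma> P f1 ` e" "p' = (f2, \<theta> f1 f2 e x1)"
    using step.hyps(2) unfolding p by (elim gluing_relE)
  have adj: "f2 \<in> faces P" "e \<subseteq> f1" "e \<subseteq> f2" using e(1) unfolding adjacent_along_def by simp_all
  have ze: "z \<in> e" using in_fmap_image[OF 1(2) adj(2) 1(1)] e(2) 1(3) by simp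
  have "\<forall>v \<in> verts P \<inter> e. \<theta> f1 f2 e (fmap \<sigma> P f1 v) = fmap \<sigma> P f2 v"
    using maps e(1) unfolding gluing_maps_def by simp
  then have "\<theta> f1 f2 e x1 = fmap \<sigma> P f2 z" using ze z(1) 1(3) by simp
  then show ?case using e(3) adj ze by auto
qed

lemma inner_point_of_face:
  assumes "f \<in> faces P" "g \<in> faces (F f)"
  obtains y where "y \<in> g" "y \<notin> skeleton1 (F f)" "y \<notin> boundary_circle (cspace (F f))"
    "y \<in> topspace (cspace (F f))"
proof -
  interpret F: polygon_patch "ntiles \<sigma>" "tile \<sigma>" "F f" by (rule polygon_patch_F[OF assms(1)])
  obtain y where "y \<in> g - skeleton1 (F f)" using F.open_face(3)[OF assms(2)] by (metis ex_in_conv)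
  then show ?thesis using that[of y] F.open_face(2)[OF assms(2)] F.cells_subset(2)[OF assms(2)] by blast
qed

text \<open>A point of an open face is not identified with any other point, and it determines the face.\<close>
lemma subface_inject:
  assumes f: "f \<in> faces P" "g \<in> faces (F f)" and f': "f' \<in> faces P" "g' \<in> faces (F f')"
    and eq: "subface f g = subface f' g'"
  shows "f = f'" "g = g'"
proof -
  interpret F: polygon_patch "ntiles \<sigma>" "tile \<sigma>" "F f" by (rule polygon_patch_F[OF f(1)])
  interpret F': polygon_patch "ntiles \<sigma>" "tile \<sigma>" "F f'" by (rule polygon_patch_F[OF f'(1)])
  obtain y where y: "y \<in> g" "y \<notin> skeleton1 (F f)" "y \<notin> boundary_circle (cspace (F f))"
    "y \<in> topspace (cspace (F f))" using inner_point_of_face[OF f] .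
  have "q (f, y) \<in> subface f' g'" unfolding eq[symmetric] using y(1) by (intro imageI) simp
  then obtain y' where y': "y' \<in> g'" "q (f, y) = q (f', y')" by auto
  have "y' \<in> topspace (cspace (F f'))" using y'(1) F'.cells_subset(2)[OF f'(2)] by (rule subsetD[rotated])
  then have "((f, y), (f', y')) \<in> (gluing_rel \<sigma> P \<theta>)\<^sup>*" using rel[OF f(1) f'(1) y(4)] y'(2) by blast
  then have "(f', y') = (f, y)" by (rule chain_from_interior[OF y(3)])
  then have 1: "f' = f" "y \<in> g'" using y'(1) by auto
  then show "f = f'" by simp
  show "g = g'"
  proof (rule ccontr)
    assume "g \<noteq> g'"
    then have "g \<inter> g' \<subseteq> skeleton1 (F f)" using F.faces_Int[OF f(2)] f'(2) 1(1) by simp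
    then show False using y 1(2) by (auto dest: subsetD)
  qed
qed

text \<open>
  A free edge \<open>e\<close> of \<open>Q\<close> comes from an edge \<open>e1\<close> of a substituted patch \<open>\<sigma>(type f)\<close>, and \<open>e1\<close> lies in only one
  face of it. So \<open>e1\<close> is in the boundary circle, in the edge path of some edge \<open>a\<close> of \<open>f\<close>. If \<open>a\<close> were in a
  second face \<open>f3\<close> of \<open>P\<close>, the gluing map would transport \<open>e1\<close> to an edge of \<open>\<sigma>(type f3)\<close>; the latter
  lies in a face there, which would be a second face of \<open>Q\<close> containing \<open>e\<close>.
\<close>
lemma free_edge_descends:
  assumes e: "free_edge Q e"
  obtains f e1 a where "f \<in> faces P" "e1 \<in> edges (F f)" "e = q ` ({f} \<times> e1)"
    "free_edge P a" "a \<subseteq> f" "e1 \<subseteq> fmap \<sigma> P f ` a"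
proof -
  have eQ: "e \<in> edges Q" using e unfolding free_edge_def by (rule conjunct1)
  have "\<exists>!E. E \<in> faces Q \<and> e \<subseteq> E" using e unfolding free_edge_def by (rule conjunct2)
  then obtain E where E0: "E \<in> faces Q \<and> e \<subseteq> E" and uniq0: "\<forall>E'. E' \<in> faces Q \<and> e \<subseteq> E' \<longrightarrow> E' = E"
    unfolding Ex1_def by (rule exE) (erule conjE)
  note E = conjunct1[OF E0] conjunct2[OF E0]
  have uniq: "E' = E" if "E' \<in> faces Q" "e \<subseteq> E'" for E'
    by (rule mp[OF spec[OF uniq0] conjI[OF that]])
  obtain f g where f: "f \<in> faces P" and g: "g \<in> faces (F f)" and Eq: "E = subface f g"
    using E(1) unfolding facesQ by auto
  interpret F: polygon_patch "ntiles \<sigma>" "tile \<sigma>" "F f" by (rule polygon_patch_F[OF f])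
  have "chart Q E ` e \<in> (`) (chart Q E) ` {e \<in> edges Q. e \<subseteq> E}" using E(2) eQ by (intro imageI) simp
  also have "\<dots> = edges (tile \<sigma> (flabel Q E))" by (rule Q.chart_cells(2)[OF E(1)])
  also have "\<dots> = (`) (chart (F f) g) ` {e \<in> edges (F f). e \<subseteq> g}"
    unfolding Eq labelQ(1)[OF f g] by (rule F.chart_cells(2)[OF g, symmetric])
  finally obtain e1 where e1: "e1 \<in> edges (F f)" "e1 \<subseteq> g" "chart Q E ` e = chart (F f) g ` e1" by auto
  have sub: "q ` ({f} \<times> e1) \<subseteq> E" unfolding Eq using e1(2) by auto
  have "chart Q E ` q ` ({f} \<times> e1) = (\<lambda>x. chart Q E (q (f, x))) ` e1" by (auto simp: image_image)
  also have "\<dots> = chart (F f) g ` e1"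
    unfolding Eq by (rule image_cong[OF refl]) (rule labelQ(2)[OF f g], rule subsetD[OF e1(2)])
  finally have "chart Q E ` e = chart Q E ` q ` ({f} \<times> e1)" using e1(3) by simp
  then have e_eq: "e = q ` ({f} \<times> e1)"
    using inj_on_image_eq_iff[OF Q.chart_homeomorphism(3)[OF E(1)] E(2) sub] by simp
  have sub2: "e \<subseteq> subface f g2" if "e1 \<subseteq> g2" for g2 unfolding e_eq using that by auto
  have bd: "e1 \<subseteq> boundary_circle (cspace (F f))"
  proof (rule F.free_edge_in_boundary[OF e1(1) g e1(2)])
    fix g2 assume g2: "g2 \<in> faces (F f)" "e1 \<subseteq> g2"
    have "subface f g2 = subface f g" using uniq[OF subface_in[OF f g2(1)] sub2[OF g2(2)]] Eq by simp
    then show "g2 = g" by (rule subface_inject(2)[OF f g2(1) f g])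
  qed
  define j where "j = flabel P f"
  have j: "j < ntiles \<sigma>" unfolding j_def by (rule P.chart_homeomorphism(4)[OF f])
  obtain a0 where a0: "a0 \<in> edges (tile \<sigma> j)" "e1 \<subseteq> smap \<sigma> j ` a0"
    using F.boundary_edge_in_tile_edge[OF presubstitutionD(1,3,4)[OF pre j, unfolded j_def] e1(1) bd]
    unfolding j_def by auto
  have "a0 \<in> (`) (chart P f) ` {e \<in> edges P. e \<subseteq> f}"
    using a0(1) unfolding j_def P.chart_cells(2)[OF f] .
  then obtain a where a: "a \<in> edges P" "a \<subseteq> f" "a0 = chart P f ` a" by auto
  have e1a: "e1 \<subseteq> fmap \<sigma> P f ` a" using a0(2) unfolding a(3) by (simp add: fmap_def j_def image_image)
  have only: "f3 = f" if f3: "f3 \<in> faces P" "a \<subseteq> f3" for f3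
  proof (rule ccontr)
    assume ne: "f3 \<noteq> f"
    interpret F3: polygon_patch "ntiles \<sigma>" "tile \<sigma>" "F f3" by (rule polygon_patch_F[OF f3(1)])
    have adj: "adjacent_along P f f3 a"
      unfolding adjacent_along_def using f f3 ne a(1,2) by simp
    have img: "(`) (\<theta> f f3 a) ` path_edges \<sigma> (flabel P f) (chart P f ` a)
          = path_edges \<sigma> (flabel P f3) (chart P f3 ` a)"
      using maps adj unfolding gluing_maps_def by simp
    have "e1 \<in> path_edges \<sigma> (flabel P f) (chart P f ` a)"
      using e1(1) a0(2) unfolding a(3) path_edges_def j_def by simp
    then have "\<theta> f f3 a ` e1 \<in> path_edges \<sigma> (flabel P f3) (chart P f3 ` a)"
      unfolding img[symmetric] by (rule imageI)
    then have e3: "\<theta> f f3 a ` e1 \<in> edges (F f3)" by (simp add: path_edges_def)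
    then obtain g3 where g3: "g3 \<in> faces (F f3)" "\<theta> f f3 a ` e1 \<subseteq> g3"
      using F3.edge_in_some_face by metis
    have "e \<subseteq> subface f3 g3"
    proof
      fix w assume "w \<in> e"
      then obtain x where x: "x \<in> e1" "w = q (f, x)" unfolding e_eq by auto
      have "((f, x), (f3, \<theta> f f3 a x)) \<in> gluing_rel \<sigma> P \<theta>"
        unfolding gluing_rel_def using adj subsetD[OF e1a x(1)] by blast
      then have "q (f, x) = q (f3, \<theta> f f3 a x)"
        using rel[OF f f3(1) subsetD[OF F.cells_subset(1)[OF e1(1)] x(1)]
            subsetD[OF F3.cells_subset(1)[OF e3] imageI[OF x(1)]]] by blast
      moreover have "\<theta> f f3 a x \<in> g3" using g3(2) x(1) by auto
      ultimately show "w \<in> subface f3 g3" using x(2) by simp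
    qed
    then have "subface f3 g3 = subface f g" using uniq[OF subface_in[OF f3(1) g3(1)]] Eq by simp
    then show False using subface_inject(1)[OF f3(1) g3(1) f g] ne by simp
  qed
  have "\<exists>!f'. f' \<in> faces P \<and> a \<subseteq> f'"
    by (rule ex1I[of _ f], rule conjI[OF f a(2)], elim conjE, rule only)
  then have "free_edge P a" unfolding free_edge_def by (rule conjI[OF a(1)])
  then show ?thesis by (rule that[OF f e1(1) e_eq _ a(2) e1a])
qed

text \<open>
  A vertex \<open>v\<close> of a free edge of \<open>Q\<close> lies over a point \<open>z\<close> of a free edge \<open>a\<close> of \<open>P\<close>. If \<open>z\<close> is a vertex,
  all faces whose images contain \<open>v\<close> contain \<open>z\<close>. If not, nothing is glued at \<open>z\<close>, as \<open>a\<close> is the only edge through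
  \<open>z\<close> and it is free, so the only face in question is the one that contains \<open>a\<close>. Finally, the vertices of
  core faces stay away from the boundary circles and are not identified with points there.
\<close>
lemma rim_subface:
  assumes f: "f \<in> faces P" and g: "g \<in> faces (F f)" and rim: "subface f g \<in> rim_faces Q"
  shows "f \<in> rim_faces P" "\<not> g \<subseteq> core (F f)"
proof -
  interpret F: polygon_patch "ntiles \<sigma>" "tile \<sigma>" "F f" by (rule polygon_patch_F[OF f])
  obtain e v where e: "free_edge Q e" and v: "v \<in> e" "v \<in> verts Q" "v \<in> subface f g"
    using rim unfolding rim_faces_def by auto
  obtain f' e1 a where f': "f' \<in> faces P" and e1: "e1 \<in> edges (F f')" "e = q ` ({f'} \<times> e1)"
    and a: "free_edge P a" "a \<subseteq> f'" "e1 \<subseteq> fmap \<sigma> P f' ` a"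
    using free_edge_descends[OF e] .
  interpret F': polygon_patch "ntiles \<sigma>" "tile \<sigma>" "F f'" by (rule polygon_patch_F[OF f'])
  have aP: "a \<in> edges P" using a(1) by (simp add: free_edge_def)
  obtain y where y: "y \<in> g" "v = q (f, y)" using v(3) by auto
  obtain y' where y': "y' \<in> e1" "v = q (f', y')" using v(1) e1(2) by auto
  obtain z where z: "z \<in> a" "y' = fmap \<sigma> P f' z" using y'(1) a(3) by auto
  have top: "y \<in> topspace (cspace (F f))" "y' \<in> topspace (cspace (F f'))"
    using y(1) F.cells_subset(2)[OF g] y'(1) F'.cells_subset(1)[OF e1(1)] by auto
  have chain: "((f', y'), (f, y)) \<in> (gluing_rel \<sigma> P \<theta>)\<^sup>*" "((f, y), (f', y')) \<in> (gluing_rel \<sigma> P \<theta>)\<^sup>*"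
    using rel[OF f' f top(2,1)] rel[OF f f' top] y(2) y'(2) by simp_all
  show "f \<in> rim_faces P"
  proof (cases "z \<in> verts P")
    case True
    have "z \<in> f" using chain_from_vertex[OF f' True subsetD[OF a(2) z(1)], of "(f, y)"] chain(1) z(2) by simp
    then show ?thesis unfolding rim_faces_def using f a(1) z(1) True by auto
  next
    case False
    have "(f, y) = (f', y')"
      using chain(1)
    proof (cases rule: converse_rtranclE)
      case (step p)
      then obtain f3 a2 where a2: "adjacent_along P f' f3 a2" "y' \<in> fmap \<sigma> P f' ` a2" by (elim gluing_relE)
      have adj: "a2 \<in> edges P" "a2 \<subseteq> f'" "a2 \<subseteq> f3" "f3 \<in> faces P" "f' \<noteq> f3"
        using a2(1) by (simp_all add: adjacent_along_def)
      have "z \<in> a2" using in_fmap_image[OF f' adj(2) subsetD[OF a(2) z(1)]] a2(2) z(2) by simp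
      then have "a2 = a" using P.edges_Int[OF adj(1) aP] z(1) False by (metis IntI subsetD)
      then have "a \<subseteq> f3" using adj(3) by simp
      then have "f' = f3" using free_edge_unique[OF a(1) f' a(2) adj(4)] by simp
      then show ?thesis using adj(5) by simp
    qed simp
    then have "a \<subseteq> f" using a(2) by simp
    moreover obtain u where "u \<in> a \<inter> verts P" using P.edge_open_cell(3)[OF aP] by (metis ex_in_conv)
    ultimately show ?thesis unfolding rim_faces_def using f a(1) by auto
  qed
  show "\<not> g \<subseteq> core (F f)"
  proof
    assume core: "g \<subseteq> core (F f)"
    define E where "E = subface f g"
    have E: "E \<in> faces Q" unfolding E_def by (rule subface_in[OF f g])
    have "chart Q E v \<in> chart Q E ` (verts Q \<inter> E)" using v(2,3) unfolding E_def by (intro imageI) simp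
    also have "\<dots> = verts (tile \<sigma> (flabel Q E))" by (rule Q.chart_cells(1)[OF E])
    also have "\<dots> = chart (F f) g ` (verts (F f) \<inter> g)"
      unfolding E_def labelQ(1)[OF f g] by (rule F.chart_cells(1)[OF g, symmetric])
    finally have "chart (F f) g y \<in> chart (F f) g ` (verts (F f) \<inter> g)"
      unfolding E_def y(2) labelQ(2)[OF f g y(1)] .
    then have "y \<in> verts (F f)"
      using inj_on_image_mem_iff[OF F.chart_homeomorphism(3)[OF g] y(1) Int_lower2] by simp
    then have "y \<notin> boundary_circle (cspace (F f))" by (rule F.core_face_avoids_boundary[OF g core y(1)])
    moreover from this have "(f', y') = (f, y)" by (rule chain_from_interior[OF _ chain(2)])
    moreover have "y' \<in> boundary_circle (cspace (F f'))"
      using fmap_image_edge[OF f' aP a(2)] a(3) y'(1) by auto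
    ultimately show False by simp
  qed
qed

lemma sum_faces:
  "(\<Sum>E\<in>faces Q. \<psi> (flabel Q E)) = (\<Sum>f\<in>faces P. children_sum (\<lambda>j. faces (spatch \<sigma> j)) (\<lambda>j. flabel (spatch \<sigma> j)) \<psi> (flabel P f))"
proof -
  let ?I = "SIGMA f:faces P. faces (F f)"
  have fin: "finite (faces (F f))" if "f \<in> faces P" for f
    using polygon_patch.finite_faces[OF polygon_patch_F[OF that]] .
  have img: "faces Q = (\<lambda>(f, g). subface f g) ` ?I" unfolding facesQ by auto
  have inj: "inj_on (\<lambda>(f, g). subface f g) ?I"
    by (rule inj_onI) (auto dest: subface_inject)
  have "(\<Sum>E\<in>faces Q. \<psi> (flabel Q E)) = (\<Sum>(f, g)\<in>?I. \<psi> (flabel Q (subface f g)))"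
    unfolding img sum.reindex[OF inj] by (simp add: case_prod_beta)
  also have "\<dots> = (\<Sum>(f, g)\<in>?I. \<psi> (flabel (F f) g))"
    by (rule sum.cong) (auto simp: labelQ)
  also have "\<dots> = (\<Sum>f\<in>faces P. \<Sum>g\<in>faces (F f). \<psi> (flabel (F f) g))"
    by (rule sum.Sigma[symmetric]) (use P.finite_faces fin in auto)
  finally show ?thesis by (simp add: children_sum_def)
qed

lemma sum_rim_faces:
  fixes \<psi> :: "nat \<Rightarrow> nat"
  shows "(\<Sum>E\<in>rim_faces Q. \<psi> (flabel Q E)) \<le>
    (\<Sum>f\<in>rim_faces P. children_sum (\<lambda>j. {g \<in> faces (spatch \<sigma> j). \<not> g \<subseteq> core (spatch \<sigma> j)}) (\<lambda>j. flabel (spatch \<sigma> j)) \<psi> (flabel P f))"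
proof -
  let ?H = "\<lambda>f. {g \<in> faces (F f). \<not> g \<subseteq> core (F f)}"
  let ?I = "SIGMA f:rim_faces P. ?H f"
  have sub: "rim_faces P \<subseteq> faces P" by (auto simp: rim_faces_def)
  have fin: "finite (?H f)" if "f \<in> rim_faces P" for f
    using polygon_patch.finite_faces[OF polygon_patch_F[OF subsetD[OF sub that]]] by simp
  have finI: "finite ?I" by (rule finite_SigmaI) (use finite_subset[OF sub P.finite_faces] fin in auto)
  have img: "rim_faces Q \<subseteq> (\<lambda>(f, g). subface f g) ` ?I"
  proof
    fix E assume E: "E \<in> rim_faces Q"
    then have "E \<in> faces Q" by (simp add: rim_faces_def)
    then obtain f g where f: "f \<in> faces P" "g \<in> faces (F f)" "E = subface f g" unfolding facesQ by auto
    then have "(f, g) \<in> ?I" using rim_subface[OF f(1,2)] E by simp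
    then show "E \<in> (\<lambda>(f, g). subface f g) ` ?I" using f(3) by (auto intro: rev_image_eqI)
  qed
  have inj: "inj_on (\<lambda>(f, g). subface f g) ?I"
    by (rule inj_onI) (auto dest: subface_inject dest!: subsetD[OF sub])
  have "(\<Sum>E\<in>rim_faces Q. \<psi> (flabel Q E)) \<le> (\<Sum>E\<in>(\<lambda>(f, g). subface f g) ` ?I. \<psi> (flabel Q E))"
    by (rule sum_mono2[OF finite_imageI[OF finI] img]) simp
  also have "\<dots> = (\<Sum>(f, g)\<in>?I. \<psi> (flabel Q (subface f g)))"
    unfolding sum.reindex[OF inj] by (simp add: case_prod_beta)
  also have "\<dots> = (\<Sum>(f, g)\<in>?I. \<psi> (flabel (F f) g))"
    by (rule sum.cong) (auto simp: labelQ dest!: subsetD[OF sub])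
  also have "\<dots> = (\<Sum>f\<in>rim_faces P. \<Sum>g\<in>?H f. \<psi> (flabel (F f) g))"
    by (rule sum.Sigma[symmetric]) (use finite_subset[OF sub P.finite_faces] fin in auto)
  finally show ?thesis by (simp add: children_sum_def)
qed

end

lemma glued_from_imp_gluing:
  assumes "presubstitution \<sigma>" "is_patch (ntiles \<sigma>) (tile \<sigma>) P" "glued_from \<sigma> P q Q"
  obtains \<theta> where "gluing \<sigma> P \<theta> q Q"
proof -
  let ?S = "sum_topology (\<lambda>f. cspace (fpatch \<sigma> P f)) (faces P)"
  have "\<exists>\<theta>. gluing_maps \<sigma> P \<theta> \<and> quotient_map ?S (cspace Q) q \<and>
            (\<forall>p\<in>topspace ?S. \<forall>p'\<in>topspace ?S. q p = q p' \<longleftrightarrow> (p, p') \<in> (gluing_rel \<sigma> P \<theta>)\<^sup>*)"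
    using assms(3) unfolding glued_from_def Let_def by (elim conjE)
  then obtain \<theta> where \<theta>: "gluing_maps \<sigma> P \<theta>"
    "\<forall>p\<in>topspace ?S. \<forall>p'\<in>topspace ?S. q p = q p' \<longleftrightarrow> (p, p') \<in> (gluing_rel \<sigma> P \<theta>)\<^sup>*"
    by (elim exE conjE)
  have "gluing \<sigma> P \<theta> q Q"
    by unfold_locales (use assms \<theta> in \<open>simp_all add: topspace_sum_topology\<close>)
  then show ?thesis using that by blast
qed

section \<open>Tiles and tilings of the hyperbolic plane\<close>

lemma interior_of_hyp:
  assumes "t \<subseteq> hyp_plane" shows "hyp.mtopology interior_of t = interior t"
  unfolding mtopology_hyp using interior_of_subtopology_open[of euclidean hyp_plane t] open_hyp_plane
    interior_subset[of t] assms by auto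

lemma tile_hyp:
  assumes "is_tile hyp.mtopology t"
  shows "t \<subseteq> hyp_plane" "closedin (top_of_set hyp_plane) t" "t \<subseteq> closure (interior t)"
proof -
  have t: "compactin hyp.mtopology t" "t = hyp.mtopology closure_of (hyp.mtopology interior_of t)"
    using assms unfolding is_tile_def by (rule conjunct1, rule conjunct2)
  show sub: "t \<subseteq> hyp_plane" using compactin_subset_topspace[OF t(1)] by simp
  show "closedin (top_of_set hyp_plane) t"
    using compactin_imp_closedin[OF hyp.Hausdorff_space_mtopology t(1)] unfolding mtopology_hyp .
  have "t = hyp.mtopology closure_of (interior t)" using t(2) interior_of_hyp[OF sub] by simp
  also have "\<dots> \<subseteq> closure (interior t)"
    unfolding mtopology_hyp using closure_of_subtopology_subset[of euclidean hyp_plane "interior t"] by simp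
  finally show "t \<subseteq> closure (interior t)" .
qed

definition comparable_to_ball :: "real \<Rightarrow> real \<Rightarrow> complex set \<Rightarrow> bool" where
  "comparable_to_ball r D t \<longleftrightarrow>
     (\<exists>c\<in>hyp_plane. (\<forall>w\<in>hyp_plane. hyp_dist c w < r \<longrightarrow> w \<in> t) \<and> (\<forall>w\<in>t. hyp_dist c w \<le> D))"

lemma comparable_to_ball_mono:
  assumes "comparable_to_ball r D t" "r' \<le> r" "D \<le> D'"
  shows "comparable_to_ball r' D' t"
proof -
  obtain c where c: "c \<in> hyp_plane" "\<forall>w\<in>hyp_plane. hyp_dist c w < r \<longrightarrow> w \<in> t" "\<forall>w\<in>t. hyp_dist c w \<le> D"
    using assms(1) unfolding comparable_to_ball_def by auto
  then have "\<forall>w\<in>hyp_plane. hyp_dist c w < r' \<longrightarrow> w \<in> t" "\<forall>w\<in>t. hyp_dist c w \<le> D'"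
    using assms(2,3) by force+
  then show ?thesis unfolding comparable_to_ball_def using c(1) by auto
qed

lemma tile_comparable_to_ball:
  assumes "is_tile hyp.mtopology s" "s \<noteq> {}"
  shows "\<exists>r D. r > 0 \<and> comparable_to_ball r D s"
proof -
  have s: "compactin hyp.mtopology s" "s = hyp.mtopology closure_of (hyp.mtopology interior_of s)"
    using assms(1) unfolding is_tile_def by (rule conjunct1, rule conjunct2)
  have "hyp.mtopology interior_of s \<noteq> {}" using s(2) assms(2) by (metis closure_of_empty)
  then obtain c where c: "c \<in> hyp.mtopology interior_of s" by (metis ex_in_conv)
  have "openin hyp.mtopology (hyp.mtopology interior_of s)" by simp
  then obtain r where r: "r > 0" "hyp.mball c r \<subseteq> hyp.mtopology interior_of s"
    using c unfolding hyp.openin_mtopology by meson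
  have cM: "c \<in> hyp_plane" using c interior_of_subset_topspace[of hyp.mtopology s] by auto
  have "hyp.mbounded s" by (rule hyp.compactin_imp_mbounded[OF s(1)])
  then obtain x B where x: "s \<subseteq> hyp.mcball x B" unfolding hyp.mbounded_def by meson
  have "hyp_dist c w \<le> hyp_dist c x + B" if w: "w \<in> s" for w
  proof -
    have "x \<in> hyp_plane" "w \<in> hyp_plane" "hyp_dist x w \<le> B" using subsetD[OF x w] by simp_all
    then show ?thesis using hyp.triangle[OF cM, of x w] by simp
  qed
  moreover have "w \<in> s" if "w \<in> hyp_plane" "hyp_dist c w < r" for w
  proof -
    have "w \<in> hyp.mball c r" using that cM by simp
    then show ?thesis using r(2) interior_of_subset[of hyp.mtopology s] by (meson subsetD)
  qed
  ultimately have "comparable_to_ball r (hyp_dist c x + B) s"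
    unfolding comparable_to_ball_def using cM by auto
  then show ?thesis using r(1) by auto
qed

lemma comparable_to_ball_image:
  assumes g: "g \<in> Bij hyp_plane" "\<forall>x\<in>hyp_plane. \<forall>y\<in>hyp_plane. hyp_dist (g x) (g y) = hyp_dist x y"
    and s: "s \<subseteq> hyp_plane" "comparable_to_ball r D s"
  shows "comparable_to_ball r D (g ` s)"
proof -
  obtain c where c: "c \<in> hyp_plane" "\<forall>w\<in>hyp_plane. hyp_dist c w < r \<longrightarrow> w \<in> s" "\<forall>w\<in>s. hyp_dist c w \<le> D"
    using s(2) unfolding comparable_to_ball_def by auto
  have bij: "bij_betw g hyp_plane hyp_plane" using g(1) by (simp add: Bij_def)
  have im: "g ` hyp_plane = hyp_plane" using bij by (rule bij_betw_imp_surj_on)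
  have "w \<in> g ` s" if w: "w \<in> hyp_plane" "hyp_dist (g c) w < r" for w
  proof -
    obtain u where u: "u \<in> hyp_plane" "w = g u" using w(1) im by auto
    then have "hyp_dist c u < r" using g(2) c(1) w(2) by simp
    then show ?thesis using c(2) u by simp
  qed
  moreover have "hyp_dist (g c) w \<le> D" if "w \<in> g ` s" for w
    using that g(2) c(1,3) s(1) by auto
  moreover have "g c \<in> hyp_plane" using c(1) im by auto
  ultimately show ?thesis unfolding comparable_to_ball_def by auto
qed

lemma tilingD:
  assumes "tiling hyp_plane hyp_dist \<Gamma> \<Lambda> \<P> \<T>"
  shows "subgroup \<Gamma> (isometry_group hyp_plane hyp_dist)" "finite \<P>"
    "\<P> \<subseteq> prototiles hyp.mtopology \<Gamma> \<Lambda>" "\<forall>t\<in>\<T>. \<exists>p\<in>\<P>. t \<in> p" "(\<Union>t\<in>\<T>. fst t) = hyp_plane"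
    "\<forall>t\<in>\<T>. \<forall>t'\<in>\<T>. t \<noteq> t' \<longrightarrow> hyp.mtopology interior_of fst t \<inter> hyp.mtopology interior_of fst t' = {}"
proof -
  note * = assms[unfolded tiling_def Let_def]
  show "subgroup \<Gamma> (isometry_group hyp_plane hyp_dist)" using * by (elim conjE)
  show "finite \<P>" using * by (elim conjE)
  show "\<P> \<subseteq> prototiles hyp.mtopology \<Gamma> \<Lambda>" using * by (elim conjE)
  show "\<forall>t\<in>\<T>. \<exists>p\<in>\<P>. t \<in> p" using * by (elim conjE)
  show "(\<Union>t\<in>\<T>. fst t) = hyp_plane" using * by (elim conjE)
  show "\<forall>t\<in>\<T>. \<forall>t'\<in>\<T>. t \<noteq> t' \<longrightarrow> hyp.mtopology interior_of fst t \<inter> hyp.mtopology interior_of fst t' = {}"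
    using * by (elim conjE)
qed

lemma prototile_members:
  assumes "p \<in> prototiles X \<Gamma> \<Lambda>"
  shows "\<exists>s. \<forall>t\<in>p. is_tile X s \<and> is_tile X (fst t) \<and> (\<exists>g\<in>\<Gamma>. fst t = g ` s)"
proof -
  obtain a where a: "p = tile_equiv X \<Gamma> \<Lambda> `` {a}"
    using assms unfolding prototiles_def by (auto elim: quotientE)
  show ?thesis
  proof (rule exI[of _ "fst a"], rule ballI)
    fix t assume "t \<in> p"
    then have "(a, t) \<in> tile_equiv X \<Gamma> \<Lambda>" unfolding a by simp
    then show "is_tile X (fst a) \<and> is_tile X (fst t) \<and> (\<exists>g\<in>\<Gamma>. fst t = g ` fst a)"
      unfolding tile_equiv_def labelled_tiles_def by auto
  qed
qed

text \<open>
  The tiles of one prototile are isometric, so they contain and are contained in balls of the same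
  radii; as there are finitely many prototiles, the radii can be chosen for all tiles at once.
  The empty set counts as a tile and has to be excluded.
\<close>
lemma tiling_comparable_to_ball:
  assumes T: "tiling hyp_plane hyp_dist \<Gamma> \<Lambda> \<P> \<T>"
  obtains r D where "r > 0" "\<And>t. t \<in> fst ` \<T> \<Longrightarrow> t \<noteq> {} \<Longrightarrow> comparable_to_ball r D t"
proof -
  have iso: "g \<in> Bij hyp_plane \<and> (\<forall>x\<in>hyp_plane. \<forall>y\<in>hyp_plane. hyp_dist (g x) (g y) = hyp_dist x y)"
    if "g \<in> \<Gamma>" for g
    using subsetD[OF subgroup.subset[OF tilingD(1)[OF T]] that] by (simp add: isometry_group_def)
  have "\<exists>r D. r > 0 \<and> (\<forall>t\<in>p. fst t \<noteq> {} \<longrightarrow> comparable_to_ball r D (fst t))" if p: "p \<in> \<P>" for p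
  proof -
    obtain s where s0: "\<forall>t\<in>p. is_tile hyp.mtopology s \<and> is_tile hyp.mtopology (fst t) \<and> (\<exists>g\<in>\<Gamma>. fst t = g ` s)"
      using prototile_members[OF subsetD[OF tilingD(3)[OF T] p]] by (elim exE)
    note s = bspec[OF s0]
    show ?thesis
    proof (cases "is_tile hyp.mtopology s \<and> s \<noteq> {}")
      case True
      then obtain r D where rD: "r > 0" "comparable_to_ball r D s" using tile_comparable_to_ball[of s] by auto
      have "comparable_to_ball r D (fst t)" if t: "t \<in> p" for t
      proof -
        obtain g where g: "g \<in> \<Gamma>" "fst t = g ` s" using s[OF t] by auto
        show ?thesis unfolding g(2)
          using iso[OF g(1)] tile_hyp(1)[of s] True rD(2) by (intro comparable_to_ball_image) simp_all
      qed
      then have "\<forall>t\<in>p. fst t \<noteq> {} \<longrightarrow> comparable_to_ball r D (fst t)" by simp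
      then show ?thesis using rD(1) by (intro exI[of _ r] exI[of _ D] conjI)
    next
      case False
      have "fst t = {}" if "t \<in> p" for t using s[OF that] False by auto
      then show ?thesis by (intro exI[of _ 1]) auto
    qed
  qed
  then obtain r D where rD: "\<And>p. p \<in> \<P> \<Longrightarrow> r p > 0 \<and> (\<forall>t\<in>p. fst t \<noteq> {} \<longrightarrow> comparable_to_ball (r p) (D p) (fst t))"
    by metis
  define r0 D0 where "r0 = Min (insert 1 (r ` \<P>))" and "D0 = Max (insert 0 (D ` \<P>))"
  have fin: "finite (insert 1 (r ` \<P>))" "finite (insert 0 (D ` \<P>))" using tilingD(2)[OF T] by simp_all
  have "r0 > 0" unfolding r0_def using fin(1) rD by (subst Min_gr_iff) auto
  moreover have "comparable_to_ball r0 D0 t" if t: "t \<in> fst ` \<T>" "t \<noteq> {}" for t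
  proof -
    obtain x where x: "x \<in> \<T>" "t = fst x" using t(1) by auto
    then obtain p where p: "p \<in> \<P>" "x \<in> p" using tilingD(4)[OF T] by auto
    have "comparable_to_ball (r p) (D p) t" using rD[OF p(1)] p(2) x(2) t(2) by simp
    moreover have "r0 \<le> r p" unfolding r0_def using fin(1) p(1) by (intro Min_le) auto
    moreover have "D p \<le> D0" unfolding D0_def using fin(2) p(1) by (intro Max_ge) auto
    ultimately show ?thesis by (rule comparable_to_ball_mono)
  qed
  ultimately show ?thesis by (rule that)
qed

lemma tiling_is_tile:
  assumes T: "tiling hyp_plane hyp_dist \<Gamma> \<Lambda> \<P> \<T>" and t: "t \<in> fst ` \<T>"
  shows "is_tile hyp.mtopology t"
proof -
  obtain x where x: "x \<in> \<T>" "t = fst x" using t by auto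
  then obtain p where p: "p \<in> \<P>" "x \<in> p" using tilingD(4)[OF T] by auto
  have "\<exists>s. \<forall>t\<in>p. is_tile hyp.mtopology s \<and> is_tile hyp.mtopology (fst t) \<and> (\<exists>g\<in>\<Gamma>. fst t = g ` s)"
    by (rule prototile_members[OF subsetD[OF tilingD(3)[OF T] p(1)]])
  then show ?thesis using p(2) x(2) by auto
qed

lemma continuous_map_into_union_topology:
  "continuous_map (X k) (union_topology X) (\<lambda>x. x)"
proof -
  have top: "topspace (union_topology X) \<subseteq> (\<Union>k. topspace (X k))"
    using openin_union_topology[of X "topspace (union_topology X)"] by simp
  have "openin (union_topology X) (\<Union>k. topspace (X k))"
    unfolding openin_union_topology
  proof (intro conjI allI)
    fix k
    have "(\<Union>k. topspace (X k)) \<inter> topspace (X k) = topspace (X k)" by auto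
    then show "openin (X k) ((\<Union>k. topspace (X k)) \<inter> topspace (X k))" by simp
  qed simp
  then have "(\<Union>k. topspace (X k)) \<subseteq> topspace (union_topology X)" by (rule openin_subset)
  then have 1: "topspace (X k) \<subseteq> topspace (union_topology X)" by auto
  show ?thesis unfolding continuous_map_def
  proof (intro conjI allI impI)
    show "(\<lambda>x. x) \<in> topspace (X k) \<rightarrow> topspace (union_topology X)" using 1 by auto
    fix U assume "openin (union_topology X) U"
    then have "openin (X k) (U \<inter> topspace (X k))" unfolding openin_union_topology by simp
    moreover have "U \<inter> topspace (X k) = {x \<in> topspace (X k). x \<in> U}" by auto
    ultimately show "openin (X k) {x \<in> topspace (X k). x \<in> U}" by simp
  qed
qed

lemma subcomplexD:
  assumes "subcomplex K L"
  shows "topspace (cspace K) \<subseteq> topspace (cspace L)" "verts K = verts L \<inter> topspace (cspace K)"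
proof -
  show "topspace (cspace K) \<subseteq> topspace (cspace L)" using assms unfolding subcomplex_def by (elim conjE)
  show "verts K = verts L \<inter> topspace (cspace K)" using assms unfolding subcomplex_def by (elim conjE)
qed

lemma subcomplex_chain_verts:
  assumes "\<And>k. subcomplex (P k) (P (Suc k))" "m \<le> n"
  shows "topspace (cspace (P m)) \<subseteq> topspace (cspace (P n)) \<and> verts (P m) = verts (P n) \<inter> topspace (cspace (P m))"
  using assms(2)
proof (induction n rule: dec_induct)
  case base
  have "verts (P m) \<subseteq> topspace (cspace (P m))" using subcomplexD(2)[OF assms(1)[of m]] by simp
  then show ?case by auto
next
  case (step n)
  then show ?case using subcomplexD[OF assms(1)[of n]] by auto
qed

section \<open>The rim of an inflated patch\<close>

text \<open>
  The isoperimetric inequality is applied to the tiles \<open>S\<close> corresponding to the faces of \<open>P n\<close>, where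
  the finite set \<open>V\<close> of vertices of \<open>P n\<close> is disregarded. A point off \<open>V\<close> common to a tile \<open>t\<close> of \<open>S\<close> and a
  tile \<open>t'\<close> not in \<open>S\<close> is on an edge \<open>e\<close> of \<open>t\<close>, since the interiors of \<open>t\<close> and \<open>t'\<close> are disjoint. A second face of \<open>P n\<close>
  containing \<open>e\<close> would be a third tile at this point and make it a vertex.
\<close>
lemma rim_isoperimetric_inequality:
  fixes P :: "nat \<Rightarrow> 'a patch"
  assumes T: "tiling hyp_plane hyp_dist \<Gamma> \<Lambda> \<P> \<T>"
    and pre: "presubstitution \<sigma>"
    and patch: "\<And>k. is_patch (ntiles \<sigma>) (tile \<sigma>) (P k)"
    and chain: "\<And>k. subcomplex (P k) (P (Suc k))"
    and h: "homeomorphic_map hyp.mtopology (union_topology (\<lambda>k. cspace (P k))) h"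
    and hverts: "h ` tiling_verts \<T> = (\<Union>k. verts (P k))"
    and hfaces: "(`) h ` fst ` \<T> = (\<Union>k. faces (P k))"
  shows "\<exists>\<kappa>. \<forall>n. card (faces (P n)) \<le> \<kappa> * card (rim_faces (P n))"
proof -
  interpret P: polygon_patch "ntiles \<sigma>" "tile \<sigma>" "P k" for k
    by (rule polygon_patch_presubstitution[OF pre patch])
  define Tl where "Tl = fst ` \<T>"
  let ?L = "union_topology (\<lambda>k. cspace (P k))"
  have tile: "is_tile hyp.mtopology t" if "t \<in> Tl" for t
    using tiling_is_tile[OF T] that unfolding Tl_def by simp
  have sub: "t \<subseteq> hyp_plane" if "t \<in> Tl" for t by (rule tile_hyp(1)[OF tile[OF that]])
  have nonempty: "t \<noteq> {}" if "t \<in> Tl" for t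
  proof -
    have "h ` t \<in> (\<Union>k. faces (P k))" unfolding hfaces[symmetric] using that unfolding Tl_def by (rule imageI)
    then obtain k where "h ` t \<in> faces (P k)" by auto
    then have "h ` t - skeleton1 (P k) \<noteq> {}" by (rule P.open_face(3))
    then show ?thesis by auto
  qed
  obtain r D where r: "r > 0" and rD: "\<And>t. t \<in> Tl \<Longrightarrow> comparable_to_ball r D t"
    using tiling_comparable_to_ball[OF T] nonempty unfolding Tl_def by metis
  then have "\<forall>t\<in>Tl. \<exists>c. c \<in> hyp_plane \<and> (\<forall>w\<in>hyp_plane. hyp_dist c w < r \<longrightarrow> w \<in> t) \<and> (\<forall>w\<in>t. hyp_dist c w \<le> D)"
    unfolding comparable_to_ball_def Bex_def by simp
  then obtain c where c: "\<forall>t\<in>Tl. c t \<in> hyp_plane \<and> (\<forall>w\<in>hyp_plane. hyp_dist (c t) w < r \<longrightarrow> w \<in> t) \<and> (\<forall>w\<in>t. hyp_dist (c t) w \<le> D)"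
    by (rule bchoice[THEN exE])
  have disj: "interior t \<inter> interior t' = {}" if tt: "t \<in> Tl" "t' \<in> Tl" "t \<noteq> t'" for t t'
  proof -
    obtain x x' where x: "x \<in> \<T>" "x' \<in> \<T>" "t = fst x" "t' = fst x'" using tt(1,2) unfolding Tl_def by auto
    then have "x \<noteq> x'" using tt(3) by auto
    then have "hyp.mtopology interior_of t \<inter> hyp.mtopology interior_of t' = {}"
      using tilingD(6)[OF T] x by simp
    then show ?thesis by (simp add: interior_of_hyp sub tt)
  qed
  have cover: "\<Union>Tl = hyp_plane" using tilingD(5)[OF T] unfolding Tl_def .
  have "\<exists>\<kappa>. \<forall>S V. S \<subseteq> Tl \<and> finite S \<and> finite V \<longrightarrow>
           card S \<le> \<kappa> * card {t \<in> S. \<exists>x\<in>t - V. \<exists>t'\<in>Tl - S. x \<in> t'}"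
  proof (rule hyperbolic_isoperimetric_inequality[OF r cover, where c = c and D = D])
    show "closedin (top_of_set hyp_plane) t" if "t \<in> Tl" for t by (rule tile_hyp(2)[OF tile[OF that]])
    show "t \<subseteq> closure (interior t)" if "t \<in> Tl" for t by (rule tile_hyp(3)[OF tile[OF that]])
    show "interior t \<inter> interior t' = {}" if "t \<in> Tl" "t' \<in> Tl" "t \<noteq> t'" for t t' by (rule disj[OF that])
    show "c t \<in> hyp_plane" if "t \<in> Tl" for t using c that by simp
    show "hyp_dist (c t) w \<le> D" if "t \<in> Tl" "w \<in> t" for t w using c that by simp
    show "w \<in> interior t" if "t \<in> Tl" "w \<in> hyp_plane" "hyp_dist (c t) w < r" for t w
    proof -
      have "hyp.mball (c t) r \<subseteq> t" using bspec[OF c that(1)] by auto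
      then have "hyp.mball (c t) r \<subseteq> hyp.mtopology interior_of t" by (intro interior_of_maximal) simp_all
      moreover have "w \<in> hyp.mball (c t) r" using bspec[OF c that(1)] that by simp
      ultimately show ?thesis using interior_of_hyp[OF sub[OF that(1)]] by auto
    qed
  qed
  then obtain \<kappa> where \<kappa>0: "\<forall>S V. S \<subseteq> Tl \<and> finite S \<and> finite V \<longrightarrow>
           card S \<le> \<kappa> * card {t \<in> S. \<exists>x\<in>t - V. \<exists>t'\<in>Tl - S. x \<in> t'}"
    by (elim exE)
  have \<kappa>: "card S \<le> \<kappa> * card {t \<in> S. \<exists>x\<in>t - V. \<exists>t'\<in>Tl - S. x \<in> t'}"
    if "S \<subseteq> Tl" "finite S" "finite V" for S V
    using \<kappa>0[rule_format, of S V] that by simp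
  have top: "topspace hyp.mtopology = hyp_plane" by simp
  have injh: "inj_on h hyp_plane" using homeomorphic_imp_injective_map[OF h] by simp
  obtain h' where h': "continuous_map ?L hyp.mtopology h'" "\<And>x. x \<in> hyp_plane \<Longrightarrow> h' (h x) = x"
    "\<And>y. y \<in> topspace ?L \<Longrightarrow> h (h' y) = y"
    using homeomorphic_map_inverse[OF h] unfolding top by metis
  have "card (faces (P n)) \<le> \<kappa> * card (rim_faces (P n))" for n
  proof -
    define S where "S = {t \<in> Tl. h ` t \<in> faces (P n)}"
    define V where "V = {x \<in> hyp_plane. \<exists>F\<in>faces (P n). h x \<in> verts (P n) \<inter> F}"
    have injim: "inj_on ((`) h) Tl"
      by (rule inj_onI) (use inj_on_image_eq_iff[OF injh] sub in auto)
    have Sfaces: "(`) h ` S = faces (P n)"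
    proof
      show "(`) h ` S \<subseteq> faces (P n)" by (auto simp: S_def)
      show "faces (P n) \<subseteq> (`) h ` S"
      proof
        fix F assume F: "F \<in> faces (P n)"
        then have "F \<in> (`) h ` Tl" unfolding Tl_def hfaces by auto
        then show "F \<in> (`) h ` S" using F unfolding S_def by auto
      qed
    qed
    have injS: "inj_on ((`) h) S" by (rule inj_on_subset[OF injim]) (simp add: S_def)
    have finS: "finite S" using finite_imageD[OF _ injS] Sfaces P.finite_faces[of n] by simp
    have finV: "finite V"
    proof (rule finite_imageD)
      have "h ` V \<subseteq> (\<Union>F\<in>faces (P n). verts (P n) \<inter> F)" by (auto simp: V_def)
      then show "finite (h ` V)"
        by (rule finite_subset) (rule finite_UN_I[OF P.finite_faces P.finite_face_verts])
      show "inj_on h V" by (rule inj_on_subset[OF injh]) (auto simp: V_def)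
    qed
    define Bd where "Bd = {t \<in> S. \<exists>x\<in>t - V. \<exists>t'\<in>Tl - S. x \<in> t'}"
    have "h ` t \<in> rim_faces (P n)" if Bd: "t \<in> Bd" for t
    proof -
      obtain x t' where tS: "t \<in> S" and x: "x \<in> t" "x \<notin> V" and t': "t' \<in> Tl" "t' \<notin> S" "x \<in> t'"
        using Bd unfolding Bd_def by auto
      have t: "t \<in> Tl" and F: "h ` t \<in> faces (P n)" using tS by (simp_all add: S_def)
      have ne: "t \<noteq> t'" using tS t'(2) by auto
      define F where "F = h ` t"
      have FP: "F \<in> faces (P n)" unfolding F_def by (rule F)
      have xM: "x \<in> hyp_plane" using sub[OF t] x(1) by auto
      define y where "y = h x"
      have yF: "y \<in> F" unfolding y_def F_def using x(1) by (rule imageI)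
      have yverts: "y \<notin> verts (P n)" using x(2) xM FP yF unfolding V_def y_def by auto
      have ntop: "y \<in> topspace (cspace (P n))" using P.cells_subset(2)[OF FP] yF by auto
      have skel: "chart (P n) F y \<in> skeleton1 (P.face_tile n F)"
      proof (rule ccontr)
        assume not: "chart (P n) F y \<notin> skeleton1 (P.face_tile n F)"
        obtain \<psi> :: "complex \<Rightarrow> 'a" where \<psi>: "continuous_map (top_of_set (ball 0 1)) (cspace (P n)) \<psi>"
          "inj_on \<psi> (ball 0 1)" "\<psi> ` ball 0 1 \<subseteq> F"
          "\<And>x. x \<in> F \<Longrightarrow> x \<notin> \<psi> ` ball 0 1 \<Longrightarrow> chart (P n) F x \<in> skeleton1 (P.face_tile n F)"
          by (rule P.face_parametrization[OF FP], rule that, assumption, assumption, assumption, simp)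
        have y\<psi>: "y \<in> \<psi> ` ball 0 1" using \<psi>(4)[OF yF] not by auto
        define \<zeta> where "\<zeta> = h' \<circ> \<psi>"
        have "continuous_map (top_of_set (ball 0 1)) hyp.mtopology (h' \<circ> ((\<lambda>x. x) \<circ> \<psi>))"
          by (rule continuous_map_compose[OF continuous_map_compose[OF \<psi>(1) continuous_map_into_union_topology[of "\<lambda>k. cspace (P k)" n]] h'(1)])
        then have "continuous_on (ball 0 1) \<zeta>"
          unfolding mtopology_hyp by (simp add: \<zeta>_def o_def continuous_map_in_subtopology)
        moreover have "inj_on \<zeta> (ball 0 1)"
        proof -
          have "h' (h u) = u" if "u \<in> t" for u using h'(2) sub[OF t] that by auto
          then have "inj_on h' F" unfolding F_def by (intro inj_onI) auto
          then show ?thesis unfolding \<zeta>_def by (intro comp_inj_on[OF \<psi>(2)]) (rule inj_on_subset[OF _ \<psi>(3)])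
        qed
        ultimately have "open (\<zeta> ` ball 0 1)" by (intro invariance_of_domain open_ball)
        moreover have sub\<zeta>: "\<zeta> ` ball 0 1 \<subseteq> t"
        proof -
          have "h' ` F \<subseteq> t" unfolding F_def using h'(2) sub[OF t] by auto
          then show ?thesis using \<psi>(3) unfolding \<zeta>_def image_comp[symmetric] by (meson image_mono order_trans)
        qed
        moreover have "x \<in> \<zeta> ` ball 0 1"
        proof -
          have "h' y \<in> h' ` \<psi> ` ball 0 1" using y\<psi> by (rule imageI)
          then show ?thesis using h'(2)[OF xM] by (simp add: y_def \<zeta>_def image_comp)
        qed
        ultimately have "x \<in> interior t" by (meson interiorI)
        moreover have "x \<in> closure (interior t')" using tile_hyp(3)[OF tile[OF t'(1)]] t'(3) by auto
        ultimately have "interior t \<inter> interior t' \<noteq> {}"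
          using open_Int_closure_eq_empty[of "interior t" "interior t'"] open_interior by auto
        then show False using disj[OF t t'(1) ne] by simp
      qed
      obtain e where e: "e \<in> edges (P n)" "e \<subseteq> F" "y \<in> e"
        using P.face_skeleton[OF FP yF skel] yverts by auto
      \<comment> \<open>Each patch is a full subcomplex of the later ones, so a vertex of any of the patches that lies in
        \<open>P n\<close> is a vertex of \<open>P n\<close>.\<close>
      have notvert: "x \<notin> tiling_verts \<T>"
      proof
        assume "x \<in> tiling_verts \<T>"
        then have "y \<in> (\<Union>k. verts (P k))" unfolding hverts[symmetric] y_def by (rule imageI)
        then obtain k where k: "y \<in> verts (P k)" by auto
        have "y \<in> verts (P n)"
        proof (cases "k \<le> n")
          case True
          then show ?thesis using subcomplex_chain_verts[of P k n, OF chain] k by auto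
        next
          case False
          then show ?thesis using subcomplex_chain_verts[of P n k, OF chain] k ntop by auto
        qed
        then show False using yverts by simp
      qed
      have only: "F2 = F" if F2: "F2 \<in> faces (P n)" "e \<subseteq> F2" for F2
      proof (rule ccontr)
        assume neF: "F2 \<noteq> F"
        obtain t2 where t2: "t2 \<in> S" "F2 = h ` t2" using F2(1) unfolding Sfaces[symmetric] by auto
        have t2T: "t2 \<in> Tl" using t2(1) by (simp add: S_def)
        have "h x \<in> h ` t2" using F2(2) e(3) unfolding t2(2) y_def by auto
        then have xt2: "x \<in> t2" using inj_on_image_mem_iff[OF injh xM sub[OF t2T]] by simp
        have "t2 \<noteq> t" "t2 \<noteq> t'" using neF t2 t'(2) unfolding F_def by auto
        moreover obtain a a' a2 where a: "a \<in> \<T>" "a' \<in> \<T>" "a2 \<in> \<T>" "t = fst a" "t' = fst a'" "t2 = fst a2"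
          using t t'(1) t2T unfolding Tl_def by auto
        ultimately have "a \<noteq> a'" "a \<noteq> a2" "a' \<noteq> a2" using ne by auto
        then have "x \<in> tiling_verts \<T>"
          unfolding tiling_verts_def using a x(1) t'(3) xt2 by auto
        then show False using notvert by simp
      qed
      have "\<exists>!f. f \<in> faces (P n) \<and> e \<subseteq> f"
        by (rule ex1I[of _ F], rule conjI[OF FP e(2)], elim conjE, rule only)
      then have free: "free_edge (P n) e" unfolding free_edge_def by (rule conjI[OF e(1)])
      obtain v where v: "v \<in> e \<inter> verts (P n)" using P.edge_open_cell(3)[OF e(1)] by (metis ex_in_conv)
      then have "F \<in> rim_faces (P n)" unfolding rim_faces_def using FP free e(2) by auto
      then show ?thesis by (simp add: F_def)
    qed
    then have "(`) h ` Bd \<subseteq> rim_faces (P n)" by auto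
    moreover have "finite (rim_faces (P n))"
      by (rule finite_subset[OF _ P.finite_faces[of n]]) (auto simp: rim_faces_def)
    moreover have "inj_on ((`) h) Bd" by (rule inj_on_subset[OF injS]) (auto simp: Bd_def)
    ultimately have "card Bd \<le> card (rim_faces (P n))" using card_inj_on_le by metis
    moreover have "card (faces (P n)) = card S" unfolding Sfaces[symmetric] by (rule card_image[OF injS])
    moreover have "card S \<le> \<kappa> * card Bd"
      unfolding Bd_def by (rule \<kappa>[OF _ finS finV]) (auto simp: S_def)
    ultimately show ?thesis by (metis mult_le_mono2 order_trans)
  qed
  then show ?thesis by auto
qed

lemma iterate_type_occurs:
  assumes "iterate \<sigma> i p Q h"
  shows "\<forall>F\<in>faces Q. occurs_after (\<lambda>j. faces (spatch \<sigma> j)) (\<lambda>j. flabel (spatch \<sigma> j)) p i (flabel Q F)"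
  using assms
proof (induction rule: iterate.induct)
  case (iterate_0 P h)
  then obtain f where "faces P = {f}" "flabel P f = i" unfolding tile_copy_def by auto
  then show ?case by (auto intro: occurs_after.intros)
next
  case (iterate_Suc p P h q Q g)
  have Q1: "faces Q = {q ` ({f} \<times> g) | f g. f \<in> faces P \<and> g \<in> faces (fpatch \<sigma> P f)}"
    using iterate_Suc.hyps(2) unfolding glued_from_def by (elim conjE)
  have Q2: "\<forall>f\<in>faces P. \<forall>g\<in>faces (fpatch \<sigma> P f).
        flabel Q (q ` ({f} \<times> g)) = flabel (fpatch \<sigma> P f) g \<and>
        (\<forall>x\<in>g. chart Q (q ` ({f} \<times> g)) (q (f, x)) = chart (fpatch \<sigma> P f) g x)"
    using iterate_Suc.hyps(2) unfolding glued_from_def by (elim conjE)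
  show ?case
  proof
    fix F assume "F \<in> faces Q"
    then obtain f g where f: "f \<in> faces P" "g \<in> faces (fpatch \<sigma> P f)" "F = q ` ({f} \<times> g)"
      unfolding Q1 by auto
    have "flabel Q F = flabel (fpatch \<sigma> P f) g" using bspec[OF bspec[OF Q2 f(1)] f(2)] f(3) by simp
    moreover have "occurs_after (\<lambda>j. faces (spatch \<sigma> j)) (\<lambda>j. flabel (spatch \<sigma> j)) p i (flabel P f)"
      using iterate_Suc.IH f(1) by (rule bspec)
    ultimately show "occurs_after (\<lambda>j. faces (spatch \<sigma> j)) (\<lambda>j. flabel (spatch \<sigma> j)) (Suc p) i (flabel Q F)"
      using occurs_after_append[where G = "\<lambda>j. faces (spatch \<sigma> j)" and ty = "\<lambda>j. flabel (spatch \<sigma> j)"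
          and l = "flabel P f" and g = g] f(2) by simp
  qed
qed

text \<open>
  For a power \<open>\<sigma>'\<close> of \<open>\<sigma>\<close> that is pure primitive, the tile patches of \<open>\<sigma>'\<close> are iterates of \<open>\<sigma>\<close>, so every type is found
  among the descendants of every type after the same number of steps.
\<close>
lemma primitive_type_occurs:
  assumes "primitive \<sigma>"
  obtains k where "\<And>i j. i < ntiles \<sigma> \<Longrightarrow> j < ntiles \<sigma> \<Longrightarrow>
    occurs_after (\<lambda>j. faces (spatch \<sigma> j)) (\<lambda>j. flabel (spatch \<sigma> j)) k i j"
proof -
  obtain k \<sigma>' where k: "is_power \<sigma> k \<sigma>'" "pure_primitive \<sigma>'" using assms unfolding primitive_def by auto
  have n: "ntiles \<sigma>' = ntiles \<sigma>" using k(1) unfolding is_power_def by (elim conjE)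
  have it: "\<forall>i<ntiles \<sigma>. tile \<sigma>' i = tile \<sigma> i \<and> iterate \<sigma> i k (spatch \<sigma>' i) (smap \<sigma>' i)"
    using k(1) unfolding is_power_def by (elim conjE)
  have core: "\<forall>i<ntiles \<sigma>'. \<forall>j<ntiles \<sigma>'. core_contains_type (spatch \<sigma>' i) j"
    using k(2) unfolding pure_primitive_def by (elim conjE)
  have "occurs_after (\<lambda>j. faces (spatch \<sigma> j)) (\<lambda>j. flabel (spatch \<sigma> j)) k i j"
    if ij: "i < ntiles \<sigma>" "j < ntiles \<sigma>" for i j
  proof -
    have "core_contains_type (spatch \<sigma>' i) j" using core ij n by simp
    then obtain f where f: "f \<in> faces (spatch \<sigma>' i)" "flabel (spatch \<sigma>' i) f = j"
      unfolding core_contains_type_def by auto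
    have "iterate \<sigma> i k (spatch \<sigma>' i) (smap \<sigma>' i)" using it ij(1) by simp
    then show ?thesis using bspec[OF iterate_type_occurs f(1)] f(2) by simp
  qed
  then show ?thesis using that by blast
qed

lemma inflated_patch:
  assumes P0: "tile_copy \<sigma> i (P 0)" and glue: "\<And>k. glued_from \<sigma> (P k) (q k) (P (Suc k))"
  shows "is_patch (ntiles \<sigma>) (tile \<sigma>) (P n)"
proof (cases n)
  case 0
  then show ?thesis using P0 unfolding tile_copy_def by simp
next
  case (Suc k)
  show ?thesis unfolding Suc using glue[of k] unfolding glued_from_def by (rule conjunct1)
qed
text \<open>
  The faces of \<open>P n\<close> are counted exactly by the iterates of the operator of \<open>\<sigma>\<close>, those of the rim are bounded
  by the iterates of the operator that omits core faces. The face of type \<open>i\<close> in the core of \<open>\<sigma>(T\<^sub>i)\<close> is the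
  missing child required for the comparison of the growth rates.
\<close>
lemma inflated_patches_have_thin_rim:
  fixes P :: "nat \<Rightarrow> 'a patch"
  assumes pre: "presubstitution \<sigma>" and prim: "primitive \<sigma>"
    and i: "i < ntiles \<sigma>" "core_contains_type (spatch \<sigma> i) i"
    and P0: "tile_copy \<sigma> i (P 0)" and glue: "\<And>k. glued_from \<sigma> (P k) (q k) (P (Suc k))"
  shows "\<exists>n. \<kappa> * card (rim_faces (P n)) < card (faces (P n))"
proof (rule ccontr)
  assume "\<not> ?thesis"
  then have iso: "card (faces (P n)) \<le> \<kappa> * card (rim_faces (P n))" for n by (meson not_less)
  define G where "G = (\<lambda>j. faces (spatch \<sigma> j))"
  define H where "H = (\<lambda>j. {g \<in> faces (spatch \<sigma> j). \<not> g \<subseteq> core (spatch \<sigma> j)})"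
  define ty where "ty = (\<lambda>j. flabel (spatch \<sigma> j))"
  have spatch: "polygon_patch (ntiles \<sigma>) (tile \<sigma>) (spatch \<sigma> j)" if "j < ntiles \<sigma>" for j
    by (rule polygon_patch_presubstitution[OF pre presubstitutionD(2)[OF pre that]])
  interpret type_substitution "ntiles \<sigma>" G H ty
  proof
    fix j assume j: "j < ntiles \<sigma>"
    show "finite (G j)" unfolding G_def by (rule polygon_patch.finite_faces[OF spatch[OF j]])
    show "H j \<subseteq> G j" unfolding G_def H_def by auto
    show "ty j g < ntiles \<sigma>" if "g \<in> G j" for g
      using that unfolding G_def ty_def by (rule polygon_patch.chart_homeomorphism(4)[OF spatch[OF j]])
  qed
  note patch = inflated_patch[OF P0 glue]
  have PP: "polygon_patch (ntiles \<sigma>) (tile \<sigma>) (P n)" for n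
    by (rule polygon_patch_presubstitution[OF pre patch])
  obtain f0 where f0: "faces (P 0) = {f0}" "flabel (P 0) f0 = i" using P0 unfolding tile_copy_def by auto
  have total: "(\<Sum>F\<in>faces (P n). \<psi> (flabel (P n) F)) = (A ^^ n) \<psi> i" for n \<psi>
  proof (induction n arbitrary: \<psi>)
    case 0
    then show ?case using f0 by simp
  next
    case (Suc n)
    obtain \<theta> where "gluing \<sigma> (P n) \<theta> (q n) (P (Suc n))" using glued_from_imp_gluing[OF pre patch glue] .
    then have "(\<Sum>F\<in>faces (P (Suc n)). \<psi> (flabel (P (Suc n)) F)) = (\<Sum>f\<in>faces (P n). A \<psi> (flabel (P n) f))"
      unfolding G_def ty_def by (rule gluing.sum_faces)
    then show ?case unfolding Suc.IH by (simp add: funpow_swap1)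
  qed
  have rim: "(\<Sum>F\<in>rim_faces (P n). \<psi> (flabel (P n) F)) \<le> (B ^^ n) \<psi> i" for n \<psi>
  proof (induction n arbitrary: \<psi>)
    case 0
    have "rim_faces (P 0) \<subseteq> {f0}" using f0(1) by (auto simp: rim_faces_def)
    then have "(\<Sum>F\<in>rim_faces (P 0). \<psi> (flabel (P 0) F)) \<le> (\<Sum>F\<in>{f0}. \<psi> (flabel (P 0) F))"
      by (intro sum_mono2) auto
    then show ?case using f0 by simp
  next
    case (Suc n)
    obtain \<theta> where "gluing \<sigma> (P n) \<theta> (q n) (P (Suc n))" using glued_from_imp_gluing[OF pre patch glue] .
    then have "(\<Sum>F\<in>rim_faces (P (Suc n)). \<psi> (flabel (P (Suc n)) F)) \<le> (\<Sum>f\<in>rim_faces (P n). B \<psi> (flabel (P n) f))"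
      unfolding H_def ty_def by (rule gluing.sum_rim_faces)
    also have "\<dots> \<le> (B ^^ n) (B \<psi>) i" by (rule Suc.IH)
    finally show ?case by (simp add: funpow_swap1)
  qed
  have le: "(A ^^ n) (\<lambda>_. 1) i \<le> \<kappa> * (B ^^ n) (\<lambda>_. 1) i" for n
  proof -
    have "(A ^^ n) (\<lambda>_. 1) i = card (faces (P n))" using total[where n = n and \<psi> = "\<lambda>_. 1"] by simp
    also have "\<dots> \<le> \<kappa> * card (rim_faces (P n))" by (rule iso)
    also have "\<dots> \<le> \<kappa> * (B ^^ n) (\<lambda>_. 1) i" using rim[where n = n and \<psi> = "\<lambda>_. 1"] by (intro mult_le_mono2) simp
    finally show ?thesis .
  qed
  have pos: "(A ^^ n) (\<lambda>_. 1) i > 0" for n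
  proof -
    obtain h where "homeomorphic_map (cspace (P n)) disc h" using polygon_patch.disc_homeomorphism[OF PP] .
    then have "h ` topspace (cspace (P n)) = cball 0 1" using homeomorphic_imp_surjective_map by force
    then have "0 \<in> h ` topspace (cspace (P n))" by simp
    then have "topspace (cspace (P n)) \<noteq> {}" by (rule contrapos_pn) simp
    then have "faces (P n) \<noteq> {}" using polygon_patch.topspace_eq_Union_faces[OF PP, of n] by auto
    then have "card (faces (P n)) > 0" using polygon_patch.finite_faces[OF PP, of n] by (simp add: card_gt_0_iff)
    then show ?thesis using total[where n = n and \<psi> = "\<lambda>_. 1"] by simp
  qed
  obtain k where k: "\<And>i j. i < ntiles \<sigma> \<Longrightarrow> j < ntiles \<sigma> \<Longrightarrow> occurs_after G ty k i j"
    using primitive_type_occurs[OF prim] unfolding G_def ty_def by blast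
  obtain g where g: "g \<in> G i - H i" "ty i g = i"
    using i(2) unfolding core_contains_type_def G_def H_def ty_def by auto
  obtain s C where C: "C \<ge> 1" "\<And>n. C ^ n * (B ^^ (n * s)) (\<lambda>_. 1) i \<le> (C - 1) ^ n * (A ^^ (n * s)) (\<lambda>_. 1) i"
    using thin_boundary[OF k i(1) g] by blast
  obtain n where n: "\<kappa> * (C - 1) ^ n < C ^ n" using geometric_gap[OF C(1)] by blast
  define b where "b = (B ^^ (n * s)) (\<lambda>_. 1) i"
  have "C ^ n * b \<le> (C - 1) ^ n * (\<kappa> * b)"
    using C(2)[of n] mult_le_mono2[OF le[of "n * s"], of "(C - 1) ^ n"] unfolding b_def by (rule order_trans)
  then have "C ^ n * b \<le> \<kappa> * (C - 1) ^ n * b" by (simp only: mult_ac)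
  moreover have "b > 0" using pos[of "n * s"] le[of "n * s"] unfolding b_def by (cases "(B ^^ (n * s)) (\<lambda>_. 1) i") auto
  ultimately have "C ^ n \<le> \<kappa> * (C - 1) ^ n" by simp
  then show False using n by simp
qed

theorem theorem7p1:
  shows "\<not> (\<exists>(\<Gamma> :: (complex \<Rightarrow> complex) set) (\<Lambda> :: 'l set) \<P> \<T>.
           primitive_substitutive_tiling TYPE('a) hyp_plane hyp_dist \<Gamma> \<Lambda> \<P> \<T>)"
proof
  assume "\<exists>(\<Gamma> :: (complex \<Rightarrow> complex) set) (\<Lambda> :: 'l set) \<P> \<T>.
           primitive_substitutive_tiling TYPE('a) hyp_plane hyp_dist \<Gamma> \<Lambda> \<P> \<T>"
  then obtain \<Gamma> :: "(complex \<Rightarrow> complex) set" and \<Lambda> :: "'l set" and \<P> \<T>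
    where ps: "primitive_substitutive_tiling TYPE('a) hyp_plane hyp_dist \<Gamma> \<Lambda> \<P> \<T>" by (elim exE)
  have T: "tiling hyp_plane hyp_dist \<Gamma> \<Lambda> \<P> \<T>"
    using ps unfolding primitive_substitutive_tiling_def by (rule conjunct1)
  let ?K = "tiling_complex hyp.mtopology \<P> \<T>"
  obtain \<sigma> :: "'a presubst" where sub: "topological_substitution \<sigma>" and prim: "primitive \<sigma>"
    and obt: "obtained_by_inflation ?K \<sigma>"
    using ps unfolding primitive_substitutive_tiling_def by (elim conjE exE)
  have pre: "presubstitution \<sigma>" using sub unfolding topological_substitution_def by (rule conjunct1)
  obtain i L where i: "i < ntiles \<sigma>" "core_contains_type (spatch \<sigma> i) i"
    and L: "inflation \<sigma> i L" "lcomplex_iso ?K L"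
    using obt unfolding obtained_by_inflation_def by (elim exE conjE)
  obtain P q where P0: "tile_copy \<sigma> i (P 0)" and glue: "\<forall>k. glued_from \<sigma> (P k) (q k) (P (Suc k))"
    and chain: "\<forall>k. subcomplex (P k) (P (Suc k)) \<and>
             (\<forall>f\<in>faces (P k).
                flabel (P (Suc k)) f = flabel (P k) f \<and>
                (\<forall>x\<in>f. chart (P (Suc k)) f x = chart (P k) f x) \<and>
                (\<forall>x\<in>topspace (cspace (fpatch \<sigma> (P k) f)). q (Suc k) (f, x) = q k (f, x)))"
    and top: "cspace L = union_topology (\<lambda>k. cspace (P k))"
    and verts: "verts L = (\<Union>k. verts (P k))" and faces: "faces L = (\<Union>k. faces (P k))"
    using L(1) unfolding inflation_def by (elim exE conjE)
  obtain h where h: "homeomorphic_map (cspace ?K) (cspace L) h" "h ` verts ?K = verts L"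
    "(`) h ` faces ?K = faces L"
    using L(2) unfolding lcomplex_iso_def by (elim exE conjE)
  have patch: "is_patch (ntiles \<sigma>) (tile \<sigma>) (P k)" for k by (rule inflated_patch[OF P0 spec[OF glue]])
  have "\<exists>\<kappa>. \<forall>n. card (faces (P n)) \<le> \<kappa> * card (rim_faces (P n))"
  proof (rule rim_isoperimetric_inequality[OF T pre patch])
    show "subcomplex (P k) (P (Suc k))" for k using spec[OF chain, of k] by (rule conjunct1)
    show "homeomorphic_map hyp.mtopology (union_topology (\<lambda>k. cspace (P k))) h"
      using h(1) unfolding top by (simp add: tiling_complex_def)
    show "h ` tiling_verts \<T> = (\<Union>k. verts (P k))" using h(2) unfolding verts by (simp add: tiling_complex_def)
    show "(`) h ` fst ` \<T> = (\<Union>k. faces (P k))" using h(3) unfolding faces by (simp add: tiling_complex_def)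
  qed
  then obtain \<kappa> where \<kappa>: "\<And>n. card (faces (P n)) \<le> \<kappa> * card (rim_faces (P n))" by (elim exE) blast
  obtain n where "\<kappa> * card (rim_faces (P n)) < card (faces (P n))"
    using inflated_patches_have_thin_rim[OF pre prim i P0 spec[OF glue], of \<kappa>] by (elim exE)
  then show False using \<kappa>[of n] by simp
qed

end
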